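(* Let $\mathcal{B}$ be an additive category and let $N\ge2$ be an integer. For any integer $s$, the $2N$-tuple $$(\mathcal{F}_{s+1}^{N-2},\ \mathcal{F}_{s}^{1},\ \mathcal{F}_{s+2}^{N-2},\ \mathcal{F}_{s+1}^{1},\ \dots,\ \mathcal{F}_{s+r+1}^{N-2},\ \mathcal{F}_{s+r}^{1},\ \dots,\ \mathcal{F}_{s+N-1}^{N-2},\ \mathcal{F}_{s+N-2}^{1},\ \mathcal{F}_{s}^{N-2},\ \mathcal{F}_{s+N-1}^{1})$$ (i.e. the pairs $\mathcal{F}_{s+r+1}^{N-2},\mathcal{F}_{s+r}^1$ for $r=0,1,\dots,N-1$ in this order, with $\mathcal{F}_{s+N}^{N-2}=\mathcal{F}_s^{N-2}$) is a $2N$-gon of recollements in $\mathsf{K}_N(\mathcal{B})$.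
   Context: An $N$-complex over $\mathcal{B}$ is a family of objects $X^i$ and morphisms $d_X^i:X^i\to X^{i+1}$ ($i\in\mathbb{Z}$) with $d_X^{i+N-1}\cdots d_X^{i+1}d_X^i=0$ for all $i$; morphisms are families commuting with $d$; the category is $\mathsf{C}_N(\mathcal{B})$. With conflations the sequences that are split short exact in each degree, $\mathsf{C}_N(\mathcal{B})$ is a Frobenius category. A morphism $f:X\to Y$ is null-homotopic if there are $s^i:X^i\to Y^{i-N+1}$ with $f^i=\sum_{j=1}^{N}d_Y^{i-1}\cdots d_Y^{i-N+j}\,s^{i+j-1}\,d_X^{i+j-2}\cdots d_X^i$ for all $i$. $\mathsf{K}_N(\mathcal{B})$ is the homotopy category of $N$-complexes; it is the stable category of $\mathsf{C}_N(\mathcal{B})$ and is triangulated as such, with translation $\Sigma$. For $0\le r<N$ and an integer $s$, $\mathcal{F}_s^r$ is the full subcategory of $\mathsf{K}_N(\mathcal{B})$ consisting of the objects (isomorphic to some) $(X^i,d^i)$ such that, for every $i\equiv s \bmod N$, $d^{i+k}=1_{X^{i+k}}$ for all $0\le k<r$ (a vacuous condition when $r=0$). A pair $(\mathcal{U},\mathcal{V})$ of full subcategories of a triangulated category $\mathcal{D}$ is a stable t-structure if $\mathcal{U}=\Sigma\mathcal{U}$, $\mathcal{V}=\Sigma\mathcal{V}$, $\operatorname{Hom}_{\mathcal{D}}(\mathcal{U},\mathcal{V})=0$, and every $X\in\mathcal{D}$ sits in a triangle $U\to X\to V\to\Sigma U$ with $U\in\mathcal{U}$, $V\in\mathcal{V}$.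 An $n$-tuple $(\mathcal{U}_1,\dots,\mathcal{U}_n)$ of full triangulated subcategories is an $n$-gon of recollements in $\mathcal{D}$ if $(\mathcal{U}_i,\mathcal{U}_{i+1})$ is a stable t-structure for $1\le i\le n$, where $\mathcal{U}_{n+1}=\mathcal{U}_1$. *)

theory Defs
  imports "HOL-Algebra.FiniteProduct" "HOL-Number_Theory.Cong"
begin

section \<open>Additive categories\<close>

text \<open>
  A category is given by sets of objects and arrows, as in Mac Lane; \<open>g \<cdot> f\<close> is meaningful
  when \<open>Cod f = Dom g\<close>. The fields \<open>Add\<close> and \<open>Zero\<close> carry the group structure of the hom-sets.
\<close>

record ('o, 'm) precat =
  Obj :: "'o set"
  Arr :: "'m set"
  Dom :: "'m \<Rightarrow> 'o"
  Cod :: "'m \<Rightarrow> 'o"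
  Ident :: "'o \<Rightarrow> 'm"
  Comp :: "'m \<Rightarrow> 'm \<Rightarrow> 'm"  (infixr "\<cdot>\<index>" 70)
  Add :: "'m \<Rightarrow> 'm \<Rightarrow> 'm"
  Zero :: "'o \<Rightarrow> 'o \<Rightarrow> 'm"

definition Homs :: "('o, 'm, 'z) precat_scheme \<Rightarrow> 'o \<Rightarrow> 'o \<Rightarrow> 'm set" where
  "Homs C X Y = {f \<in> Arr C. Dom C f = X \<and> Cod C f = Y}"

definition Hom_group :: "('o, 'm, 'z) precat_scheme \<Rightarrow> 'o \<Rightarrow> 'o \<Rightarrow> 'm monoid" where
  "Hom_group C X Y = \<lparr>carrier = Homs C X Y, monoid.mult = Add C, one = Zero C X Y\<rparr>"

definition Diff :: "('o, 'm, 'z) precat_scheme \<Rightarrow> 'm \<Rightarrow> 'm \<Rightarrow> 'm" where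
  "Diff C f g = Add C f (inv\<^bsub>Hom_group C (Dom C f) (Cod C f)\<^esub> g)"

locale category =
  fixes C :: "('o, 'm, 'z) precat_scheme" (structure)
  assumes Dom_closed: "f \<in> Arr C \<Longrightarrow> Dom C f \<in> Obj C"
    and Cod_closed: "f \<in> Arr C \<Longrightarrow> Cod C f \<in> Obj C"
    and Id_closed: "X \<in> Obj C \<Longrightarrow> Ident C X \<in> Homs C X X"
    and Comp_closed: "f \<in> Homs C X Y \<Longrightarrow> g \<in> Homs C Y Z \<Longrightarrow> g \<cdot> f \<in> Homs C X Z"
    and Comp_Id: "f \<in> Homs C X Y \<Longrightarrow> f \<cdot> Ident C X = f"
    and Id_Comp: "f \<in> Homs C X Y \<Longrightarrow> Ident C Y \<cdot> f = f"
    and Comp_assoc: "f \<in> Homs C W X \<Longrightarrow> g \<in> Homs C X Y \<Longrightarrow> h \<in> Homs C Y Z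
      \<Longrightarrow> (h \<cdot> g) \<cdot> f = h \<cdot> (g \<cdot> f)"

locale preadditive_category = category +
  assumes Hom_comm_group: "X \<in> Obj C \<Longrightarrow> Y \<in> Obj C \<Longrightarrow> comm_group (Hom_group C X Y)"
    and Comp_Add: "f \<in> Homs C X Y \<Longrightarrow> f' \<in> Homs C X Y \<Longrightarrow> g \<in> Homs C Y Z
      \<Longrightarrow> g \<cdot> Add C f f' = Add C (g \<cdot> f) (g \<cdot> f')"
    and Add_Comp: "f \<in> Homs C X Y \<Longrightarrow> g \<in> Homs C Y Z \<Longrightarrow> g' \<in> Homs C Y Z
      \<Longrightarrow> Add C g g' \<cdot> f = Add C (g \<cdot> f) (g' \<cdot> f)"

definition zero_object :: "('o, 'm, 'z) precat_scheme \<Rightarrow> 'o \<Rightarrow> bool" where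
  "zero_object C Z \<longleftrightarrow> Z \<in> Obj C \<and>
    (\<forall>X\<in>Obj C. (\<exists>!f. f \<in> Homs C X Z) \<and> (\<exists>!f. f \<in> Homs C Z X))"

definition biproduct :: "('o, 'm, 'z) precat_scheme \<Rightarrow> 'o \<Rightarrow> 'o \<Rightarrow> 'o \<Rightarrow> bool" where
  "biproduct C X Y S \<longleftrightarrow> S \<in> Obj C \<and>
    (\<exists>i\<in>Homs C X S. \<exists>j\<in>Homs C Y S. \<exists>p\<in>Homs C S X. \<exists>q\<in>Homs C S Y.
      p \<cdot>\<^bsub>C\<^esub> i = Ident C X \<and> q \<cdot>\<^bsub>C\<^esub> j = Ident C Y \<and>
      p \<cdot>\<^bsub>C\<^esub> j = Zero C Y X \<and> q \<cdot>\<^bsub>C\<^esub> i = Zero C X Y \<and>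
      Add C (i \<cdot>\<^bsub>C\<^esub> p) (j \<cdot>\<^bsub>C\<^esub> q) = Ident C S)"

locale additive_category = preadditive_category +
  assumes has_zero_object: "\<exists>Z. zero_object C Z"
    and has_biproducts: "X \<in> Obj C \<Longrightarrow> Y \<in> Obj C \<Longrightarrow> \<exists>S. biproduct C X Y S"

definition iso_arr :: "('o, 'm, 'z) precat_scheme \<Rightarrow> 'm \<Rightarrow> bool" where
  "iso_arr C f \<longleftrightarrow> f \<in> Arr C \<and>
    (\<exists>g\<in>Homs C (Cod C f) (Dom C f).
      g \<cdot>\<^bsub>C\<^esub> f = Ident C (Dom C f) \<and> f \<cdot>\<^bsub>C\<^esub> g = Ident C (Cod C f))"

definition isomorphic :: "('o, 'm, 'z) precat_scheme \<Rightarrow> 'o \<Rightarrow> 'o \<Rightarrow> bool" where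
  "isomorphic C X Y \<longleftrightarrow> (\<exists>f\<in>Homs C X Y. iso_arr C f)"

definition split_short_exact :: "('o, 'm, 'z) precat_scheme \<Rightarrow> 'm \<Rightarrow> 'm \<Rightarrow> bool" where
  "split_short_exact C f g \<longleftrightarrow> f \<in> Arr C \<and> g \<in> Arr C \<and> Cod C f = Dom C g \<and>
    g \<cdot>\<^bsub>C\<^esub> f = Zero C (Dom C f) (Cod C g) \<and>
    (\<exists>r\<in>Homs C (Cod C f) (Dom C f). \<exists>t\<in>Homs C (Cod C g) (Dom C g).
      r \<cdot>\<^bsub>C\<^esub> f = Ident C (Dom C f) \<and> g \<cdot>\<^bsub>C\<^esub> t = Ident C (Cod C g) \<and>
      Add C (f \<cdot>\<^bsub>C\<^esub> r) (t \<cdot>\<^bsub>C\<^esub> g) = Ident C (Cod C f))"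

definition pushout :: "('o, 'm, 'z) precat_scheme \<Rightarrow> 'm \<Rightarrow> 'm \<Rightarrow> 'm \<Rightarrow> 'm \<Rightarrow> bool" where
  \<comment> \<open>\<open>v\<close>, \<open>t\<close> are the legs opposite to \<open>i\<close> and \<open>u\<close>, respectively\<close>
  "pushout C u i v t \<longleftrightarrow>
    u \<in> Arr C \<and> i \<in> Arr C \<and> v \<in> Arr C \<and> t \<in> Arr C \<and>
    Dom C u = Dom C i \<and> Cod C u = Dom C v \<and> Cod C i = Dom C t \<and> Cod C v = Cod C t \<and>
    v \<cdot>\<^bsub>C\<^esub> u = t \<cdot>\<^bsub>C\<^esub> i \<and>
    (\<forall>W\<in>Obj C. \<forall>a\<in>Homs C (Cod C u) W. \<forall>b\<in>Homs C (Cod C i) W.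
      a \<cdot>\<^bsub>C\<^esub> u = b \<cdot>\<^bsub>C\<^esub> i \<longrightarrow>
      (\<exists>!c. c \<in> Homs C (Cod C v) W \<and> c \<cdot>\<^bsub>C\<^esub> v = a \<and> c \<cdot>\<^bsub>C\<^esub> t = b))"


section \<open>Stable t-structures and polygons of recollements\<close>

text \<open>
  A triangle \<open>X \<rightarrow> Y \<rightarrow> Z \<rightarrow> \<Sigma>X\<close> is represented by its three arrows. A full subcategory is
  represented by its set of objects.
\<close>

record ('o, 'm) tricat = "('o, 'm) precat" +
  shift_obj :: "'o \<Rightarrow> 'o"
  shift_arr :: "'m \<Rightarrow> 'm"
  triangles :: "('m \<times> 'm \<times> 'm) set"

definition shift_subcat :: "('o, 'm, 'z) tricat_scheme \<Rightarrow> 'o set \<Rightarrow> 'o set" where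
  \<comment> \<open>the translate of a subcategory, closed under isomorphism\<close>
  "shift_subcat D U = {Y \<in> Obj D. \<exists>X\<in>U. isomorphic D Y (shift_obj D X)}"

definition triangulated_subcat :: "('o, 'm, 'z) tricat_scheme \<Rightarrow> 'o set \<Rightarrow> bool" where
  "triangulated_subcat D U \<longleftrightarrow> U \<subseteq> Obj D \<and>
    (\<exists>Z\<in>U. zero_object D Z) \<and>
    (\<forall>X\<in>U. \<forall>Y\<in>Obj D. isomorphic D X Y \<longrightarrow> Y \<in> U) \<and>
    U = shift_subcat D U \<and>
    (\<forall>(u, v, w)\<in>triangles D.
      let X = Dom D u; Y = Dom D v; Z = Dom D w in
      (X \<in> U \<and> Y \<in> U \<longrightarrow> Z \<in> U) \<and>
      (Y \<in> U \<and> Z \<in> U \<longrightarrow> X \<in> U) \<and>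
      (X \<in> U \<and> Z \<in> U \<longrightarrow> Y \<in> U))"

definition stable_t_structure :: "('o, 'm, 'z) tricat_scheme \<Rightarrow> 'o set \<Rightarrow> 'o set \<Rightarrow> bool" where
  "stable_t_structure D U V \<longleftrightarrow> U \<subseteq> Obj D \<and> V \<subseteq> Obj D \<and>
    U = shift_subcat D U \<and> V = shift_subcat D V \<and>
    (\<forall>X\<in>U. \<forall>Y\<in>V. Homs D X Y = {Zero D X Y}) \<and>
    (\<forall>X\<in>Obj D. \<exists>(u, v, w)\<in>triangles D. Dom D u \<in> U \<and> Dom D v = X \<and> Dom D w \<in> V)"

definition polygon_of_recollements ::
    "('o, 'm, 'z) tricat_scheme \<Rightarrow> nat \<Rightarrow> 'o set list \<Rightarrow> bool" where
  "polygon_of_recollements D n Us \<longleftrightarrow> length Us = n \<and>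
    (\<forall>U\<in>set Us. triangulated_subcat D U) \<and>
    (\<forall>i<n. stable_t_structure D (Us ! i) (Us ! (Suc i mod n)))"


section \<open>The stable category of a Frobenius category\<close>

definition quotient_arr :: "('m \<times> 'm) set \<Rightarrow> 'm \<Rightarrow> 'm set" where
  "quotient_arr R f = R `` {f}"

text \<open>The quotient of a preadditive category by a congruence \<open>R\<close> on its arrows.\<close>

definition quotient_cat :: "('o, 'm, 'z) precat_scheme \<Rightarrow> ('m \<times> 'm) set \<Rightarrow> ('o, 'm set) precat" where
  "quotient_cat C R =
    \<lparr>Obj = Obj C,
     Arr = Arr C // R,
     Dom = (\<lambda>F. Dom C (SOME f. f \<in> F)),
     Cod = (\<lambda>F. Cod C (SOME f. f \<in> F)),
     Ident = (\<lambda>X. quotient_arr R (Ident C X)),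
     Comp = (\<lambda>G F. quotient_arr R ((SOME g. g \<in> G) \<cdot>\<^bsub>C\<^esub> (SOME f. f \<in> F))),
     Add = (\<lambda>F G. quotient_arr R (Add C (SOME f. f \<in> F) (SOME g. g \<in> G))),
     Zero = (\<lambda>X Y. quotient_arr R (Zero C X Y))\<rparr>"

text \<open>Below, \<open>E\<close> is the class of conflations, each given by its inflation and its deflation.\<close>

definition injective_object :: "('o, 'm, 'z) precat_scheme \<Rightarrow> ('m \<times> 'm) set \<Rightarrow> 'o \<Rightarrow> bool" where
  "injective_object C E J \<longleftrightarrow> J \<in> Obj C \<and>
    (\<forall>(f, g)\<in>E. \<forall>h\<in>Homs C (Dom C f) J. \<exists>k\<in>Homs C (Cod C f) J. k \<cdot>\<^bsub>C\<^esub> f = h)"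

definition injective_hull :: "('o, 'm, 'z) precat_scheme \<Rightarrow> ('m \<times> 'm) set \<Rightarrow> 'o \<Rightarrow> 'm \<times> 'm" where
  \<comment> \<open>a chosen conflation \<open>X \<rightarrow> I(X) \<rightarrow> \<Sigma>X\<close> with \<open>I(X)\<close> injective (no minimality is required)\<close>
  "injective_hull C E X =
    (SOME (i, p). (i, p) \<in> E \<and> Dom C i = X \<and> injective_object C E (Cod C i))"

abbreviation hull_inc :: "('o, 'm, 'z) precat_scheme \<Rightarrow> ('m \<times> 'm) set \<Rightarrow> 'o \<Rightarrow> 'm" where
  "hull_inc C E X \<equiv> fst (injective_hull C E X)"

abbreviation hull_proj :: "('o, 'm, 'z) precat_scheme \<Rightarrow> ('m \<times> 'm) set \<Rightarrow> 'o \<Rightarrow> 'm" where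
  "hull_proj C E X \<equiv> snd (injective_hull C E X)"

definition suspension :: "('o, 'm, 'z) precat_scheme \<Rightarrow> ('m \<times> 'm) set \<Rightarrow> 'o \<Rightarrow> 'o" where
  "suspension C E X = Cod C (hull_proj C E X)"

definition suspends :: "('o, 'm, 'z) precat_scheme \<Rightarrow> ('m \<times> 'm) set \<Rightarrow> 'm \<Rightarrow> 'm \<Rightarrow> bool" where
  \<comment> \<open>\<open>g : \<Sigma>X \<rightarrow> \<Sigma>Y\<close> is induced by an extension of \<open>f : X \<rightarrow> Y\<close> to \<open>I(X) \<rightarrow> I(Y)\<close>\<close>
  "suspends C E f g \<longleftrightarrow>
    (let X = Dom C f; Y = Cod C f in
      g \<in> Homs C (suspension C E X) (suspension C E Y) \<and>
      (\<exists>h\<in>Homs C (Cod C (hull_inc C E X)) (Cod C (hull_inc C E Y)).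
        h \<cdot>\<^bsub>C\<^esub> hull_inc C E X = hull_inc C E Y \<cdot>\<^bsub>C\<^esub> f \<and>
        g \<cdot>\<^bsub>C\<^esub> hull_proj C E X = hull_proj C E Y \<cdot>\<^bsub>C\<^esub> h))"

definition stable_shift_arr ::
    "('o, 'm, 'z) precat_scheme \<Rightarrow> ('m \<times> 'm) set \<Rightarrow> ('m \<times> 'm) set \<Rightarrow> 'm set \<Rightarrow> 'm set" where
  "stable_shift_arr C E R F = quotient_arr R (SOME g. \<exists>f\<in>F. suspends C E f g)"

text \<open>
  The standard triangle on \<open>u : X \<rightarrow> Y\<close> is \<open>X \<rightarrow> Y \<rightarrow> C\<^sub>u \<rightarrow> \<Sigma>X\<close>, where \<open>C\<^sub>u\<close> is the pushout of
  \<open>u\<close> along \<open>X \<rightarrow> I(X)\<close> and \<open>C\<^sub>u \<rightarrow> \<Sigma>X\<close> is induced by \<open>0 : Y \<rightarrow> \<Sigma>X\<close> and \<open>I(X) \<rightarrow> \<Sigma>X\<close>.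
  The triangles of the stable category are the triples isomorphic to standard ones.
\<close>

definition standard_triangles ::
    "('o, 'm, 'z) precat_scheme \<Rightarrow> ('m \<times> 'm) set \<Rightarrow> ('m \<times> 'm) set
      \<Rightarrow> ('m set \<times> 'm set \<times> 'm set) set" where
  "standard_triangles C E R =
    {(quotient_arr R u, quotient_arr R v, quotient_arr R w) | u v w.
      \<exists>t. pushout C u (hull_inc C E (Dom C u)) v t \<and>
        w \<in> Homs C (Cod C v) (suspension C E (Dom C u)) \<and>
        w \<cdot>\<^bsub>C\<^esub> v = Zero C (Cod C u) (suspension C E (Dom C u)) \<and>
        w \<cdot>\<^bsub>C\<^esub> t = hull_proj C E (Dom C u)}"

definition stable_triangles ::
    "('o, 'm, 'z) precat_scheme \<Rightarrow> ('m \<times> 'm) set \<Rightarrow> ('m \<times> 'm) set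
      \<Rightarrow> ('m set \<times> 'm set \<times> 'm set) set" where
  "stable_triangles C E R =
    (let Q = quotient_cat C R in
      {(u, v, w). u \<in> Arr Q \<and> v \<in> Arr Q \<and> w \<in> Arr Q \<and>
        Cod Q u = Dom Q v \<and> Cod Q v = Dom Q w \<and> Cod Q w = suspension C E (Dom Q u) \<and>
        (\<exists>(u', v', w')\<in>standard_triangles C E R.
          \<exists>a\<in>Homs Q (Dom Q u) (Dom Q u').
          \<exists>b\<in>Homs Q (Dom Q v) (Dom Q v').
          \<exists>c\<in>Homs Q (Dom Q w) (Dom Q w').
            iso_arr Q a \<and> iso_arr Q b \<and> iso_arr Q c \<and>
            b \<cdot>\<^bsub>Q\<^esub> u = u' \<cdot>\<^bsub>Q\<^esub> a \<and>
            c \<cdot>\<^bsub>Q\<^esub> v = v' \<cdot>\<^bsub>Q\<^esub> b \<and>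
            stable_shift_arr C E R a \<cdot>\<^bsub>Q\<^esub> w = w' \<cdot>\<^bsub>Q\<^esub> c)})"

definition stable_cat ::
    "('o, 'm, 'z) precat_scheme \<Rightarrow> ('m \<times> 'm) set \<Rightarrow> ('m \<times> 'm) set \<Rightarrow> ('o, 'm set) tricat" where
  "stable_cat C E R =
    precat.extend (quotient_cat C R)
      (tricat.fields (suspension C E) (stable_shift_arr C E R) (stable_triangles C E R))"


section \<open>\<open>N\<close>-complexes\<close>

record ('o, 'm) ncomplex =
  deg :: "int \<Rightarrow> 'o"
  diff :: "int \<Rightarrow> 'm"

record ('o, 'm) chain_map =
  source :: "('o, 'm) ncomplex"
  target :: "('o, 'm) ncomplex"
  component :: "int \<Rightarrow> 'm"

text \<open>\<open>diff_iter B X i k\<close> is the composite \<open>d\<^sup>i\<^sup>+\<^sup>k\<^sup>-\<^sup>1 \<cdots> d\<^sup>i : X\<^sup>i \<rightarrow> X\<^sup>i\<^sup>+\<^sup>k\<close>.\<close>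

fun diff_iter :: "('o, 'm, 'z) precat_scheme \<Rightarrow> ('o, 'm) ncomplex \<Rightarrow> int \<Rightarrow> nat \<Rightarrow> 'm" where
  "diff_iter B X i 0 = Ident B (deg X i)"
| "diff_iter B X i (Suc k) = diff X (i + int k) \<cdot>\<^bsub>B\<^esub> diff_iter B X i k"

definition ncomplexes :: "('o, 'm, 'z) precat_scheme \<Rightarrow> nat \<Rightarrow> ('o, 'm) ncomplex set" where
  "ncomplexes B N = {X. \<forall>i. deg X i \<in> Obj B \<and> diff X i \<in> Homs B (deg X i) (deg X (i + 1)) \<and>
    diff_iter B X i N = Zero B (deg X i) (deg X (i + int N))}"

definition chain_maps :: "('o, 'm, 'z) precat_scheme \<Rightarrow> nat \<Rightarrow> ('o, 'm) chain_map set" where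
  "chain_maps B N = {f. source f \<in> ncomplexes B N \<and> target f \<in> ncomplexes B N \<and>
    (\<forall>i. component f i \<in> Homs B (deg (source f) i) (deg (target f) i) \<and>
      component f (i + 1) \<cdot>\<^bsub>B\<^esub> diff (source f) i = diff (target f) i \<cdot>\<^bsub>B\<^esub> component f i)}"

definition C_cat ::
    "('o, 'm, 'z) precat_scheme \<Rightarrow> nat \<Rightarrow> (('o, 'm) ncomplex, ('o, 'm) chain_map) precat" where
  "C_cat B N =
    \<lparr>Obj = ncomplexes B N,
     Arr = chain_maps B N,
     Dom = source,
     Cod = target,
     Ident = (\<lambda>X. \<lparr>source = X, target = X, component = (\<lambda>i. Ident B (deg X i))\<rparr>),
     Comp = (\<lambda>g f. \<lparr>source = source f, target = target g,
       component = (\<lambda>i. component g i \<cdot>\<^bsub>B\<^esub> component f i)\<rparr>),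
     Add = (\<lambda>f g. \<lparr>source = source f, target = target f,
       component = (\<lambda>i. Add B (component f i) (component g i))\<rparr>),
     Zero = (\<lambda>X Y. \<lparr>source = X, target = Y, component = (\<lambda>i. Zero B (deg X i) (deg Y i))\<rparr>)\<rparr>"

definition conflations ::
    "('o, 'm, 'z) precat_scheme \<Rightarrow> nat \<Rightarrow> (('o, 'm) chain_map \<times> ('o, 'm) chain_map) set" where
  "conflations B N = {(f, g). f \<in> chain_maps B N \<and> g \<in> chain_maps B N \<and> target f = source g \<and>
    (\<forall>i. split_short_exact B (component f i) (component g i))}"

text \<open>
  The summation \<open>finprod\<close> is taken in the group of arrows \<open>X\<^sup>i \<rightarrow> Y\<^sup>i\<close>, whose operation is the
  addition of arrows.
\<close>

definition null_homotopic :: "('o, 'm, 'z) precat_scheme \<Rightarrow> nat \<Rightarrow> ('o, 'm) chain_map \<Rightarrow> bool" where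
  "null_homotopic B N f \<longleftrightarrow>
    (let X = source f; Y = target f in
      \<exists>s. (\<forall>i. s i \<in> Homs B (deg X i) (deg Y (i - int N + 1))) \<and>
        (\<forall>i. component f i =
          finprod (Hom_group B (deg X i) (deg Y i))
            (\<lambda>j. diff_iter B Y (i - int N + int j) (N - j) \<cdot>\<^bsub>B\<^esub>
                 s (i + int j - 1) \<cdot>\<^bsub>B\<^esub> diff_iter B X i (j - 1))
            {1..N}))"

definition homotopy ::
    "('o, 'm, 'z) precat_scheme \<Rightarrow> nat \<Rightarrow> (('o, 'm) chain_map \<times> ('o, 'm) chain_map) set" where
  "homotopy B N = {(f, g). f \<in> chain_maps B N \<and> g \<in> chain_maps B N \<and>
    source f = source g \<and> target f = target g \<and> null_homotopic B N (Diff (C_cat B N) f g)}"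

definition K_cat ::
    "('o, 'm, 'z) precat_scheme \<Rightarrow> nat \<Rightarrow> (('o, 'm) ncomplex, ('o, 'm) chain_map set) tricat" where
  "K_cat B N = stable_cat (C_cat B N) (conflations B N) (homotopy B N)"

text \<open>
  An equation \<open>d\<^sup>i = 1\<close> entails that the source \<open>X\<^sup>i\<close> and the target \<open>X\<^sup>i\<^sup>+\<^sup>1\<close> coincide.
\<close>

definition F_subcat ::
    "('o, 'm, 'z) precat_scheme \<Rightarrow> nat \<Rightarrow> int \<Rightarrow> nat \<Rightarrow> ('o, 'm) ncomplex set" where
  "F_subcat B N s r = {Y \<in> Obj (K_cat B N). \<exists>X\<in>Obj (K_cat B N). isomorphic (K_cat B N) Y X \<and>
    (\<forall>i. [i = s] (mod int N) \<longrightarrow>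
      (\<forall>k<r. diff X (i + int k) = Ident B (deg X (i + int k))))}"

lemma F_subcat_periodic: "F_subcat B N (s + int N) r = F_subcat B N s r"
  by (simp add: F_subcat_def cong_def)

end

theory Submission
  imports Defs
begin

text \<open>
  A monotone map \<open>\<phi> : \<int> \<rightarrow> \<int>\<close> with \<open>\<phi>(i + N) = \<phi>(i) + N\<close> acts on \<open>N\<close>-complexes by reindexing,
  \<open>(X \<circ> \<phi>)\<^sup>i = X\<^bsup>\<phi>(i)\<^esup>\<close> with composites of \<open>d\<close> as differential; this action respects conflations and
  homotopies, and \<open>\<phi> \<le> \<psi>\<close> gives a natural map \<open>X \<circ> \<phi> \<rightarrow> X \<circ> \<psi>\<close>. If \<open>mid\<close> is the step map with
  constant value \<open>s + r\<close> from \<open>s\<close> to \<open>s + N - 1\<close>, then \<open>X \<circ> mid\<close> is contractible, \<open>X \<circ> min(id, mid)\<close>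
  lies in \<open>\<F>\<^sub>s\<^sub>+\<^sub>r\<^bsup>N-1-r\<^esup>\<close>, \<open>X \<circ> max(id, mid)\<close> lies in \<open>\<F>\<^sub>s\<^sup>r\<close>, and the evident square of natural maps is
  a conflation \<open>X \<circ> min(id, mid) \<rightarrow> X \<oplus> (X \<circ> mid) \<rightarrow> X \<circ> max(id, mid)\<close>. A map from the first
  subcategory to the second factors through a complex of the form \<open>X \<circ> mid\<close>, hence vanishes in the
  homotopy category; and reindexing an injective hull of \<open>X = X \<circ> \<phi>\<close> shows that the subcategories are
  stable under \<open>\<Sigma>\<close>. So \<open>(\<F>\<^sub>s\<^sub>+\<^sub>r\<^bsup>N-1-r\<^esup>, \<F>\<^sub>s\<^sup>r)\<close> is a stable t-structure for all \<open>s\<close> and \<open>r < N\<close>; the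
  corollary consists of the cases \<open>r = 1\<close> and \<open>r = N - 2\<close>. Each \<open>\<F>\<^sub>s\<^sup>r\<close> is triangulated because it is the
  full left orthogonal of its right neighbour.
\<close>

section \<open>Arithmetic in preadditive categories\<close>

text \<open>The locale \<open>frobenius\<close> takes the ideal \<open>Null\<close> as primitive, so
  that the explicit homotopy sums only serve to verify its axioms; injectives are recovered as the
  objects with null identity. The argument does not presuppose that \<open>K_cat\<close> satisfies
  the axioms of a triangulated category: closure under two out of three is a diagram chase with
  pushouts of complexes.

  Equivariance of \<open>\<phi>\<close> under translation by \<open>N\<close> does two things. It
  keeps composites of \<open>N\<close> differentials zero, and it cuts the window of
  \<open>N\<close> degrees entering a homotopy at \<open>\<phi> i\<close> into \<open>N\<close>
  blocks indexed by the window at \<open>i\<close>, which gives the transported homotopy. Injective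
  hulls are themselves reindexings: rounding degrees up to one residue class modulo \<open>N\<close>
  yields a contractible complex and a map that is an identity in that class, and finitely many of
  these are summed.

  The delicate inclusion is that a left orthogonal complex is homotopy equivalent to its truncation
  \<open>reindex low X\<close>. The truncation conflation yields only a one-sided homotopy inverse;
  idempotence of \<open>low\<close> makes it two-sided.\<close>

context category
begin

lemma in_Homs: "f \<in> Homs C X Y \<longleftrightarrow> f \<in> Arr C \<and> Dom C f = X \<and> Cod C f = Y"
  by (auto simp: Homs_def)

lemma comp_arr:
  assumes "f \<in> Arr C" "g \<in> Arr C" "Dom C g = Cod C f"
  shows "g \<cdot> f \<in> Arr C" "Dom C (g \<cdot> f) = Dom C f" "Cod C (g \<cdot> f) = Cod C g"
  using Comp_closed[of f "Dom C f" "Cod C f" g "Cod C g"] assms by (simp_all add: in_Homs)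

lemma ident_arr:
  assumes "X \<in> Obj C"
  shows "Ident C X \<in> Arr C" "Dom C (Ident C X) = X" "Cod C (Ident C X) = X"
  using Id_closed[OF assms] by (simp_all add: in_Homs)

lemma comp_ident: "f \<in> Arr C \<Longrightarrow> Dom C f = X \<Longrightarrow> f \<cdot> Ident C X = f"
  using Comp_Id[of f X "Cod C f"] by (simp add: in_Homs)

lemma ident_comp: "f \<in> Arr C \<Longrightarrow> Cod C f = X \<Longrightarrow> Ident C X \<cdot> f = f"
  using Id_Comp[of f "Dom C f" X] by (simp add: in_Homs)

lemma comp_assoc:
  assumes "f \<in> Arr C" "g \<in> Arr C" "h \<in> Arr C" "Dom C g = Cod C f" "Dom C h = Cod C g"
  shows "(h \<cdot> g) \<cdot> f = h \<cdot> (g \<cdot> f)"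
  using Comp_assoc[of f "Dom C f" "Cod C f" g "Cod C g" h "Cod C h"] assms by (simp add: in_Homs)

text \<open>The rewrite rules bracket composites to the right, which hides a known product
  \<open>g \<cdot> f\<close> inside \<open>g \<cdot> (f \<cdot> x)\<close>; in this form the
  equation can still be applied there.\<close>

lemma comp_reduce:
  assumes "g \<cdot> f = e" "f \<in> Arr C" "g \<in> Arr C" "Dom C g = Cod C f" "x \<in> Arr C" "Dom C f = Cod C x"
  shows "g \<cdot> (f \<cdot> x) = e \<cdot> x"
  using assms comp_assoc[of x f g] by simp

lemmas cat = Dom_closed Cod_closed comp_arr ident_arr comp_ident ident_comp comp_assoc

end

context preadditive_category
begin

text \<open>The hom-group is read off the arrow itself, so negation is a unary operation. It agrees
  with the inverse in \<open>Diff\<close> whenever the two arrows are parallel.\<close>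

definition neg  ("\<ominus> _" [81] 80) where
  "\<ominus> f = inv\<^bsub>Hom_group C (Dom C f) (Cod C f)\<^esub> f"

abbreviation add  (infixl "\<oplus>" 65) where
  "f \<oplus> g \<equiv> Add C f g"

lemma carrier_Hom_group: "carrier (Hom_group C X Y) = Homs C X Y"
  and mult_Hom_group: "x \<otimes>\<^bsub>Hom_group C X Y\<^esub> y = x \<oplus> y"
  and one_Hom_group: "\<one>\<^bsub>Hom_group C X Y\<^esub> = Zero C X Y"
  by (simp_all add: Hom_group_def)

lemmas Hom_group_simps = carrier_Hom_group mult_Hom_group one_Hom_group

lemma hom_group: "f \<in> Arr C \<Longrightarrow> comm_group (Hom_group C (Dom C f) (Cod C f))"
  by (simp add: Hom_comm_group Dom_closed Cod_closed)

lemma zero_arr: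
  assumes "X \<in> Obj C" "Y \<in> Obj C"
  shows "Zero C X Y \<in> Arr C" "Dom C (Zero C X Y) = X" "Cod C (Zero C X Y) = Y"
proof -
  interpret G: comm_group "Hom_group C X Y" using assms by (rule Hom_comm_group)
  show "Zero C X Y \<in> Arr C" "Dom C (Zero C X Y) = X" "Cod C (Zero C X Y) = Y"
    using G.one_closed by (simp_all add: Hom_group_simps in_Homs)
qed

lemma add_arr:
  assumes "f \<in> Arr C" "g \<in> Arr C" "Dom C g = Dom C f" "Cod C g = Cod C f"
  shows "f \<oplus> g \<in> Arr C" "Dom C (f \<oplus> g) = Dom C f" "Cod C (f \<oplus> g) = Cod C f"
proof -
  interpret G: comm_group "Hom_group C (Dom C f) (Cod C f)" using assms(1) by (rule hom_group)
  show "f \<oplus> g \<in> Arr C" "Dom C (f \<oplus> g) = Dom C f" "Cod C (f \<oplus> g) = Cod C f"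
    using G.m_closed[of f g] assms by (simp_all add: Hom_group_simps in_Homs)
qed

lemma neg_arr:
  assumes "f \<in> Arr C"
  shows "\<ominus> f \<in> Arr C" "Dom C (\<ominus> f) = Dom C f" "Cod C (\<ominus> f) = Cod C f"
proof -
  interpret G: comm_group "Hom_group C (Dom C f) (Cod C f)" using assms(1) by (rule hom_group)
  show "\<ominus> f \<in> Arr C" "Dom C (\<ominus> f) = Dom C f" "Cod C (\<ominus> f) = Cod C f"
    using G.inv_closed[of f] assms by (simp_all add: neg_def Hom_group_simps in_Homs)
qed

lemma add_assoc:
  assumes "f \<in> Arr C" "g \<in> Arr C" "h \<in> Arr C"
    "Dom C g = Dom C f" "Cod C g = Cod C f" "Dom C h = Dom C f" "Cod C h = Cod C f"
  shows "f \<oplus> g \<oplus> h = f \<oplus> (g \<oplus> h)"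
proof -
  interpret G: comm_group "Hom_group C (Dom C f) (Cod C f)" using assms(1) by (rule hom_group)
  show ?thesis using G.m_assoc[of f g h] assms by (simp add: Hom_group_simps in_Homs)
qed

lemma add_commute:
  assumes "f \<in> Arr C" "g \<in> Arr C" "Dom C g = Dom C f" "Cod C g = Cod C f"
  shows "f \<oplus> g = g \<oplus> f"
proof -
  interpret G: comm_group "Hom_group C (Dom C f) (Cod C f)" using assms(1) by (rule hom_group)
  show ?thesis using G.m_comm[of f g] assms by (simp add: Hom_group_simps in_Homs)
qed

lemma add_left_commute:
  assumes "f \<in> Arr C" "g \<in> Arr C" "h \<in> Arr C"
    "Dom C g = Dom C f" "Cod C g = Cod C f" "Dom C h = Dom C f" "Cod C h = Cod C f"
  shows "f \<oplus> (g \<oplus> h) = g \<oplus> (f \<oplus> h)"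
proof -
  interpret G: comm_group "Hom_group C (Dom C f) (Cod C f)" using assms(1) by (rule hom_group)
  show ?thesis using G.m_lcomm[of f g h] assms by (simp add: Hom_group_simps in_Homs)
qed

lemma zero_add:
  assumes "f \<in> Arr C" "Dom C f = X" "Cod C f = Y"
  shows "Zero C X Y \<oplus> f = f" "f \<oplus> Zero C X Y = f"
proof -
  interpret G: comm_group "Hom_group C (Dom C f) (Cod C f)" using assms(1) by (rule hom_group)
  show "Zero C X Y \<oplus> f = f" "f \<oplus> Zero C X Y = f"
    using G.l_one[of f] G.r_one[of f] assms by (simp_all add: Hom_group_simps in_Homs)
qed

lemma add_neg:
  assumes "f \<in> Arr C"
  shows "f \<oplus> \<ominus> f = Zero C (Dom C f) (Cod C f)" "\<ominus> f \<oplus> f = Zero C (Dom C f) (Cod C f)"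
proof -
  interpret G: comm_group "Hom_group C (Dom C f) (Cod C f)" using assms(1) by (rule hom_group)
  show "f \<oplus> \<ominus> f = Zero C (Dom C f) (Cod C f)" "\<ominus> f \<oplus> f = Zero C (Dom C f) (Cod C f)"
    using G.r_inv[of f] G.l_inv[of f] assms by (simp_all add: neg_def Hom_group_simps in_Homs)
qed

lemma add_neg_cancel:
  assumes "f \<in> Arr C" "g \<in> Arr C" "Dom C g = Dom C f" "Cod C g = Cod C f"
  shows "f \<oplus> (\<ominus> f \<oplus> g) = g" "\<ominus> f \<oplus> (f \<oplus> g) = g"
  using assms add_assoc[of f "\<ominus> f" g] add_assoc[of "\<ominus> f" f g]
  by (simp_all add: neg_arr add_neg zero_add)

lemma add_left_cancel:
  assumes "f \<oplus> g = f \<oplus> h" "f \<in> Arr C" "g \<in> Arr C" "h \<in> Arr C"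
    "Dom C g = Dom C f" "Cod C g = Cod C f" "Dom C h = Dom C f" "Cod C h = Cod C f"
  shows "g = h"
  using assms by (metis add_neg_cancel(2))

lemma neg_unique:
  assumes "f \<oplus> g = Zero C (Dom C f) (Cod C f)" "f \<in> Arr C" "g \<in> Arr C"
    "Dom C g = Dom C f" "Cod C g = Cod C f"
  shows "\<ominus> f = g"
  using assms by (intro add_left_cancel[of f "\<ominus> f" g]) (simp_all add: neg_arr add_neg)

lemma diff_eq_neg:
  "f \<in> Arr C \<Longrightarrow> g \<in> Arr C \<Longrightarrow> Dom C g = Dom C f \<Longrightarrow> Cod C g = Cod C f \<Longrightarrow> Diff C f g = f \<oplus> \<ominus> g"
  by (simp add: Diff_def neg_def)

lemma neg_neg: "f \<in> Arr C \<Longrightarrow> \<ominus> (\<ominus> f) = f"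
  by (rule neg_unique) (simp_all add: neg_arr add_neg)

lemma neg_zero: "X \<in> Obj C \<Longrightarrow> Y \<in> Obj C \<Longrightarrow> \<ominus> Zero C X Y = Zero C X Y"
  by (rule neg_unique) (simp_all add: zero_arr zero_add)

lemma neg_add:
  assumes "f \<in> Arr C" "g \<in> Arr C" "Dom C g = Dom C f" "Cod C g = Cod C f"
  shows "\<ominus> (f \<oplus> g) = \<ominus> f \<oplus> \<ominus> g"
  using assms
  by (intro neg_unique)
    (simp_all add: neg_arr add_arr add_neg add_assoc add_left_commute[of g "\<ominus> f"] zero_add)

lemma comp_add:
  assumes "f \<in> Arr C" "g \<in> Arr C" "h \<in> Arr C" "Dom C g = Dom C f" "Cod C g = Cod C f"
    "Dom C h = Cod C f"
  shows "h \<cdot> (f \<oplus> g) = h \<cdot> f \<oplus> h \<cdot> g"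
  using Comp_Add[of f "Dom C f" "Cod C f" g h "Cod C h"] assms by (simp add: in_Homs)

lemma add_comp:
  assumes "f \<in> Arr C" "g \<in> Arr C" "h \<in> Arr C" "Dom C g = Dom C f" "Cod C g = Cod C f"
    "Dom C f = Cod C h"
  shows "(f \<oplus> g) \<cdot> h = f \<cdot> h \<oplus> g \<cdot> h"
  using Add_Comp[of h "Dom C h" "Cod C h" f "Cod C f" g] assms by (simp add: in_Homs)

lemma comp_zero:
  assumes "f \<in> Arr C" "Dom C f = Y" "X \<in> Obj C"
  shows "f \<cdot> Zero C X Y = Zero C X (Cod C f)"
proof -
  have Y: "Y \<in> Obj C" using assms Dom_closed by auto
  have "f \<cdot> Zero C X Y \<oplus> f \<cdot> Zero C X Y = f \<cdot> (Zero C X Y \<oplus> Zero C X Y)"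
    using assms Y by (simp add: comp_add zero_arr)
  also have "\<dots> = f \<cdot> Zero C X Y \<oplus> Zero C X (Cod C f)"
    using assms Y by (simp add: zero_arr zero_add cat)
  finally show ?thesis
    by (rule add_left_cancel) (use assms Y in \<open>simp_all add: zero_arr cat\<close>)
qed

lemma zero_comp:
  assumes "f \<in> Arr C" "Cod C f = X" "Y \<in> Obj C"
  shows "Zero C X Y \<cdot> f = Zero C (Dom C f) Y"
proof -
  have X: "X \<in> Obj C" using assms Cod_closed by auto
  have "Zero C X Y \<cdot> f \<oplus> Zero C X Y \<cdot> f = (Zero C X Y \<oplus> Zero C X Y) \<cdot> f"
    using assms X by (simp add: add_comp zero_arr)
  also have "\<dots> = Zero C X Y \<cdot> f \<oplus> Zero C (Dom C f) Y"
    using assms X by (simp add: zero_arr zero_add cat)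
  finally show ?thesis
    by (rule add_left_cancel) (use assms X in \<open>simp_all add: zero_arr cat\<close>)
qed

lemma comp_neg:
  assumes "f \<in> Arr C" "g \<in> Arr C" "Dom C g = Cod C f"
  shows "g \<cdot> \<ominus> f = \<ominus> (g \<cdot> f)"
proof -
  have "g \<cdot> f \<oplus> g \<cdot> \<ominus> f = Zero C (Dom C f) (Cod C g)"
    using assms by (simp add: comp_add[symmetric] add_neg neg_arr comp_zero cat)
  then show ?thesis
    using assms by (intro neg_unique[symmetric]) (simp_all add: cat neg_arr)
qed

lemma neg_comp:
  assumes "f \<in> Arr C" "g \<in> Arr C" "Dom C g = Cod C f"
  shows "\<ominus> g \<cdot> f = \<ominus> (g \<cdot> f)"
proof -
  have "g \<cdot> f \<oplus> \<ominus> g \<cdot> f = Zero C (Dom C f) (Cod C g)"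
    using assms by (simp add: add_comp[symmetric] add_neg neg_arr zero_comp cat)
  then show ?thesis
    using assms by (intro neg_unique[symmetric]) (simp_all add: cat neg_arr)
qed

text \<open>The normal form: sums and composites bracketed to the right, composition distributed
  over sums, negation moved outside composites and inside sums. Commutativity of addition is kept
  out, hence the explicit instances of \<open>add_commute\<close> and
  \<open>add_left_commute\<close> in later proofs.\<close>

lemmas alg = cat zero_arr add_arr neg_arr add_assoc zero_add add_neg add_neg_cancel neg_neg neg_zero
  neg_add comp_add add_comp comp_zero zero_comp comp_neg neg_comp

end

section \<open>Stable categories\<close>

text \<open>The first five axioms make \<open>Null\<close> an ideal, the \<open>confl\<close> axioms
  make conflations kernel-cokernel pairs, and \<open>null_extend\<close> and
  \<open>null_lift\<close> are relative injectivity and projectivity of null maps. Both axioms on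
  enough objects ask for a middle term with null identity, so one class of objects serves as
  injectives and as projectives.\<close>

locale frobenius = additive_category C for C :: "('o, 'm, 'z) precat_scheme" (structure) +
  fixes E :: "('m \<times> 'm) set" and Null :: "'m \<Rightarrow> bool"
  assumes null_zero: "X \<in> Obj C \<Longrightarrow> Y \<in> Obj C \<Longrightarrow> Null (Zero C X Y)"
    and null_add: "Null f \<Longrightarrow> Null g \<Longrightarrow> f \<in> Arr C \<Longrightarrow> g \<in> Arr C \<Longrightarrow> Dom C g = Dom C f
      \<Longrightarrow> Cod C g = Cod C f \<Longrightarrow> Null (f \<oplus> g)"
    and null_neg: "Null f \<Longrightarrow> f \<in> Arr C \<Longrightarrow> Null (\<ominus> f)"
    and null_comp: "Null f \<Longrightarrow> f \<in> Arr C \<Longrightarrow> g \<in> Arr C \<Longrightarrow> Dom C g = Cod C f \<Longrightarrow> Null (g \<cdot> f)"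
    and comp_null: "Null g \<Longrightarrow> f \<in> Arr C \<Longrightarrow> g \<in> Arr C \<Longrightarrow> Dom C g = Cod C f \<Longrightarrow> Null (g \<cdot> f)"
    and confl_arr: "(i, p) \<in> E \<Longrightarrow> i \<in> Arr C \<and> p \<in> Arr C \<and> Dom C p = Cod C i"
    and confl_zero: "(i, p) \<in> E \<Longrightarrow> p \<cdot> i = Zero C (Dom C i) (Cod C p)"
    and confl_ker: "(i, p) \<in> E \<Longrightarrow> b \<in> Homs C W (Cod C i) \<Longrightarrow> p \<cdot> b = Zero C W (Cod C p)
      \<Longrightarrow> \<exists>a\<in>Homs C W (Dom C i). i \<cdot> a = b"
    and confl_mono: "(i, p) \<in> E \<Longrightarrow> a \<in> Homs C W (Dom C i) \<Longrightarrow> a' \<in> Homs C W (Dom C i)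
      \<Longrightarrow> i \<cdot> a = i \<cdot> a' \<Longrightarrow> a = a'"
    and confl_coker: "(i, p) \<in> E \<Longrightarrow> b \<in> Homs C (Cod C i) W \<Longrightarrow> b \<cdot> i = Zero C (Dom C i) W
      \<Longrightarrow> \<exists>a\<in>Homs C (Cod C p) W. a \<cdot> p = b"
    and confl_epi: "(i, p) \<in> E \<Longrightarrow> a \<in> Homs C (Cod C p) W \<Longrightarrow> a' \<in> Homs C (Cod C p) W
      \<Longrightarrow> a \<cdot> p = a' \<cdot> p \<Longrightarrow> a = a'"
    and null_extend: "Null f \<Longrightarrow> (i, p) \<in> E \<Longrightarrow> f \<in> Homs C (Dom C i) Y
      \<Longrightarrow> \<exists>g\<in>Homs C (Cod C i) Y. Null g \<and> g \<cdot> i = f"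
    and null_lift: "Null f \<Longrightarrow> (i, p) \<in> E \<Longrightarrow> f \<in> Homs C X (Cod C p)
      \<Longrightarrow> \<exists>g\<in>Homs C X (Cod C i). Null g \<and> p \<cdot> g = f"
    and enough_injectives: "X \<in> Obj C \<Longrightarrow>
      \<exists>i p. (i, p) \<in> E \<and> Dom C i = X \<and> Null (Ident C (Cod C i))"
    and enough_projectives: "X \<in> Obj C \<Longrightarrow>
      \<exists>i p. (i, p) \<in> E \<and> Cod C p = X \<and> Null (Ident C (Cod C i))"
begin

subsection \<open>Homotopy classes\<close>

text \<open>Shaped like \<open>homotopy\<close>, with \<open>Null\<close> in place of
  \<open>null_homotopic\<close>, so that both relations coincide for complexes by unfolding.\<close>

definition hrel :: "('m \<times> 'm) set" where
  "hrel = {(f, g). f \<in> Arr C \<and> g \<in> Arr C \<and> Dom C f = Dom C g \<and> Cod C f = Cod C g \<and>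
    Null (Diff C f g)}"

abbreviation K :: "('o, 'm set) tricat" where "K \<equiv> stable_cat C E hrel"

abbreviation sim :: "'m \<Rightarrow> 'm \<Rightarrow> bool" (infix "\<sim>" 50) where "f \<sim> g \<equiv> (f, g) \<in> hrel"

abbreviation cls :: "'m \<Rightarrow> 'm set" where "cls f \<equiv> quotient_arr hrel f"

lemma sim_iff: "f \<sim> g \<longleftrightarrow> f \<in> Arr C \<and> g \<in> Arr C \<and> Dom C g = Dom C f \<and> Cod C g = Cod C f \<and>
    Null (f \<oplus> \<ominus> g)"
  by (auto simp: hrel_def diff_eq_neg)

lemma sim_refl: "f \<in> Arr C \<Longrightarrow> f \<sim> f"
  by (simp add: sim_iff alg null_zero)

lemma sim_sym: "f \<sim> g \<Longrightarrow> g \<sim> f"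
  using null_neg[of "f \<oplus> \<ominus> g"] add_commute[of "\<ominus> f" g] by (auto simp: sim_iff alg)

lemma sim_trans [trans]:
  assumes "f \<sim> g" "g \<sim> h"
  shows "f \<sim> h"
proof -
  have "f \<oplus> \<ominus> g \<oplus> (g \<oplus> \<ominus> h) = f \<oplus> \<ominus> h"
    using assms by (simp add: sim_iff alg)
  then show ?thesis
    using null_add[of "f \<oplus> \<ominus> g" "g \<oplus> \<ominus> h"] assms by (simp add: sim_iff alg)
qed

lemma sim_comp:
  assumes "f \<sim> f'" "g \<sim> g'" "Dom C g = Cod C f"
  shows "g \<cdot> f \<sim> g' \<cdot> f'"
proof -
  have "g \<cdot> f \<sim> g \<cdot> f'"
    using assms null_comp[of "f \<oplus> \<ominus> f'" g] by (simp add: sim_iff alg)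
  moreover have "g \<cdot> f' \<sim> g' \<cdot> f'"
    using assms comp_null[of "g \<oplus> \<ominus> g'" f'] by (simp add: sim_iff alg)
  ultimately show ?thesis by (rule sim_trans)
qed

lemma sim_zero_iff:
  assumes "f \<in> Homs C X Y"
  shows "f \<sim> Zero C X Y \<longleftrightarrow> Null f"
  using assms Dom_closed[of f] Cod_closed[of f] by (auto simp: in_Homs sim_iff alg)

lemma sim_null:
  assumes "f \<sim> g" "Null g"
  shows "Null f"
  using assms null_add[of "f \<oplus> \<ominus> g" g] by (simp add: sim_iff alg)

lemma cls_eq_iff: "f \<in> Arr C \<Longrightarrow> g \<in> Arr C \<Longrightarrow> cls f = cls g \<longleftrightarrow> f \<sim> g"
  unfolding quotient_arr_def by (blast intro: sim_refl sim_trans dest: sim_sym)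

lemma some_cls: "f \<in> Arr C \<Longrightarrow> f \<sim> (SOME g. g \<in> cls f)"
  using someI[of "\<lambda>g. g \<in> cls f" f] by (simp add: quotient_arr_def sim_refl)

lemma Obj_K: "Obj K = Obj C"
  by (simp add: stable_cat_def precat.defs quotient_cat_def)

lemma Arr_K: "Arr K = cls ` Arr C"
  by (auto simp: stable_cat_def precat.defs quotient_cat_def quotient_def quotient_arr_def)

lemma Dom_K: "f \<in> Arr C \<Longrightarrow> Dom K (cls f) = Dom C f"
  and Cod_K: "f \<in> Arr C \<Longrightarrow> Cod K (cls f) = Cod C f"
  using some_cls[of f] by (simp_all add: stable_cat_def precat.defs quotient_cat_def sim_iff)

lemma Ident_K: "Ident K X = cls (Ident C X)"
  and Zero_K: "Zero K X Y = cls (Zero C X Y)"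
  by (simp_all add: stable_cat_def precat.defs quotient_cat_def)

lemma Comp_K:
  assumes "f \<in> Arr C" "g \<in> Arr C" "Dom C g = Cod C f"
  shows "cls g \<cdot>\<^bsub>K\<^esub> cls f = cls (g \<cdot> f)"
proof -
  have "g \<cdot> f \<sim> (SOME h. h \<in> cls g) \<cdot> (SOME h. h \<in> cls f)"
    using assms by (intro sim_comp some_cls) auto
  then have "cls (g \<cdot> f) = cls ((SOME h. h \<in> cls g) \<cdot> (SOME h. h \<in> cls f))"
    by (subst cls_eq_iff) (auto simp: sim_iff)
  then show ?thesis
    by (simp add: stable_cat_def precat.defs quotient_cat_def)
qed

lemma quotient_cat_K:
  "Obj (quotient_cat C hrel) = Obj K" "Arr (quotient_cat C hrel) = Arr K"
  "Dom (quotient_cat C hrel) = Dom K" "Cod (quotient_cat C hrel) = Cod K"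
  "Comp (quotient_cat C hrel) = Comp K" "Ident (quotient_cat C hrel) = Ident K"
  by (simp_all add: stable_cat_def precat.defs)

lemma shift_obj_K: "shift_obj K = suspension C E"
  and triangles_K: "triangles K = stable_triangles C E hrel"
  by (simp_all add: stable_cat_def precat.defs tricat.defs)

lemma Homs_K: "Homs K X Y = cls ` Homs C X Y"
  unfolding Homs_def Arr_K using Dom_K Cod_K by auto

definition siso :: "'o \<Rightarrow> 'o \<Rightarrow> bool" where
  "siso X Y \<longleftrightarrow> (\<exists>f\<in>Homs C X Y. \<exists>g\<in>Homs C Y X. g \<cdot> f \<sim> Ident C X \<and> f \<cdot> g \<sim> Ident C Y)"

lemma iso_arr_cong:
  assumes "Obj A = Obj B" "Arr A = Arr B" "Dom A = Dom B" "Cod A = Cod B" "Comp A = Comp B"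
    "Ident A = Ident B"
  shows "iso_arr A f = iso_arr B f" "Homs A X Y = Homs B X Y"
  unfolding iso_arr_def Homs_def assms by auto

lemma iso_arr_K:
  assumes "f \<in> Homs C X Y"
  shows "iso_arr K (cls f) \<longleftrightarrow>
    (\<exists>g\<in>Homs C Y X. g \<cdot> f \<sim> Ident C X \<and> f \<cdot> g \<sim> Ident C Y)"
proof -
  have f: "f \<in> Arr C" "Dom C f = X" "Cod C f = Y" "X \<in> Obj C" "Y \<in> Obj C"
    using assms Dom_closed Cod_closed by (auto simp: in_Homs)
  have *: "(\<exists>g\<in>cls ` Homs C Y X. P g) = (\<exists>g\<in>Homs C Y X. P (cls g))" for P by auto
  show ?thesis unfolding iso_arr_def
    using f by (auto simp: Homs_K Dom_K Cod_K * Arr_K in_Homs Comp_K Ident_K cls_eq_iff alg)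
qed

lemma isomorphic_K: "isomorphic K X Y \<longleftrightarrow> siso X Y"
  unfolding isomorphic_def siso_def Homs_K using iso_arr_K by auto

lemma sisoI:
  assumes "f \<in> Homs C X Y" "g \<in> Homs C Y X" "g \<cdot> f \<sim> Ident C X" "f \<cdot> g \<sim> Ident C Y"
  shows "siso X Y"
  using assms by (auto simp: siso_def)

lemma siso_obj: "siso X Y \<Longrightarrow> X \<in> Obj C" "siso X Y \<Longrightarrow> Y \<in> Obj C"
  using Dom_closed Cod_closed by (auto simp: siso_def in_Homs)

lemma siso_refl: "X \<in> Obj C \<Longrightarrow> siso X X"
  by (rule sisoI[of "Ident C X" _ _ "Ident C X"]) (auto simp: in_Homs alg intro!: sim_refl)

lemma siso_sym: "siso X Y \<Longrightarrow> siso Y X"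
  by (auto simp: siso_def)

lemma siso_trans:
  assumes "siso X Y" "siso Y Z"
  shows "siso X Z"
proof -
  obtain f g where fg: "f \<in> Arr C" "Dom C f = X" "Cod C f = Y" "g \<in> Arr C" "Dom C g = Y"
    "Cod C g = X" "g \<cdot> f \<sim> Ident C X" "f \<cdot> g \<sim> Ident C Y"
    using assms(1) by (auto simp: siso_def in_Homs)
  obtain h k where hk: "h \<in> Arr C" "Dom C h = Y" "Cod C h = Z" "k \<in> Arr C" "Dom C k = Z"
    "Cod C k = Y" "k \<cdot> h \<sim> Ident C Y" "h \<cdot> k \<sim> Ident C Z"
    using assms(2) by (auto simp: siso_def in_Homs)
  have "g \<cdot> ((k \<cdot> h) \<cdot> f) \<sim> g \<cdot> (Ident C Y \<cdot> f)"
    using fg hk by (intro sim_comp sim_refl) (simp_all add: alg)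
  also have "g \<cdot> (Ident C Y \<cdot> f) = g \<cdot> f" using fg by (simp add: alg)
  also note fg(7)
  finally have 1: "(g \<cdot> k) \<cdot> (h \<cdot> f) \<sim> Ident C X"
    using fg hk by (simp add: alg)
  have "h \<cdot> ((f \<cdot> g) \<cdot> k) \<sim> h \<cdot> (Ident C Y \<cdot> k)"
    using fg hk by (intro sim_comp sim_refl) (simp_all add: alg)
  also have "h \<cdot> (Ident C Y \<cdot> k) = h \<cdot> k" using hk by (simp add: alg)
  also note hk(8)
  finally have 2: "(h \<cdot> f) \<cdot> (g \<cdot> k) \<sim> Ident C Z"
    using fg hk by (simp add: alg)
  show ?thesis
    by (rule sisoI[OF _ _ 1 2]) (use fg hk in \<open>simp_all add: in_Homs alg\<close>)
qed

subsection \<open>Suspension\<close>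

abbreviation injective :: "'o \<Rightarrow> bool" where "injective J \<equiv> J \<in> Obj C \<and> Null (Ident C J)"

lemma null_through_injective:
  assumes "injective J" "f \<in> Homs C X J" "g \<in> Homs C J Y"
  shows "Null f" "Null g"
proof -
  show "Null f"
    using assms comp_null[of "Ident C J" f] by (simp add: in_Homs alg)
  show "Null g"
    using assms null_comp[of "Ident C J" g] by (simp add: in_Homs alg)
qed

lemma null_into_injective: "injective J \<Longrightarrow> f \<in> Homs C X J \<Longrightarrow> Null f"
  by (rule null_through_injective(1)[of J f X "Ident C J" J]) (auto simp: in_Homs alg)

lemma null_from_injective: "injective J \<Longrightarrow> f \<in> Homs C J X \<Longrightarrow> Null f"
  by (rule null_through_injective(2)[of J "Ident C J" J f X]) (auto simp: in_Homs alg)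

text \<open>An injective \<open>J\<close> is a retract of the middle term of a conflation starting
  in \<open>J\<close>, which may be chosen with null identity, and null maps form an ideal.
  Conversely, every map into an object with null identity is null and therefore extends along
  inflations.\<close>

lemma injective_object_iff: "injective_object C E J \<longleftrightarrow> injective J"
proof
  assume J: "injective_object C E J"
  then have "J \<in> Obj C" by (simp add: injective_object_def)
  then obtain i p where ip: "(i, p) \<in> E" "Dom C i = J" "Null (Ident C (Cod C i))"
    using enough_injectives by blast
  have "Ident C J \<in> Homs C J J" using \<open>J \<in> Obj C\<close> by (simp add: in_Homs alg)
  moreover from J have "\<And>f g h. (f, g) \<in> E \<Longrightarrow> h \<in> Homs C (Dom C f) J \<Longrightarrow>
      \<exists>k\<in>Homs C (Cod C f) J. k \<cdot> f = h"
    by (auto simp: injective_object_def)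
  ultimately obtain k where k: "k \<in> Homs C (Cod C i) J" "k \<cdot> i = Ident C J"
    using ip(1,2) by metis
  have i: "i \<in> Arr C" using ip confl_arr by blast
  have "Null k"
    by (rule null_from_injective[OF _ k(1)]) (simp add: ip i Cod_closed)
  then show "injective J"
    using comp_null[of k i] k i \<open>J \<in> Obj C\<close> by (simp add: in_Homs)
next
  assume J: "injective J"
  have "\<exists>k\<in>Homs C (Cod C f) J. k \<cdot> f = h" if "(f, g) \<in> E" "h \<in> Homs C (Dom C f) J" for f g h
    using null_extend[OF null_into_injective[OF J that(2)] that] by blast
  with J show "injective_object C E J"
    by (auto simp: injective_object_def)
qed

definition inj_confl :: "'m \<Rightarrow> 'm \<Rightarrow> bool" where
  "inj_confl i p \<longleftrightarrow> (i, p) \<in> E \<and> Null (Ident C (Cod C i))"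

lemma inj_conflD:
  assumes "inj_confl i p"
  shows "(i, p) \<in> E" "injective (Cod C i)" "i \<in> Arr C" "p \<in> Arr C" "Dom C p = Cod C i"
    "Dom C i \<in> Obj C" "Cod C p \<in> Obj C"
  using assms confl_arr[of i p] by (auto simp: inj_confl_def alg)

lemma injective_hull:
  assumes "X \<in> Obj C"
  shows "inj_confl (hull_inc C E X) (hull_proj C E X)" "Dom C (hull_inc C E X) = X"
proof -
  let ?P = "\<lambda>(i, p). (i, p) \<in> E \<and> Dom C i = X \<and> injective_object C E (Cod C i)"
  obtain i p where "(i, p) \<in> E" "Dom C i = X" "Null (Ident C (Cod C i))"
    using enough_injectives[OF assms] by blast
  then have "?P (i, p)"
    using confl_arr Cod_closed by (auto simp: injective_object_iff)
  then have "?P (injective_hull C E X)"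
    unfolding injective_hull_def by (rule someI)
  then show "inj_confl (hull_inc C E X) (hull_proj C E X)" "Dom C (hull_inc C E X) = X"
    by (auto simp: inj_confl_def injective_object_iff split: prod.splits)
qed

lemma comparison:
  assumes ip: "(i, p) \<in> E" and jq: "inj_confl j q" and f: "f \<in> Homs C (Dom C i) (Dom C j)"
  shows "\<exists>h\<in>Homs C (Cod C i) (Cod C j). \<exists>g\<in>Homs C (Cod C p) (Cod C q).
    h \<cdot> i = j \<cdot> f \<and> g \<cdot> p = q \<cdot> h"
proof -
  note j = inj_conflD[OF jq]
  note i = confl_arr[OF ip]
  have "j \<cdot> f \<in> Homs C (Dom C i) (Cod C j)" using f j by (simp add: in_Homs alg)
  from null_extend[OF null_into_injective[OF j(2) this] ip this]
  obtain h where h: "h \<in> Homs C (Cod C i) (Cod C j)" "h \<cdot> i = j \<cdot> f" by auto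
  have "(q \<cdot> h) \<cdot> i = q \<cdot> (h \<cdot> i)"
    using h(1) i j by (simp add: in_Homs alg)
  also have "\<dots> = (q \<cdot> j) \<cdot> f" unfolding h(2) using f i j by (simp add: in_Homs alg)
  also have "\<dots> = Zero C (Dom C i) (Cod C q)"
    unfolding confl_zero[OF j(1)] using f i j by (auto simp: in_Homs alg)
  finally obtain g where "g \<in> Homs C (Cod C p) (Cod C q)" "g \<cdot> p = q \<cdot> h"
    using confl_coker[OF ip, of "q \<cdot> h" "Cod C q"] h(1) j i by (auto simp: in_Homs alg)
  then show ?thesis using h by blast
qed

text \<open>Extend \<open>f\<close> to \<open>k\<close> on the middle term. The difference of
  \<open>h\<close> and \<open>j \<cdot> k\<close> vanishes on \<open>i\<close> and descends to some
  \<open>m\<close>, and \<open>g = q \<cdot> m\<close> because \<open>q \<cdot> j\<close> is zero;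
  so \<open>g\<close> passes through an injective.\<close>

lemma comparison_null:
  assumes ip: "(i, p) \<in> E" and jq: "inj_confl j q" and f: "f \<in> Homs C (Dom C i) (Dom C j)"
    and h: "h \<in> Homs C (Cod C i) (Cod C j)" and g: "g \<in> Homs C (Cod C p) (Cod C q)"
    and eq: "h \<cdot> i = j \<cdot> f" "g \<cdot> p = q \<cdot> h" and "Null f"
  shows "Null g"
proof -
  note j = inj_conflD[OF jq]
  note i = confl_arr[OF ip]
  obtain k where k: "k \<in> Homs C (Cod C i) (Dom C j)" "k \<cdot> i = f"
    using null_extend[OF \<open>Null f\<close> ip f] by blast
  have "(h \<oplus> \<ominus> (j \<cdot> k)) \<cdot> i = Zero C (Dom C i) (Cod C j)"
    using h k f i j eq by (simp add: in_Homs alg)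
  then obtain m where m: "m \<in> Homs C (Cod C p) (Cod C j)" "m \<cdot> p = h \<oplus> \<ominus> (j \<cdot> k)"
    using confl_coker[OF ip, of "h \<oplus> \<ominus> (j \<cdot> k)" "Cod C j"] h k i j by (auto simp: in_Homs alg)
  have "q \<cdot> (m \<cdot> p) = q \<cdot> h \<oplus> \<ominus> ((q \<cdot> j) \<cdot> k)"
    unfolding m(2) using h k j by (simp add: in_Homs alg)
  also have "\<dots> = g \<cdot> p"
    unfolding confl_zero[OF j(1)] eq(2) using h k j i by (auto simp: in_Homs alg)
  finally have "(q \<cdot> m) \<cdot> p = g \<cdot> p"
    using m j i by (simp add: in_Homs alg)
  then have "q \<cdot> m = g"
    using confl_epi[OF ip, of "q \<cdot> m" "Cod C q" g] m(1) j g by (simp add: in_Homs alg)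
  moreover have "Null (q \<cdot> m)"
    using null_comp[OF null_into_injective[OF j(2) m(1)], of q] m(1) j by (simp add: in_Homs)
  ultimately show ?thesis by simp
qed

lemma comparison_sim_ident:
  assumes ip: "inj_confl i p"
    and f: "f \<in> Homs C (Dom C i) (Dom C i)" "f \<sim> Ident C (Dom C i)"
    and h: "h \<in> Homs C (Cod C i) (Cod C i)" and g: "g \<in> Homs C (Cod C p) (Cod C p)"
    and eq: "h \<cdot> i = i \<cdot> f" "g \<cdot> p = p \<cdot> h"
  shows "g \<sim> Ident C (Cod C p)"
proof -
  note i = inj_conflD[OF ip]
  have "Null (g \<oplus> \<ominus> Ident C (Cod C p))"
  proof (rule comparison_null[OF i(1) ip, of "f \<oplus> \<ominus> Ident C (Dom C i)" "h \<oplus> \<ominus> Ident C (Cod C i)"])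
    show "Null (f \<oplus> \<ominus> Ident C (Dom C i))" using f(2) by (simp add: sim_iff)
  qed (use f(1) h g eq i in \<open>simp_all add: in_Homs alg\<close>)
  then show ?thesis using g i by (auto simp: sim_iff in_Homs alg)
qed

lemma siso_suspension:
  assumes ip: "inj_confl i p" and jq: "inj_confl j q" and iso: "siso (Dom C i) (Dom C j)"
  shows "siso (Cod C p) (Cod C q)"
proof -
  note i = inj_conflD[OF ip]
  note j = inj_conflD[OF jq]
  obtain f f' where f: "f \<in> Homs C (Dom C i) (Dom C j)" "f' \<in> Homs C (Dom C j) (Dom C i)"
    and ff: "f' \<cdot> f \<sim> Ident C (Dom C i)" "f \<cdot> f' \<sim> Ident C (Dom C j)"
    using iso by (auto simp: siso_def)
  obtain h g where h: "h \<in> Homs C (Cod C i) (Cod C j)" "g \<in> Homs C (Cod C p) (Cod C q)"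
    "h \<cdot> i = j \<cdot> f" "g \<cdot> p = q \<cdot> h"
    using comparison[OF i(1) jq f(1)] by blast
  obtain h' g' where h': "h' \<in> Homs C (Cod C j) (Cod C i)" "g' \<in> Homs C (Cod C q) (Cod C p)"
    "h' \<cdot> j = i \<cdot> f'" "g' \<cdot> q = p \<cdot> h'"
    using comparison[OF j(1) ip f(2)] by blast
  note [simp] = in_Homs alg comp_reduce[OF h(3)] comp_reduce[OF h(4)] comp_reduce[OF h'(3)]
    comp_reduce[OF h'(4)]
  have "g' \<cdot> g \<sim> Ident C (Cod C p)"
    by (rule comparison_sim_ident[OF ip _ ff(1), of "h' \<cdot> h"]) (use f h h' i j in simp_all)
  moreover have "g \<cdot> g' \<sim> Ident C (Cod C q)"
    by (rule comparison_sim_ident[OF jq _ ff(2), of "h \<cdot> h'"]) (use f h h' i j in simp_all)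
  ultimately show ?thesis
    by (intro sisoI[OF h(2) h'(2)])
qed

text \<open>Frees later arguments from the hull picked by \<open>SOME\<close>: any conflation with
  injective middle term computes the suspension up to stable isomorphism.\<close>

lemma suspension_siso:
  assumes "inj_confl i p"
  shows "siso (suspension C E (Dom C i)) (Cod C p)"
  using assms injective_hull[OF inj_conflD(6)[OF assms]] inj_conflD(6)[OF assms]
  by (auto simp: suspension_def intro!: siso_suspension siso_refl)

text \<open>\<open>stable_shift_arr\<close> selects one map among all those induced by all
  representatives of a class. For the class of an identity, every candidate is stably the identity
  by \<open>comparison_sim_ident\<close>. Identities are enough because the triangle isomorphism
  built in \<open>conflation_triangle\<close> has an identity as its first component.\<close>

lemma shift_arr_ident:
  assumes "X \<in> Obj C"
  shows "stable_shift_arr C E hrel (cls (Ident C X)) = cls (Ident C (suspension C E X))"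
proof -
  note h = injective_hull[OF assms]
  note i = inj_conflD[OF h(1)]
  let ?i = "hull_inc C E X" and ?p = "hull_proj C E X" and ?S = "suspension C E X"
  let ?Q = "\<lambda>g. \<exists>f\<in>cls (Ident C X). suspends C E f g"
  have "suspends C E (Ident C X) (Ident C ?S)"
    unfolding suspends_def Let_def
    using assms h(2) i
    by (auto simp: suspension_def in_Homs alg intro!: bexI[of _ "Ident C (Cod C ?i)"])
  moreover have "Ident C X \<in> cls (Ident C X)"
    using assms by (simp add: quotient_arr_def sim_refl alg)
  ultimately have "?Q (Ident C ?S)" by blast
  then have "?Q (SOME g. ?Q g)" by (rule someI)
  then obtain f where f: "f \<in> cls (Ident C X)" "suspends C E f (SOME g. ?Q g)" by blast
  define g where "g = (SOME g. ?Q g)"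
  have "suspends C E f g" using f(2) by (simp only: g_def)
  moreover have f': "Ident C X \<sim> f" using f(1) by (simp add: quotient_arr_def)
  moreover from this have fX: "f \<in> Arr C" "Dom C f = X" "Cod C f = X" using assms by (simp_all add: sim_iff alg)
  ultimately obtain h where gh: "g \<in> Homs C ?S ?S" "h \<in> Homs C (Cod C ?i) (Cod C ?i)"
    "h \<cdot> ?i = ?i \<cdot> f" "g \<cdot> ?p = ?p \<cdot> h"
    unfolding suspends_def Let_def by auto
  have "g \<sim> Ident C ?S" unfolding suspension_def
    by (rule comparison_sim_ident[OF h(1) _ _ gh(2) _ gh(3,4)])
      (use fX f' gh(1) h(2) in \<open>auto simp: in_Homs suspension_def intro: sim_sym\<close>)
  moreover have "g \<in> Arr C" "Ident C ?S \<in> Arr C"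
    using gh(1) i by (auto simp: in_Homs alg suspension_def)
  ultimately show ?thesis
    unfolding stable_shift_arr_def g_def[symmetric] by (simp add: cls_eq_iff)
qed

subsection \<open>Triangles\<close>

lemma pushout_arr:
  assumes "pushout C u i v t"
  shows "u \<in> Arr C" "i \<in> Arr C" "v \<in> Arr C" "t \<in> Arr C" "Dom C i = Dom C u" "Dom C v = Cod C u"
    "Dom C t = Cod C i" "Cod C t = Cod C v" "v \<cdot> u = t \<cdot> i"
  using assms by (auto simp: pushout_def)

lemma pushout_factor:
  assumes "pushout C u i v t" "a \<in> Homs C (Cod C u) W" "b \<in> Homs C (Cod C i) W" "a \<cdot> u = b \<cdot> i"
  shows "\<exists>c\<in>Homs C (Cod C v) W. c \<cdot> v = a \<and> c \<cdot> t = b"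
proof -
  have "W \<in> Obj C" using assms(2) Cod_closed by (auto simp: in_Homs)
  then show ?thesis using assms unfolding pushout_def by blast
qed

lemma pushout_unique:
  assumes po: "pushout C u i v t" and c: "c \<in> Homs C (Cod C v) W" "c' \<in> Homs C (Cod C v) W"
    and eq: "c \<cdot> v = c' \<cdot> v" "c \<cdot> t = c' \<cdot> t"
  shows "c = c'"
proof -
  note arr = pushout_arr[OF po]
  have "W \<in> Obj C" using c Cod_closed by (auto simp: in_Homs)
  moreover have "c' \<cdot> v \<in> Homs C (Cod C u) W" "c' \<cdot> t \<in> Homs C (Cod C i) W"
    using c arr by (simp_all add: in_Homs alg)
  moreover have "(c' \<cdot> v) \<cdot> u = (c' \<cdot> t) \<cdot> i"
    using c arr by (simp add: in_Homs alg)
  ultimately have "\<exists>!k. k \<in> Homs C (Cod C v) W \<and> k \<cdot> v = c' \<cdot> v \<and> k \<cdot> t = c' \<cdot> t"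
    using po unfolding pushout_def by blast
  then show ?thesis using c eq by blast
qed

lemma triangleI:
  assumes "(u', v', w') \<in> standard_triangles C E hrel"
    and "iso_arr K a" "iso_arr K b" "iso_arr K c"
    and "b \<cdot>\<^bsub>K\<^esub> u = u' \<cdot>\<^bsub>K\<^esub> a" "c \<cdot>\<^bsub>K\<^esub> v = v' \<cdot>\<^bsub>K\<^esub> b"
      "stable_shift_arr C E hrel a \<cdot>\<^bsub>K\<^esub> w = w' \<cdot>\<^bsub>K\<^esub> c"
    and "a \<in> Homs K (Dom K u) (Dom K u')" "b \<in> Homs K (Dom K v) (Dom K v')"
      "c \<in> Homs K (Dom K w) (Dom K w')"
    and "u \<in> Arr K" "v \<in> Arr K" "w \<in> Arr K" "Cod K u = Dom K v" "Cod K v = Dom K w"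
      "Cod K w = suspension C E (Dom K u)"
  shows "(u, v, w) \<in> triangles K"
  unfolding triangles_K stable_triangles_def Let_def quotient_cat_K iso_arr_cong[OF quotient_cat_K]
  using assms by blast

text \<open>
  For an inflation \<open>i : U \<rightarrow> X\<close> with cokernel \<open>p : X \<rightarrow> V\<close>, an extension \<open>h : X \<rightarrow> I(U)\<close> of
  \<open>U \<rightarrow> I(U)\<close> identifies the pushout defining the standard triangle on \<open>i\<close> with \<open>I(U) \<oplus> V\<close>.
\<close>

lemma conflation_triangle:
  assumes ip: "(i, p) \<in> E" and iso: "siso X (Cod C i)"
  shows "\<exists>(u, v, w)\<in>triangles K. Dom K u = Dom C i \<and> Dom K v = X \<and> Dom K w = Cod C p"
proof -
  note i = confl_arr[OF ip, THEN conjunct1] confl_arr[OF ip, THEN conjunct2, THEN conjunct1]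
    confl_arr[OF ip, THEN conjunct2, THEN conjunct2]
  let ?U = "Dom C i" and ?V = "Cod C p" and ?X = "Cod C i"
  let ?j = "hull_inc C E ?U" and ?q = "hull_proj C E ?U"
  have U: "?U \<in> Obj C" using i Dom_closed by simp
  have V: "?V \<in> Obj C" using i Cod_closed by simp
  have X: "X \<in> Obj C" using siso_obj iso by blast
  note j = inj_conflD[OF injective_hull(1)[OF U]] injective_hull(2)[OF U]
  have jq: "?q \<cdot> ?j = Zero C ?U (suspension C E ?U)"
    using confl_zero[OF j(1)] j(8) by (simp add: suspension_def)
  let ?I = "Cod C ?j"
  have "?j \<in> Homs C ?U ?I" using j by (simp add: in_Homs)
  from null_extend[OF null_into_injective[OF j(2) this] ip this]
  obtain h where h: "h \<in> Homs C ?X ?I" "h \<cdot> i = ?j" by blast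
  have "(?q \<cdot> h) \<cdot> i = Zero C ?U (suspension C E ?U)"
    using h i j jq by (simp add: in_Homs comp_assoc)
  \<comment> \<open>Up to sign, \<open>n\<close> is the connecting map of the conflation; it becomes
    the third arrow of the triangle.\<close>
  then obtain n where n: "n \<in> Homs C ?V (suspension C E ?U)" "n \<cdot> p = ?q \<cdot> h"
    using confl_coker[OF ip, of "?q \<cdot> h" "suspension C E ?U"] h i j
    by (auto simp: in_Homs comp_arr suspension_def)
  obtain S j1 j2 q1 q2 where S: "S \<in> Obj C" "j1 \<in> Homs C ?I S" "j2 \<in> Homs C ?V S" "q1 \<in> Homs C S ?I"
    "q2 \<in> Homs C S ?V" "q1 \<cdot> j1 = Ident C ?I" "q2 \<cdot> j2 = Ident C ?V" "q1 \<cdot> j2 = Zero C ?V ?I"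
    "q2 \<cdot> j1 = Zero C ?I ?V" "j1 \<cdot> q1 \<oplus> j2 \<cdot> q2 = Ident C S"
    using has_biproducts[of ?I ?V] j(2) V unfolding biproduct_def by blast
  let ?v = "j1 \<cdot> h \<oplus> j2 \<cdot> p"
  \<comment> \<open>The sign makes \<open>?w\<close> vanish on \<open>?v\<close>: the two summands
    give \<open>?q \<cdot> h\<close> and the negative of \<open>n \<cdot> p\<close>, which are
    opposite by the choice of \<open>n\<close>.\<close>
  let ?w = "?q \<cdot> q1 \<oplus> \<ominus> (n \<cdot> q2)"
  have pi: "p \<cdot> i = Zero C ?U ?V" by (rule confl_zero[OF ip])
  note red = comp_reduce[OF S(6)] comp_reduce[OF S(7)] comp_reduce[OF S(8)] comp_reduce[OF S(9)]
    comp_reduce[OF h(2)] comp_reduce[OF pi]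
  have SO: "\<And>Z. suspension C E Z = Cod C (hull_proj C E Z)" by (simp add: suspension_def)
  note ty = S(1-5)[unfolded in_Homs] h(1)[unfolded in_Homs] n(1)[unfolded in_Homs] i j U V SO in_Homs
  have po: "pushout C i ?j ?v j1"
    unfolding pushout_def
  proof (intro conjI ballI impI)
    show "?v \<cdot> i = j1 \<cdot> ?j"
      using S(6-9) h(2) pi by (simp add: ty alg)
    fix W a b
    assume W: "W \<in> Obj C" and a: "a \<in> Homs C (Cod C i) W" and b: "b \<in> Homs C ?I W"
      and ab: "a \<cdot> i = b \<cdot> ?j"
    have "(a \<oplus> \<ominus> (b \<cdot> h)) \<cdot> i = Zero C ?U W"
      using a b W h(2) ab by (simp add: ty alg)
    then obtain c where c: "c \<in> Homs C ?V W" "c \<cdot> p = a \<oplus> \<ominus> (b \<cdot> h)"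
      using confl_coker[OF ip, of "a \<oplus> \<ominus> (b \<cdot> h)" W] a b by (auto simp: ty alg)
    show "\<exists>!e. e \<in> Homs C (Cod C ?v) W \<and> e \<cdot> ?v = a \<and> e \<cdot> j1 = b"
    proof (rule ex1I[of _ "b \<cdot> q1 \<oplus> c \<cdot> q2"], intro conjI)
      show "b \<cdot> q1 \<oplus> c \<cdot> q2 \<in> Homs C (Cod C ?v) W"
        using b c by (simp add: ty alg)
      have "(b \<cdot> q1 \<oplus> c \<cdot> q2) \<cdot> ?v = b \<cdot> h \<oplus> c \<cdot> p"
        using b c(1) W S(6-9) by (simp add: ty alg red)
      also have "\<dots> = a" unfolding c(2)
        using a b W add_commute[of "b \<cdot> h" "a \<oplus> \<ominus> (b \<cdot> h)"] by (simp add: ty alg)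
      finally show "(b \<cdot> q1 \<oplus> c \<cdot> q2) \<cdot> ?v = a" .
      show "(b \<cdot> q1 \<oplus> c \<cdot> q2) \<cdot> j1 = b"
        using b c(1) W S(6-9) by (simp add: ty alg red)
    next
      fix e assume e: "e \<in> Homs C (Cod C ?v) W \<and> e \<cdot> ?v = a \<and> e \<cdot> j1 = b"
      then have e': "e \<in> Arr C" "Dom C e = S" "Cod C e = W" "e \<cdot> j1 = b"
        by (simp_all add: ty alg)
      have ejh: "(e \<cdot> j1) \<cdot> h = b \<cdot> h" unfolding e'(4) ..
      have "e \<cdot> ?v = (e \<cdot> j1) \<cdot> h \<oplus> (e \<cdot> j2) \<cdot> p"
        using e'(1-3) by (simp add: ty alg)
      then have "a = b \<cdot> h \<oplus> (e \<cdot> j2) \<cdot> p" using e unfolding ejh by simp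
      then have ejp: "(e \<cdot> j2) \<cdot> p = a \<oplus> \<ominus> (b \<cdot> h)"
        using e'(1-3) b add_commute[of "b \<cdot> h" "(e \<cdot> j2) \<cdot> p"] by (simp add: ty alg)
      have c': "c = e \<cdot> j2"
        by (rule confl_epi[OF ip c(1)]) (use c e'(1-3) ejp in \<open>simp_all add: ty comp_arr\<close>)
      have "e = e \<cdot> (j1 \<cdot> q1 \<oplus> j2 \<cdot> q2)" unfolding S(10) using e'(1,2) by (simp only: comp_ident)
      also have "\<dots> = (e \<cdot> j1) \<cdot> q1 \<oplus> (e \<cdot> j2) \<cdot> q2"
        using e'(1-3) by (simp add: ty alg)
      also have "\<dots> = b \<cdot> q1 \<oplus> c \<cdot> q2"
        unfolding c' e'(4) ..
      finally show "e = b \<cdot> q1 \<oplus> c \<cdot> q2" .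
    qed
  qed (simp_all add: ty alg)
  have w: "?w \<in> Homs C S (suspension C E ?U)" by (simp add: ty alg)
  have "?w \<cdot> ?v = ?q \<cdot> h \<oplus> \<ominus> (n \<cdot> p)"
    using S(6-9) by (simp add: ty alg red)
  also have "\<dots> = Zero C ?X (suspension C E ?U)"
    unfolding n(2) by (simp add: ty alg)
  finally have wv: "?w \<cdot> ?v = Zero C ?X (suspension C E ?U)" .
  have wt: "?w \<cdot> j1 = ?q" using S(6-9) by (simp add: ty alg red)
  have std: "(cls i, cls ?v, cls ?w) \<in> standard_triangles C E hrel"
    unfolding standard_triangles_def mem_Collect_eq
  proof (intro exI conjI)
    show "?w \<in> Homs C (Cod C ?v) (suspension C E ?U)" using w by (simp add: ty alg)
  qed (rule refl po wv wt)+
  obtain k l where k: "k \<in> Homs C X ?X" "l \<in> Homs C ?X X" "l \<cdot> k \<sim> Ident C X" "k \<cdot> l \<sim> Ident C ?X"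
    using iso by (auto simp: siso_def)
  have "(cls (l \<cdot> i), cls (p \<cdot> k), cls (?w \<cdot> j2)) \<in> triangles K"
  proof (rule triangleI[OF std])
    show "iso_arr K (cls (Ident C ?U))"
      by (subst iso_arr_K[of _ ?U ?U])
        (use U in \<open>auto simp: in_Homs alg intro!: sim_refl bexI[of _ "Ident C ?U"]\<close>)
    show "iso_arr K (cls k)"
      by (subst iso_arr_K[OF k(1)]) (use k in blast)
    \<comment> \<open>The difference \<open>j1 \<cdot> q1\<close> passes through the injective
      \<open>?I\<close>, so \<open>j2\<close> is a stable isomorphism from the cokernel of
      \<open>i\<close> to the pushout, with inverse \<open>q2\<close>.\<close>
    have "j2 \<cdot> q2 \<sim> j1 \<cdot> q1 \<oplus> j2 \<cdot> q2"
    proof -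
      have "j2 \<cdot> q2 \<oplus> \<ominus> (j1 \<cdot> q1 \<oplus> j2 \<cdot> q2) = \<ominus> (j1 \<cdot> q1)"
        using add_commute[of "\<ominus> (j1 \<cdot> q1)" "\<ominus> (j2 \<cdot> q2)"] by (simp add: ty alg)
      moreover have "Null (\<ominus> (j1 \<cdot> q1))"
        using null_comp[OF null_into_injective[OF j(2) S(4)], of j1] by (simp add: ty null_neg alg)
      ultimately show ?thesis by (simp add: ty sim_iff alg)
    qed
    then have "j2 \<cdot> q2 \<sim> Ident C S" using S(10) by simp
    moreover have "q2 \<cdot> j2 \<sim> Ident C ?V" using S(7) V by (simp add: sim_refl alg)
    ultimately show "iso_arr K (cls j2)"
      by (subst iso_arr_K[OF S(3)]) (use S(5) in blast)
    have "(k \<cdot> l) \<cdot> i \<sim> Ident C ?X \<cdot> i"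
      using k by (intro sim_comp[OF sim_refl k(4)]) (simp_all add: ty alg)
    then show "cls k \<cdot>\<^bsub>K\<^esub> cls (l \<cdot> i) = cls i \<cdot>\<^bsub>K\<^esub> cls (Ident C ?U)"
      using k by (simp add: ty Comp_K alg cls_eq_iff)
    have "Null (\<ominus> (j1 \<cdot> h \<cdot> k))"
      using null_comp[OF null_into_injective[OF j(2), of "h \<cdot> k"], of X j1] k
      by (simp add: ty null_neg alg)
    moreover have "j2 \<cdot> (p \<cdot> k) \<oplus> \<ominus> (?v \<cdot> k) = \<ominus> (j1 \<cdot> h \<cdot> k)"
      using k add_commute[of "\<ominus> (j1 \<cdot> h \<cdot> k)" "\<ominus> (j2 \<cdot> p \<cdot> k)"] by (simp add: ty alg)
    ultimately have "j2 \<cdot> (p \<cdot> k) \<sim> ?v \<cdot> k"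
      using k by (simp add: ty sim_iff alg)
    then show "cls j2 \<cdot>\<^bsub>K\<^esub> cls (p \<cdot> k) = cls ?v \<cdot>\<^bsub>K\<^esub> cls k"
      using k by (simp add: ty Comp_K alg cls_eq_iff)
    show "stable_shift_arr C E hrel (cls (Ident C ?U)) \<cdot>\<^bsub>K\<^esub> cls (?w \<cdot> j2)
        = cls ?w \<cdot>\<^bsub>K\<^esub> cls j2"
      unfolding shift_arr_ident[OF U] using w by (simp add: ty Comp_K alg)
  qed (use k w X in \<open>auto simp: ty alg Dom_K Cod_K Arr_K Homs_K\<close>)
  then show ?thesis
    by (rule rev_bexI) (use k in \<open>simp add: ty Dom_K alg\<close>)
qed

text \<open>Membership in an isomorphism-closed class of objects only depends on the three vertices,
  so the commuting squares of the triangle isomorphism are dropped here.\<close>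

lemma triangle_standard:
  assumes "(u, v, w) \<in> triangles K"
  shows "\<exists>u' v' w' t. pushout C u' (hull_inc C E (Dom C u')) v' t \<and>
    w' \<in> Homs C (Cod C v') (suspension C E (Dom C u')) \<and>
    w' \<cdot> v' = Zero C (Cod C u') (suspension C E (Dom C u')) \<and>
    w' \<cdot> t = hull_proj C E (Dom C u') \<and>
    siso (Dom K u) (Dom C u') \<and> siso (Dom K v) (Cod C u') \<and> siso (Dom K w) (Cod C v')"
proof -
  obtain u' v' w' a b c where std: "(u', v', w') \<in> standard_triangles C E hrel"
    and abc: "a \<in> Homs K (Dom K u) (Dom K u')" "b \<in> Homs K (Dom K v) (Dom K v')"
      "c \<in> Homs K (Dom K w) (Dom K w')" "iso_arr K a" "iso_arr K b" "iso_arr K c"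
    using assms unfolding triangles_K stable_triangles_def Let_def quotient_cat_K
      iso_arr_cong[OF quotient_cat_K] by blast
  have iso: "siso (Dom K u) (Dom K u')" "siso (Dom K v) (Dom K v')" "siso (Dom K w) (Dom K w')"
    using abc unfolding isomorphic_K[symmetric] isomorphic_def by blast+
  obtain u0 v0 w0 t where eq: "u' = cls u0" "v' = cls v0" "w' = cls w0"
    and t: "pushout C u0 (hull_inc C E (Dom C u0)) v0 t"
      "w0 \<in> Homs C (Cod C v0) (suspension C E (Dom C u0))"
      "w0 \<cdot> v0 = Zero C (Cod C u0) (suspension C E (Dom C u0))"
      "w0 \<cdot> t = hull_proj C E (Dom C u0)"
    using std unfolding standard_triangles_def by blast
  have "Dom K u' = Dom C u0" "Dom K v' = Cod C u0" "Dom K w' = Cod C v0"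
    using pushout_arr[OF t(1)] t(2) by (simp_all add: eq Dom_K in_Homs)
  then show ?thesis using t iso by metis
qed

subsection \<open>Subcategories closed under isomorphism\<close>

definition iso_closure :: "'o set \<Rightarrow> 'o set" where
  "iso_closure S = {Y \<in> Obj C. \<exists>X\<in>S. siso Y X}"

text \<open>Strict witnesses are demanded inside \<open>S\<close>, before closing under isomorphism,
  since this is what reindexed conflations provide. The two clauses become the two inclusions of
  \<open>U = \<Sigma>U\<close> in \<open>iso_closure_shift\<close>: the first one suspends, the
  second one desuspends.\<close>

definition shift_stable :: "'o set \<Rightarrow> bool" where
  "shift_stable S \<longleftrightarrow> S \<subseteq> Obj C \<and>
    (\<forall>X\<in>S. \<exists>i p. inj_confl i p \<and> Dom C i = X \<and> Cod C p \<in> S) \<and>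
    (\<forall>X\<in>S. \<exists>i p. inj_confl i p \<and> Cod C p = X \<and> Dom C i \<in> S)"

lemma iso_closure_iso: "siso X Y \<Longrightarrow> Y \<in> iso_closure S \<Longrightarrow> X \<in> iso_closure S"
  unfolding iso_closure_def using siso_trans siso_obj by blast

lemma suspension_in_iso_closure:
  assumes "shift_stable S" "X \<in> iso_closure S"
  shows "suspension C E X \<in> iso_closure S"
proof -
  obtain X' where X': "X' \<in> S" "siso X X'" "X \<in> Obj C"
    using assms by (auto simp: iso_closure_def)
  then obtain i p where ip: "inj_confl i p" "Dom C i = X'" "Cod C p \<in> S"
    using assms(1) unfolding shift_stable_def by blast
  note h = injective_hull[OF X'(3)]
  have "siso (suspension C E X) (Cod C p)"
    unfolding suspension_def using siso_suspension[OF h(1) ip(1)] h(2) X' ip by simp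
  then show ?thesis using ip(3) siso_obj by (auto simp: iso_closure_def)
qed

lemma iso_closure_shift:
  assumes "shift_stable S"
  shows "iso_closure S = shift_subcat K (iso_closure S)"
proof (intro equalityI subsetI)
  fix Y assume Y: "Y \<in> iso_closure S"
  then obtain Y' where Y': "Y' \<in> S" "siso Y Y'" "Y \<in> Obj C"
    by (auto simp: iso_closure_def)
  then obtain i p where ip: "inj_confl i p" "Cod C p = Y'" "Dom C i \<in> S"
    using assms(1) unfolding shift_stable_def by blast
  have "siso Y (suspension C E (Dom C i))"
    using siso_trans[OF Y'(2)] siso_sym[OF suspension_siso[OF ip(1)]] ip(2) by simp
  moreover have "Dom C i \<in> iso_closure S"
    using inj_conflD(6)[OF ip(1)] siso_refl ip(3) by (auto simp: iso_closure_def)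
  ultimately show "Y \<in> shift_subcat K (iso_closure S)"
    using Y'(3) unfolding shift_subcat_def Obj_K isomorphic_K shift_obj_K by blast
next
  fix Y assume "Y \<in> shift_subcat K (iso_closure S)"
  then obtain X where "X \<in> iso_closure S" "siso Y (suspension C E X)"
    unfolding shift_subcat_def Obj_K isomorphic_K shift_obj_K by blast
  then show "Y \<in> iso_closure S"
    using suspension_in_iso_closure[OF assms] iso_closure_iso by blast
qed

section \<open>Left orthogonals and two out of three for triangles\<close>

definition left_perp :: "'o set \<Rightarrow> 'o set" where
  "left_perp T = {X \<in> Obj C. \<forall>V\<in>T. \<forall>f\<in>Homs C X V. Null f}"

lemma null_precomp_iso:
  assumes "siso X X'" "\<And>g. g \<in> Homs C X' V \<Longrightarrow> Null g" "f \<in> Homs C X V"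
  shows "Null f"
proof -
  obtain a b where ab: "a \<in> Homs C X X'" "b \<in> Homs C X' X" "b \<cdot> a \<sim> Ident C X"
    using assms(1) by (auto simp: siso_def)
  have "Null (f \<cdot> b)" using assms(3) ab by (intro assms(2)) (simp add: in_Homs alg)
  then have "Null ((f \<cdot> b) \<cdot> a)"
    by (rule comp_null) (use assms(3) ab in \<open>simp_all add: in_Homs alg\<close>)
  moreover have "f \<cdot> Ident C X \<sim> f \<cdot> (b \<cdot> a)"
    by (rule sim_comp[OF sim_sym[OF ab(3)]]) (use assms(3) ab in \<open>auto simp: in_Homs alg intro: sim_refl\<close>)
  ultimately show ?thesis
    using assms(3) ab sim_null by (simp add: in_Homs alg)
qed

lemma null_postcomp_iso:
  assumes "siso Y Y'" "\<And>g. g \<in> Homs C X Y' \<Longrightarrow> Null g" "f \<in> Homs C X Y"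
  shows "Null f"
proof -
  obtain a b where ab: "a \<in> Homs C Y Y'" "b \<in> Homs C Y' Y" "b \<cdot> a \<sim> Ident C Y"
    using assms(1) by (auto simp: siso_def)
  have "Null (a \<cdot> f)" using assms(3) ab by (intro assms(2)) (simp add: in_Homs alg)
  then have "Null (b \<cdot> (a \<cdot> f))"
    by (rule null_comp) (use assms(3) ab in \<open>simp_all add: in_Homs alg\<close>)
  moreover have "Ident C Y \<cdot> f \<sim> (b \<cdot> a) \<cdot> f"
    by (rule sim_comp[OF _ sim_sym[OF ab(3)]]) (use assms(3) ab in \<open>auto simp: in_Homs alg intro: sim_refl\<close>)
  ultimately show ?thesis
    using assms(3) ab sim_null by (simp add: in_Homs alg)
qed

lemma left_perp_iso: "siso X Y \<Longrightarrow> Y \<in> left_perp T \<Longrightarrow> X \<in> left_perp T"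
  unfolding left_perp_def using null_precomp_iso siso_obj(1) by blast

text \<open>The middle term of the conflation is only asked to be stably isomorphic to
  \<open>X\<close>: for complexes it is \<open>X\<close> plus a contractible summand.\<close>

lemma stable_t_structureI:
  assumes S: "shift_stable S" and T: "shift_stable T"
    and null: "\<And>X Y f. X \<in> S \<Longrightarrow> Y \<in> T \<Longrightarrow> f \<in> Homs C X Y \<Longrightarrow> Null f"
    and confl: "\<And>X. X \<in> Obj C \<Longrightarrow>
      \<exists>i p. (i, p) \<in> E \<and> Dom C i \<in> S \<and> Cod C p \<in> T \<and> siso X (Cod C i)"
  shows "stable_t_structure K (iso_closure S) (iso_closure T)"
  unfolding stable_t_structure_def
proof (intro conjI ballI)
  show "iso_closure S \<subseteq> Obj K" "iso_closure T \<subseteq> Obj K"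
    by (auto simp: iso_closure_def Obj_K)
  show "iso_closure S = shift_subcat K (iso_closure S)"
    "iso_closure T = shift_subcat K (iso_closure T)"
    using S T by (simp_all add: iso_closure_shift[symmetric])
  show "Homs K X Y = {Zero K X Y}" if mem: "X \<in> iso_closure S" "Y \<in> iso_closure T" for X Y
  proof -
    have XY: "X \<in> Obj C" "Y \<in> Obj C" using mem by (auto simp: iso_closure_def)
    obtain X' Y' where "X' \<in> S" "siso X X'" "Y' \<in> T" "siso Y Y'"
      using mem unfolding iso_closure_def by blast
    then have "Null f" if "f \<in> Homs C X Y" for f
      using that null null_precomp_iso null_postcomp_iso by metis
    then have "cls f = cls (Zero C X Y)" if "f \<in> Homs C X Y" for f
      using that sim_zero_iff[OF that] XY by (subst cls_eq_iff) (auto simp: in_Homs zero_arr)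
    moreover have "Zero C X Y \<in> Homs C X Y" using XY by (simp add: in_Homs zero_arr)
    ultimately show ?thesis unfolding Homs_K Zero_K by blast
  qed
  show "\<exists>(u, v, w)\<in>triangles K. Dom K u \<in> iso_closure S \<and> Dom K v = X \<and> Dom K w \<in> iso_closure T"
    if "X \<in> Obj K" for X
  proof -
    obtain i p where ip: "(i, p) \<in> E" "Dom C i \<in> S" "Cod C p \<in> T" "siso X (Cod C i)"
      using confl[of X] \<open>X \<in> Obj K\<close> unfolding Obj_K by blast
    have "Dom C i \<in> iso_closure S" "Cod C p \<in> iso_closure T"
      using ip S T siso_refl by (auto simp: iso_closure_def shift_stable_def)
    with conflation_triangle[OF ip(1,4)] show ?thesis by (auto elim!: rev_bexI)
  qed
qed

text \<open>Since \<open>f \<cdot> v\<close> is null, it extends to a map \<open>b\<close> on the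
  hull of \<open>Cod C u\<close>. Subtracting the null map \<open>b \<cdot> e\<close> makes the
  restriction along \<open>v\<close> strictly zero, and what remains factors through the suspension
  of \<open>Dom C u\<close>, where orthogonality applies.\<close>

lemma left_perp_third:
  assumes po: "pushout C u (hull_inc C E (Dom C u)) v t"
    and w: "w \<in> Homs C (Cod C v) (suspension C E (Dom C u))"
      "w \<cdot> v = Zero C (Cod C u) (suspension C E (Dom C u))" "w \<cdot> t = hull_proj C E (Dom C u)"
    and susp: "suspension C E (Dom C u) \<in> left_perp T" and Y: "Cod C u \<in> left_perp T"
  shows "Cod C v \<in> left_perp T"
  unfolding left_perp_def
proof (intro CollectI conjI ballI)
  note arr = pushout_arr[OF po]
  let ?i = "hull_inc C E (Dom C u)" and ?p = "hull_proj C E (Dom C u)"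
  show "Cod C v \<in> Obj C" using arr Cod_closed by simp
  fix V f assume V: "V \<in> T" and f: "f \<in> Homs C (Cod C v) V"
  have X: "Dom C u \<in> Obj C" "Cod C u \<in> Obj C" and VO: "V \<in> Obj C"
    using arr f Cod_closed[of f] by (auto simp: Dom_closed Cod_closed in_Homs)
  note i = inj_conflD[OF injective_hull(1)[OF X(1)]]
  note j = inj_conflD[OF injective_hull(1)[OF X(2)]] injective_hull(2)[OF X(2)]
  let ?j = "hull_inc C E (Cod C u)"
  let ?J = "Cod C ?j"
  have fv: "f \<cdot> v \<in> Homs C (Cod C u) V" using f arr by (simp add: in_Homs alg)
  then have "Null (f \<cdot> v)" using Y V by (auto simp: left_perp_def)
  then obtain b where b: "b \<in> Homs C ?J V" "b \<cdot> ?j = f \<cdot> v"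
    using null_extend[OF _ j(1), of "f \<cdot> v" V] fv j by auto
  have ju: "?j \<cdot> u \<in> Homs C (Dom C u) ?J" using j arr by (simp add: in_Homs alg)
  obtain a where a: "a \<in> Homs C (Cod C ?i) ?J" "a \<cdot> ?i = ?j \<cdot> u"
    using null_extend[OF null_into_injective[OF j(2) ju] i(1)] ju arr by auto
  obtain e where e: "e \<in> Homs C (Cod C v) ?J" "e \<cdot> v = ?j" "e \<cdot> t = a"
    using pushout_factor[OF po, of ?j ?J a] a j by (auto simp: in_Homs)
  let ?f = "f \<oplus> \<ominus> (b \<cdot> e)"
  have fv0: "?f \<cdot> v = Zero C (Cod C u) V"
    using f b e arr j X VO by (simp add: in_Homs alg)
  have "(?f \<cdot> t) \<cdot> ?i = (?f \<cdot> v) \<cdot> u"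
    using f b(1) e(1) arr by (simp add: in_Homs comp_assoc comp_arr add_arr neg_arr)
  also have "\<dots> = Zero C (Dom C u) V" unfolding fv0 using arr X VO by (simp add: alg)
  finally have "(?f \<cdot> t) \<cdot> ?i = Zero C (Dom C ?i) V" using arr by simp
  then obtain g where g: "g \<in> Homs C (Cod C ?p) V" "g \<cdot> ?p = ?f \<cdot> t"
    using confl_coker[OF i(1), of "?f \<cdot> t" V] f b(1) e(1) arr i by (auto simp: in_Homs alg)
  have "Null g" using susp V g(1) by (auto simp: left_perp_def suspension_def)
  then have gw: "Null (g \<cdot> w)"
    using comp_null[of g w] g(1) w(1) by (simp add: in_Homs suspension_def)
  have fgw: "?f = g \<cdot> w"
  proof (rule pushout_unique[OF po])
    show "?f \<in> Homs C (Cod C v) V" "g \<cdot> w \<in> Homs C (Cod C v) V"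
      using f b(1) e(1) g(1) w(1) by (simp_all add: in_Homs alg suspension_def)
    have "(g \<cdot> w) \<cdot> v = g \<cdot> Zero C (Cod C u) (Cod C ?p)"
      using g(1) w(1,2) arr by (simp add: in_Homs comp_assoc suspension_def)
    also have "\<dots> = Zero C (Cod C u) V" using g(1) X by (simp add: in_Homs comp_zero)
    finally show "?f \<cdot> v = (g \<cdot> w) \<cdot> v" using fv0 by simp
    show "?f \<cdot> t = (g \<cdot> w) \<cdot> t"
      using g(1) w(1) arr by (simp add: g(2)[symmetric] w(3) in_Homs comp_assoc suspension_def)
  qed
  have be: "Null (b \<cdot> e)"
    using null_comp[OF null_into_injective[OF j(2) e(1)], of b] b(1) e(1) by (simp add: in_Homs)
  have "Null (?f \<oplus> b \<cdot> e)"
    by (rule null_add[OF gw[folded fgw] be])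
      (use f b(1) e(1) in \<open>simp_all add: in_Homs alg\<close>)
  moreover have "?f \<oplus> b \<cdot> e = f"
    using f b(1) e(1) VO by (auto simp: in_Homs alg)
  ultimately show "Null f" by simp
qed

text \<open>The null map \<open>f \<cdot> u\<close> extends over the hull of \<open>Dom C u\<close>;
  this extension and \<open>f\<close> glue to a map on the pushout, which is null by
  orthogonality.\<close>

lemma left_perp_second:
  assumes po: "pushout C u (hull_inc C E (Dom C u)) v t"
    and X: "Dom C u \<in> left_perp T" and Z: "Cod C v \<in> left_perp T"
  shows "Cod C u \<in> left_perp T"
  unfolding left_perp_def
proof (intro CollectI conjI ballI)
  note arr = pushout_arr[OF po]
  let ?i = "hull_inc C E (Dom C u)"
  show Y: "Cod C u \<in> Obj C" using arr Cod_closed by simp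
  have XO: "Dom C u \<in> Obj C" using arr Dom_closed by simp
  note i = inj_conflD[OF injective_hull(1)[OF XO]]
  fix V f assume V: "V \<in> T" and f: "f \<in> Homs C (Cod C u) V"
  have fu: "f \<cdot> u \<in> Homs C (Dom C u) V" using f arr by (simp add: in_Homs alg)
  then have "Null (f \<cdot> u)" using X V by (auto simp: left_perp_def)
  then obtain b where b: "b \<in> Homs C (Cod C ?i) V" "b \<cdot> ?i = f \<cdot> u"
    using null_extend[OF _ i(1), of "f \<cdot> u" V] fu arr by auto
  obtain e where e: "e \<in> Homs C (Cod C v) V" "e \<cdot> v = f"
    using pushout_factor[OF po f b(1)] b(2) by auto
  have "Null e" using e Z V by (auto simp: left_perp_def)
  then show "Null f"
    using comp_null[of e v] e arr by (simp add: in_Homs)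
qed

text \<open>The problem is moved to a suspension of \<open>V\<close> that still lies in
  \<open>T\<close>. Gluing zero on \<open>Cod C u\<close> with \<open>q \<cdot> b\<close> gives a
  map out of the third vertex, null by orthogonality; its lift \<open>g'\<close> to the injective
  corrects \<open>b\<close>, so that \<open>f\<close> becomes \<open>a \<cdot> u\<close> minus
  \<open>e \<cdot> ?i\<close>. Here \<open>a\<close> starts in the second vertex and
  \<open>e\<close> in an injective, hence both are null.\<close>

lemma left_perp_first:
  assumes po: "pushout C u (hull_inc C E (Dom C u)) v t" and T: "shift_stable T"
    and Y: "Cod C u \<in> left_perp T" and Z: "Cod C v \<in> left_perp T"
  shows "Dom C u \<in> left_perp T"
  unfolding left_perp_def
proof (intro CollectI conjI ballI)
  note arr = pushout_arr[OF po]
  let ?i = "hull_inc C E (Dom C u)"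
  show XO: "Dom C u \<in> Obj C" using arr Dom_closed by simp
  have YO: "Cod C u \<in> Obj C" using arr Cod_closed by simp
  note i = inj_conflD[OF injective_hull(1)[OF XO]]
  fix V f assume V: "V \<in> T" and f: "f \<in> Homs C (Dom C u) V"
  obtain j q where jq: "inj_confl j q" "Dom C j = V" "Cod C q \<in> T"
    using T V unfolding shift_stable_def by blast
  note j = inj_conflD[OF jq(1)]
  have jf: "j \<cdot> f \<in> Homs C (Dom C u) (Cod C j)" using f jq(2) j by (simp add: in_Homs alg)
  obtain b where b: "b \<in> Homs C (Cod C ?i) (Cod C j)" "b \<cdot> ?i = j \<cdot> f"
    using null_extend[OF null_into_injective[OF j(2) jf] i(1)] jf arr by auto
  have "(q \<cdot> b) \<cdot> ?i = (q \<cdot> j) \<cdot> f"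
    using f b j i jq(2) by (simp add: in_Homs alg)
  also have "\<dots> = Zero C (Cod C u) (Cod C q) \<cdot> u"
    unfolding confl_zero[OF j(1)] using f j jq(2) arr YO by (auto simp: in_Homs alg)
  finally have "Zero C (Cod C u) (Cod C q) \<cdot> u = (q \<cdot> b) \<cdot> ?i" ..
  then obtain g where g: "g \<in> Homs C (Cod C v) (Cod C q)" "g \<cdot> v = Zero C (Cod C u) (Cod C q)"
    "g \<cdot> t = q \<cdot> b"
    using pushout_factor[OF po, of "Zero C (Cod C u) (Cod C q)" "Cod C q" "q \<cdot> b"] b j YO
    by (auto simp: in_Homs alg)
  have "Null g" using g Z jq(3) by (auto simp: left_perp_def)
  then obtain g' where g': "g' \<in> Homs C (Cod C v) (Cod C j)" "q \<cdot> g' = g"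
    using null_lift[OF _ j(1) g(1)] by auto
  have "q \<cdot> (g' \<cdot> v) = (q \<cdot> g') \<cdot> v"
    using g'(1) j arr by (simp add: in_Homs alg)
  also have "\<dots> = Zero C (Cod C u) (Cod C q)" by (simp add: g'(2) g(2))
  finally obtain a where a: "a \<in> Homs C (Cod C u) V" "j \<cdot> a = g' \<cdot> v"
    using confl_ker[OF j(1), of "g' \<cdot> v" "Cod C u"] g'(1) arr jq(2) by (auto simp: in_Homs alg)
  have "q \<cdot> (g' \<cdot> t \<oplus> \<ominus> b) = (q \<cdot> g') \<cdot> t \<oplus> \<ominus> (q \<cdot> b)"
    using g'(1) j arr b by (simp add: in_Homs alg)
  also have "\<dots> = Zero C (Cod C ?i) (Cod C q)"
    unfolding g'(2) g(3) using j b by (auto simp: in_Homs alg)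
  finally obtain e where e: "e \<in> Homs C (Cod C ?i) V" "j \<cdot> e = g' \<cdot> t \<oplus> \<ominus> b"
    using confl_ker[OF j(1), of "g' \<cdot> t \<oplus> \<ominus> b" "Cod C ?i"] g'(1) arr jq(2) b
    by (auto simp: in_Homs alg)
  have "j \<cdot> (a \<cdot> u \<oplus> \<ominus> (e \<cdot> ?i)) = (j \<cdot> a) \<cdot> u \<oplus> \<ominus> ((j \<cdot> e) \<cdot> ?i)"
    using a(1) e(1) jq(2) j arr by (simp add: in_Homs alg)
  also have "\<dots> = g' \<cdot> (t \<cdot> ?i) \<oplus> (\<ominus> (g' \<cdot> (t \<cdot> ?i)) \<oplus> j \<cdot> f)"
    unfolding a(2) e(2) using g'(1) b j arr f jq(2) by (simp add: in_Homs alg)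
  also have "\<dots> = j \<cdot> f"
    using g'(1) j arr f jq(2) by (simp add: in_Homs alg)
  finally have eq: "a \<cdot> u \<oplus> \<ominus> (e \<cdot> ?i) = f"
    by (rule confl_mono[OF j(1), rotated 2]) (use a(1) e(1) f jq(2) arr in \<open>simp_all add: in_Homs alg\<close>)
  have "Null a" using Y V a(1) by (auto simp: left_perp_def)
  then have au: "Null (a \<cdot> u)"
    by (rule comp_null) (use a arr in \<open>simp_all add: in_Homs\<close>)
  have ei: "Null (\<ominus> (e \<cdot> ?i))"
    using comp_null[OF null_from_injective[OF i(2) e(1)], of ?i] e(1) i
    by (simp add: in_Homs null_neg alg)
  show "Null f"
    unfolding eq[symmetric]
    by (rule null_add[OF au ei]) (use a(1) e(1) arr in \<open>simp_all add: in_Homs alg\<close>)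
qed

lemma zero_object_K:
  assumes "zero_object C Z"
  shows "zero_object K Z"
proof -
  have "\<exists>!g. g \<in> cls ` A" if "\<exists>!f. f \<in> A" for A using that by blast
  then show ?thesis using assms unfolding zero_object_def Obj_K Homs_K by blast
qed

text \<open>The orthogonal description settles all triangles, whereas invariance under translation
  comes from \<open>S\<close>; the latter also supplies the suspension of the first vertex that
  \<open>left_perp_third\<close> asks for.\<close>

lemma triangulated_subcatI:
  assumes S: "shift_stable S" and T: "shift_stable T" and eq: "iso_closure S = left_perp T"
    and zero: "zero_object C Z" "Z \<in> S"
  shows "triangulated_subcat K (iso_closure S)"
proof -
  let ?U = "iso_closure S"
  have two_of_three: "(Dom K u \<in> ?U \<and> Dom K v \<in> ?U \<longrightarrow> Dom K w \<in> ?U) \<and>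
      (Dom K v \<in> ?U \<and> Dom K w \<in> ?U \<longrightarrow> Dom K u \<in> ?U) \<and>
      (Dom K u \<in> ?U \<and> Dom K w \<in> ?U \<longrightarrow> Dom K v \<in> ?U)"
    if "(u, v, w) \<in> triangles K" for u v w
  proof -
    obtain u' v' w' t where t: "pushout C u' (hull_inc C E (Dom C u')) v' t"
      "w' \<in> Homs C (Cod C v') (suspension C E (Dom C u'))"
      "w' \<cdot> v' = Zero C (Cod C u') (suspension C E (Dom C u'))"
      "w' \<cdot> t = hull_proj C E (Dom C u')"
      and iso: "siso (Dom K u) (Dom C u')" "siso (Dom K v) (Cod C u')" "siso (Dom K w) (Cod C v')"
      using triangle_standard[OF \<open>(u, v, w) \<in> triangles K\<close>] by blast
    have in_U: "X \<in> ?U \<longleftrightarrow> Y \<in> ?U" if "siso X Y" for X Y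
      using iso_closure_iso that siso_sym by blast
    show ?thesis
      unfolding in_U[OF iso(1)] in_U[OF iso(2)] in_U[OF iso(3)]
      using left_perp_third[OF t, of T] left_perp_second[OF t(1), of T] left_perp_first[OF t(1) T]
        suspension_in_iso_closure[OF S, of "Dom C u'"] unfolding eq by blast
  qed
  show ?thesis
    unfolding triangulated_subcat_def isomorphic_K
  proof (intro conjI)
    show "?U \<subseteq> Obj K" by (auto simp: iso_closure_def Obj_K)
    show "\<exists>Z\<in>?U. zero_object K Z"
    proof (rule bexI)
      show "zero_object K Z" by (rule zero_object_K[OF zero(1)])
      show "Z \<in> ?U" using zero siso_refl by (auto simp: iso_closure_def zero_object_def)
    qed
    show "\<forall>X\<in>?U. \<forall>Y\<in>Obj K. siso X Y \<longrightarrow> Y \<in> ?U"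
      using iso_closure_iso siso_sym by blast
    show "?U = shift_subcat K ?U" by (rule iso_closure_shift[OF S])
  qed (use two_of_three in \<open>unfold Let_def, blast\<close>)
qed

end

section \<open>The category of \<open>N\<close>-complexes\<close>

context preadditive_category
begin

text \<open>\<open>biproduct\<close> hides the four structure maps behind quantifiers; with the maps
  as arguments, a biproduct of complexes can be compared with those of its components.\<close>

definition biprod :: "_ \<Rightarrow> _ \<Rightarrow> _ \<Rightarrow> _ \<Rightarrow> _ \<Rightarrow> _ \<Rightarrow> _ \<Rightarrow> bool" where
  "biprod X Y S i j p q \<longleftrightarrow>
    i \<in> Homs C X S \<and> j \<in> Homs C Y S \<and> p \<in> Homs C S X \<and> q \<in> Homs C S Y \<and>
    p \<cdot> i = Ident C X \<and> q \<cdot> j = Ident C Y \<and> p \<cdot> j = Zero C Y X \<and> q \<cdot> i = Zero C X Y \<and>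
    i \<cdot> p \<oplus> j \<cdot> q = Ident C S"

lemma biprodD:
  assumes "biprod X Y S i j p q"
  shows "i \<in> Arr C" "Dom C i = X" "Cod C i = S" "j \<in> Arr C" "Dom C j = Y" "Cod C j = S"
    "p \<in> Arr C" "Dom C p = S" "Cod C p = X" "q \<in> Arr C" "Dom C q = S" "Cod C q = Y"
    "X \<in> Obj C" "Y \<in> Obj C" "S \<in> Obj C"
    "p \<cdot> i = Ident C X" "q \<cdot> j = Ident C Y" "p \<cdot> j = Zero C Y X" "q \<cdot> i = Zero C X Y"
    "i \<cdot> p \<oplus> j \<cdot> q = Ident C S"
  using assms Dom_closed Cod_closed by (auto simp: biprod_def in_Homs)

lemmas biprod_red = comp_reduce[OF biprodD(16)] comp_reduce[OF biprodD(17)]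
  comp_reduce[OF biprodD(18)] comp_reduce[OF biprodD(19)]

lemma biprod_exists_iff: "biproduct C X Y S \<longleftrightarrow> S \<in> Obj C \<and> (\<exists>i j p q. biprod X Y S i j p q)"
  unfolding biproduct_def biprod_def by blast

end

locale ncomplex_category = additive_category C for C :: "('o, 'm, 'z) precat_scheme" (structure) +
  fixes N :: nat
  assumes N_pos: "0 < N"
begin

abbreviation CC :: "(('o, 'm) ncomplex, ('o, 'm) chain_map) precat" where "CC \<equiv> C_cat C N"

text \<open>Indexing by both end points instead of by length makes composition and reindexing free
  of index arithmetic. It is meant for \<open>a \<le> b\<close>; otherwise \<open>nat\<close>
  truncates and the value is an identity.\<close>

definition dd :: "('o, 'm) ncomplex \<Rightarrow> int \<Rightarrow> int \<Rightarrow> 'm" where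
  "dd X a b = diff_iter C X a (nat (b - a))"

lemma ncomplexD:
  assumes "X \<in> ncomplexes C N"
  shows "deg X i \<in> Obj C" "diff X i \<in> Arr C" "Dom C (diff X i) = deg X i"
    "Cod C (diff X i) = deg X (i + 1)" "diff_iter C X i N = Zero C (deg X i) (deg X (i + int N))"
  using assms by (auto simp: ncomplexes_def in_Homs)

lemma diff_iter_arr:
  assumes "\<And>i. deg X i \<in> Obj C" "\<And>i. diff X i \<in> Homs C (deg X i) (deg X (i + 1))"
  shows "diff_iter C X i k \<in> Homs C (deg X i) (deg X (i + int k))"
proof (induction k)
  case (Suc k)
  then show ?case
    using assms(2)[of "i + int k"] by (simp add: in_Homs cat add.assoc add.commute[of 1])
qed (simp add: assms Id_closed)

lemma diff_iter_plus:
  assumes "\<And>i. deg X i \<in> Obj C" "\<And>i. diff X i \<in> Homs C (deg X i) (deg X (i + 1))"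
  shows "diff_iter C X i (k + l) = diff_iter C X (i + int k) l \<cdot> diff_iter C X i k"
proof (induction l)
  case 0
  show ?case using diff_iter_arr[OF assms, of i k] by (simp add: in_Homs cat)
next
  case (Suc l)
  then show ?case
    using diff_iter_arr[OF assms, of i k] diff_iter_arr[OF assms, of "i + int k" l]
      assms(2)[of "i + int k + int l"]
    by (simp add: in_Homs cat add.assoc)
qed

lemma diff_iter_arr':
  assumes "X \<in> ncomplexes C N"
  shows "diff_iter C X i k \<in> Arr C" "Dom C (diff_iter C X i k) = deg X i"
    "Cod C (diff_iter C X i k) = deg X (i + int k)"
  using diff_iter_arr[of X i k] ncomplexD[OF assms] by (auto simp: in_Homs)

lemma dd_self: "dd X a a = Ident C (deg X a)"
  by (simp add: dd_def)

context
  fixes X assumes X: "X \<in> ncomplexes C N"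
begin

lemma dd_arr:
  assumes "a \<le> b"
  shows "dd X a b \<in> Arr C" "Dom C (dd X a b) = deg X a" "Cod C (dd X a b) = deg X b"
  using diff_iter_arr[of X a "nat (b - a)"] ncomplexD[OF X] assms by (auto simp: dd_def in_Homs)

lemma dd_step: "dd X a (a + 1) = diff X a"
  using ncomplexD[OF X] by (simp add: dd_def cat)

lemma dd_comp: "a \<le> b \<Longrightarrow> b \<le> c \<Longrightarrow> dd X b c \<cdot> dd X a b = dd X a c"
  using diff_iter_plus[of X a "nat (b - a)" "nat (c - b)"] ncomplexD[OF X]
  by (simp add: dd_def in_Homs nat_add_distrib[symmetric])

lemma dd_comp_assoc:
  "a \<le> b \<Longrightarrow> b \<le> c \<Longrightarrow> f \<in> Arr C \<Longrightarrow> Cod C f = deg X a \<Longrightarrow> dd X b c \<cdot> (dd X a b \<cdot> f) = dd X a c \<cdot> f"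
  using comp_assoc[of f "dd X a b" "dd X b c"] by (simp add: dd_arr dd_comp)

lemma dd_zero:
  assumes "a + int N \<le> b"
  shows "dd X a b = Zero C (deg X a) (deg X b)"
proof -
  have "dd X a (a + int N) = Zero C (deg X a) (deg X (a + int N))"
    using ncomplexD(5)[OF X] by (simp add: dd_def)
  then have "dd X (a + int N) b \<cdot> dd X a (a + int N) = Zero C (deg X a) (deg X b)"
    using assms ncomplexD[OF X] by (simp add: comp_zero dd_arr)
  then show ?thesis using dd_comp[of a "a + int N" b] assms by simp
qed

end

lemma ncomplexI:
  assumes "\<And>i. deg X i \<in> Obj C" "\<And>i. diff X i \<in> Homs C (deg X i) (deg X (i + 1))"
    and "\<And>i. diff_iter C X i N = Zero C (deg X i) (deg X (i + int N))"
  shows "X \<in> ncomplexes C N"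
  using assms by (simp add: ncomplexes_def)

lemma chain_mapD:
  assumes "f \<in> chain_maps C N"
  shows "source f \<in> ncomplexes C N" "target f \<in> ncomplexes C N"
    "component f i \<in> Arr C" "Dom C (component f i) = deg (source f) i"
    "Cod C (component f i) = deg (target f) i"
    "component f (i + 1) \<cdot> diff (source f) i = diff (target f) i \<cdot> component f i"
  using assms by (auto simp: chain_maps_def in_Homs)

lemma chain_mapI:
  assumes "source f \<in> ncomplexes C N" "target f \<in> ncomplexes C N"
    and "\<And>i. component f i \<in> Homs C (deg (source f) i) (deg (target f) i)"
    and "\<And>i. component f (i + 1) \<cdot> diff (source f) i = diff (target f) i \<cdot> component f i"
  shows "f \<in> chain_maps C N"
  using assms by (simp add: chain_maps_def)

lemma chain_map_dd:
  assumes f: "f \<in> chain_maps C N" and "a \<le> b"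
  shows "component f b \<cdot> dd (source f) a b = dd (target f) a b \<cdot> component f a"
  using \<open>a \<le> b\<close>
proof (induction b rule: int_ge_induct)
  case base
  show ?case using chain_mapD[OF f] by (simp add: dd_self cat)
next
  case (step b)
  note D = chain_mapD(1-5)[OF f] ncomplexD[OF chain_mapD(1)[OF f]] ncomplexD[OF chain_mapD(2)[OF f]]
  have eq: "dd X a (b + 1) = diff X b \<cdot> dd X a b" if "X \<in> ncomplexes C N" for X
    using dd_comp[OF that, of a b "b + 1"] step(1) dd_step[OF that] by simp
  have "component f (b + 1) \<cdot> (diff (source f) b \<cdot> dd (source f) a b)
      = (component f (b + 1) \<cdot> diff (source f) b) \<cdot> dd (source f) a b"
    using D step(1) by (simp add: comp_assoc dd_arr)
  also have "\<dots> = diff (target f) b \<cdot> (component f b \<cdot> dd (source f) a b)"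
    unfolding chain_mapD(6)[OF f] using D step(1) by (simp add: comp_assoc dd_arr)
  also have "\<dots> = (diff (target f) b \<cdot> dd (target f) a b) \<cdot> component f a"
    unfolding step(2) using D step(1) by (simp add: comp_assoc dd_arr)
  finally show ?case using D by (simp add: eq)
qed

lemma CC_simps [simp]:
  "Obj CC = ncomplexes C N" "Arr CC = chain_maps C N" "Dom CC = source" "Cod CC = target"
  "source (Ident CC X) = X" "target (Ident CC X) = X" "component (Ident CC X) i = Ident C (deg X i)"
  "source (g \<cdot>\<^bsub>CC\<^esub> f) = source f" "target (g \<cdot>\<^bsub>CC\<^esub> f) = target g"
  "component (g \<cdot>\<^bsub>CC\<^esub> f) i = component g i \<cdot> component f i"
  "source (Add CC f g) = source f" "target (Add CC f g) = target f"
  "component (Add CC f g) i = component f i \<oplus> component g i"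
  "source (Zero CC X Y) = X" "target (Zero CC X Y) = Y"
  "component (Zero CC X Y) i = Zero C (deg X i) (deg Y i)"
  by (simp_all add: C_cat_def)

lemma chain_map_eqI:
  fixes f g :: "('o, 'm) chain_map"
  assumes "source f = source g" "target f = target g" "\<And>i. component f i = component g i"
  shows "f = g"
  using assms by (intro chain_map.equality) auto

lemma ident_chain_map: "X \<in> ncomplexes C N \<Longrightarrow> Ident CC X \<in> chain_maps C N"
  by (rule chain_mapI) (simp_all add: ncomplexD in_Homs cat)

lemma comp_chain_map:
  assumes f: "f \<in> chain_maps C N" and g: "g \<in> chain_maps C N" and eq: "source g = target f"
  shows "g \<cdot>\<^bsub>CC\<^esub> f \<in> chain_maps C N"
proof (rule chain_mapI)
  fix i
  note D = chain_mapD(1-5)[OF f] chain_mapD(1-5)[OF g] ncomplexD[OF chain_mapD(1)[OF f]]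
    ncomplexD[OF chain_mapD(2)[OF f]] ncomplexD[OF chain_mapD(2)[OF g]] eq
  have "(component g (i + 1) \<cdot> component f (i + 1)) \<cdot> diff (source f) i
      = component g (i + 1) \<cdot> (component f (i + 1) \<cdot> diff (source f) i)"
    using D by (simp add: comp_assoc)
  also have "\<dots> = (component g (i + 1) \<cdot> diff (source g) i) \<cdot> component f i"
    unfolding chain_mapD(6)[OF f] using D by (simp add: comp_assoc)
  also have "\<dots> = diff (target g) i \<cdot> (component g i \<cdot> component f i)"
    unfolding chain_mapD(6)[OF g] using D by (simp add: comp_assoc)
  finally show "component (g \<cdot>\<^bsub>CC\<^esub> f) (i + 1) \<cdot> diff (source (g \<cdot>\<^bsub>CC\<^esub> f)) i =
      diff (target (g \<cdot>\<^bsub>CC\<^esub> f)) i \<cdot> component (g \<cdot>\<^bsub>CC\<^esub> f) i" by simp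
qed (use chain_mapD[OF f] chain_mapD[OF g] eq in \<open>simp_all add: in_Homs cat\<close>)

lemma zero_chain_map: "X \<in> ncomplexes C N \<Longrightarrow> Y \<in> ncomplexes C N \<Longrightarrow> Zero CC X Y \<in> chain_maps C N"
  by (rule chain_mapI) (simp_all add: ncomplexD in_Homs alg)

lemma add_chain_map:
  assumes f: "f \<in> chain_maps C N" and g: "g \<in> chain_maps C N"
    and eq: "source g = source f" "target g = target f"
  shows "Add CC f g \<in> chain_maps C N"
proof (rule chain_mapI)
  fix i
  note D = chain_mapD[OF f] chain_mapD[OF g] ncomplexD[OF chain_mapD(1)[OF f]]
    ncomplexD[OF chain_mapD(2)[OF f]] eq
  show "component (Add CC f g) (i + 1) \<cdot> diff (source (Add CC f g)) i =
      diff (target (Add CC f g)) i \<cdot> component (Add CC f g) i"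
    using D by (simp add: add_comp comp_add)
qed (use chain_mapD[OF f] chain_mapD[OF g] eq in \<open>simp_all add: in_Homs alg\<close>)

lemma neg_chain_map:
  assumes f: "f \<in> chain_maps C N"
  shows "\<lparr>source = source f, target = target f, component = \<lambda>i. \<ominus> component f i\<rparr> \<in> chain_maps C N"
  by (rule chain_mapI)
    (use chain_mapD[OF f] ncomplexD[OF chain_mapD(1)[OF f]] ncomplexD[OF chain_mapD(2)[OF f]]
      in \<open>simp_all add: in_Homs neg_arr comp_neg neg_comp\<close>)

lemma Homs_CC: "Homs CC X Y = {f \<in> chain_maps C N. source f = X \<and> target f = Y}"
  by (simp add: Homs_def)

lemma preadditive_CC: "preadditive_category CC"
proof (intro preadditive_category.intro category.intro preadditive_category_axioms.intro)
  fix X Y assume XY: "X \<in> Obj CC" "Y \<in> Obj CC"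
  show "comm_group (Hom_group CC X Y)"
  proof (rule comm_groupI)
    fix f assume "f \<in> carrier (Hom_group CC X Y)"
    then have f: "f \<in> chain_maps C N" "source f = X" "target f = Y"
      by (auto simp: Hom_group_def Homs_CC)
    let ?g = "\<lparr>source = source f, target = target f, component = \<lambda>i. \<ominus> component f i\<rparr>"
    have "Add CC ?g f = Zero CC X Y"
      using f chain_mapD[OF f(1)] by (intro chain_map_eqI) (simp_all add: add_neg)
    moreover have "?g \<in> Homs CC X Y" using f neg_chain_map[OF f(1)] by (simp add: Homs_CC)
    ultimately show "\<exists>g\<in>carrier (Hom_group CC X Y). g \<otimes>\<^bsub>Hom_group CC X Y\<^esub> f = \<one>\<^bsub>Hom_group CC X Y\<^esub>"
      by (auto simp: Hom_group_def)
  qed (use XY in \<open>auto simp: Hom_group_def Homs_CC zero_chain_map add_chain_map chain_mapD alg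
    intro!: chain_map_eqI add_commute\<close>)
next
  fix f X Y assume "f \<in> Homs CC X Y"
  then show "f \<cdot>\<^bsub>CC\<^esub> Ident CC X = f" "Ident CC Y \<cdot>\<^bsub>CC\<^esub> f = f"
    by (auto simp: Homs_CC cat chain_mapD intro!: chain_map_eqI)
next
  fix f g h W X Y Z assume "f \<in> Homs CC W X" "g \<in> Homs CC X Y" "h \<in> Homs CC Y Z"
  then show "(h \<cdot>\<^bsub>CC\<^esub> g) \<cdot>\<^bsub>CC\<^esub> f = h \<cdot>\<^bsub>CC\<^esub> (g \<cdot>\<^bsub>CC\<^esub> f)"
    by (auto simp: Homs_CC comp_assoc chain_mapD intro!: chain_map_eqI)
next
  fix f f' g X Y Z assume "f \<in> Homs CC X Y" "f' \<in> Homs CC X Y" "g \<in> Homs CC Y Z"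
  then show "g \<cdot>\<^bsub>CC\<^esub> Add CC f f' = Add CC (g \<cdot>\<^bsub>CC\<^esub> f) (g \<cdot>\<^bsub>CC\<^esub> f')"
    by (auto simp: Homs_CC comp_add chain_mapD intro!: chain_map_eqI)
next
  fix f g g' X Y Z assume "f \<in> Homs CC X Y" "g \<in> Homs CC Y Z" "g' \<in> Homs CC Y Z"
  then show "Add CC g g' \<cdot>\<^bsub>CC\<^esub> f = Add CC (g \<cdot>\<^bsub>CC\<^esub> f) (g' \<cdot>\<^bsub>CC\<^esub> f)"
    by (auto simp: Homs_CC add_comp chain_mapD intro!: chain_map_eqI)
qed (auto simp: Homs_CC chain_mapD ident_chain_map comp_chain_map)

end

sublocale ncomplex_category \<subseteq> CC: preadditive_category "C_cat C N"
  by (rule preadditive_CC)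

context ncomplex_category
begin

lemma neg_CC:
  assumes "f \<in> chain_maps C N"
  shows "source (CC.neg f) = source f" "target (CC.neg f) = target f"
    "component (CC.neg f) i = \<ominus> component f i"
proof -
  have "CC.neg f = \<lparr>source = source f, target = target f, component = \<lambda>i. \<ominus> component f i\<rparr>"
    by (rule CC.neg_unique)
      (use assms chain_mapD[OF assms] neg_chain_map[OF assms] in
        \<open>auto simp: alg intro!: chain_map_eqI\<close>)
  then show "source (CC.neg f) = source f" "target (CC.neg f) = target f"
    "component (CC.neg f) i = \<ominus> component f i" by simp_all
qed

text \<open>The biproduct is recorded twice: as one of complexes for homotopy arguments, and degree
  by degree because splitness of a conflation is a degreewise condition.\<close>

lemma CC_biprod_exists:
  assumes X: "X \<in> ncomplexes C N" and Y: "Y \<in> ncomplexes C N"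
  shows "\<exists>S i j p q. CC.biprod X Y S i j p q \<and> (\<forall>k. biprod (deg X k) (deg Y k) (deg S k)
    (component i k) (component j k) (component p k) (component q k))"
proof -
  have "\<forall>k. \<exists>S i j p q. biprod (deg X k) (deg Y k) S i j p q"
    using has_biproducts ncomplexD(1)[OF X] ncomplexD(1)[OF Y] biprod_exists_iff by metis
  then obtain S i j p q where bp: "\<And>k. biprod (deg X k) (deg Y k) (S k) (i k) (j k) (p k) (q k)"
    by metis
  note D = biprodD[OF bp] biprod_red[OF bp] ncomplexD[OF X] ncomplexD[OF Y]
  define d where "d k = i (k + 1) \<cdot> diff X k \<cdot> p k \<oplus> j (k + 1) \<cdot> diff Y k \<cdot> q k" for k
  define T where "T = \<lparr>deg = S, diff = d\<rparr>"
  have T: "deg T k = S k" "diff T k = d k" for k by (simp_all add: T_def)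
  have d: "d k \<in> Homs C (S k) (S (k + 1))" for k
    using D by (simp add: d_def in_Homs alg)
  have iter: "diff_iter C T k n = i (k + int n) \<cdot> diff_iter C X k n \<cdot> p k
      \<oplus> j (k + int n) \<cdot> diff_iter C Y k n \<cdot> q k" for k n
  proof (induction n)
    case 0
    show ?case using D by (simp add: T alg)
  next
    case (Suc n)
    show ?case
      using D Suc diff_iter_arr'[OF X] diff_iter_arr'[OF Y]
      by (simp add: T d_def alg add.assoc add.commute[of 1])
  qed
  have TN: "T \<in> ncomplexes C N"
    by (rule ncomplexI) (use D d iter in \<open>simp_all add: T alg\<close>)
  let ?i = "\<lparr>source = X, target = T, component = i\<rparr>"
  let ?j = "\<lparr>source = Y, target = T, component = j\<rparr>"
  let ?p = "\<lparr>source = T, target = X, component = p\<rparr>"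
  let ?q = "\<lparr>source = T, target = Y, component = q\<rparr>"
  have maps: "?i \<in> chain_maps C N" "?j \<in> chain_maps C N" "?p \<in> chain_maps C N" "?q \<in> chain_maps C N"
    by (rule chain_mapI, use X Y TN D in \<open>simp_all add: T d_def in_Homs alg\<close>)+
  then have "CC.biprod X Y T ?i ?j ?p ?q"
    unfolding CC.biprod_def using D by (auto simp: Homs_CC T intro!: chain_map_eqI)
  then show ?thesis using bp
    by (intro exI[of _ T] exI[of _ ?i] exI[of _ ?j] exI[of _ ?p] exI[of _ ?q]) (simp add: T)
qed

text \<open>On a zero object the identity is also the zero arrow, so identities are admissible
  differentials; with them the complex satisfies the condition defining each \<open>strict_F\<close>
  literally.\<close>

lemma zero_complex:
  assumes "zero_object C Z"
  shows "zero_object CC \<lparr>deg = \<lambda>i. Z, diff = \<lambda>i. Ident C Z\<rparr>" (is "zero_object _ ?Z")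
proof -
  have Z: "Z \<in> Obj C" using assms by (simp add: zero_object_def)
  have into: "f = g" if "f \<in> Homs C X Z" "g \<in> Homs C X Z" "X \<in> Obj C" for f g X
    using assms that unfolding zero_object_def by blast
  have out: "f = g" if "f \<in> Homs C Z X" "g \<in> Homs C Z X" "X \<in> Obj C" for f g X
    using assms that unfolding zero_object_def by blast
  have "diff_iter C ?Z i n \<in> Homs C Z Z" for i n
    using diff_iter_arr[of ?Z i n] Z by (simp add: Id_closed)
  then have ZN: "?Z \<in> ncomplexes C N"
    using Z by (intro ncomplexI) (auto intro!: into simp: in_Homs zero_arr ident_arr)
  have "\<exists>!f. f \<in> Homs CC X ?Z" if "X \<in> ncomplexes C N" for X
  proof (rule ex1I)
    show "Zero CC X ?Z \<in> Homs CC X ?Z" using that ZN by (simp add: Homs_CC zero_chain_map)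
    show "f = Zero CC X ?Z" if f: "f \<in> Homs CC X ?Z" for f
      using f \<open>X \<in> _\<close> Z
      by (intro chain_map_eqI into[of _ "deg X _"])
        (auto simp: Homs_CC in_Homs chain_mapD zero_arr ncomplexD)
  qed
  moreover have "\<exists>!f. f \<in> Homs CC ?Z X" if "X \<in> ncomplexes C N" for X
  proof (rule ex1I)
    show "Zero CC ?Z X \<in> Homs CC ?Z X" using that ZN by (simp add: Homs_CC zero_chain_map)
    show "f = Zero CC ?Z X" if f: "f \<in> Homs CC ?Z X" for f
      using f \<open>X \<in> _\<close> Z
      by (intro chain_map_eqI out[of _ "deg X _"])
        (auto simp: Homs_CC in_Homs chain_mapD zero_arr ncomplexD)
  qed
  ultimately show ?thesis using ZN by (simp add: zero_object_def)
qed

lemma additive_CC: "additive_category CC"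
proof unfold_locales
  show "\<exists>Z. zero_object CC Z" using has_zero_object zero_complex by blast
  show "\<exists>S. biproduct CC X Y S" if "X \<in> Obj CC" "Y \<in> Obj CC" for X Y
    using CC_biprod_exists[of X Y] that CC.biprodD(15) CC.biprod_exists_iff by (metis CC_simps(1))
qed

end

subsection \<open>Null-homotopic maps\<close>

context preadditive_category
begin

abbreviation hsum where "hsum X Y f A \<equiv> finprod (Hom_group C X Y) f A"

lemma hsum_closed:
  assumes "X \<in> Obj C" "Y \<in> Obj C" "\<And>a. a \<in> A \<Longrightarrow> f a \<in> Homs C X Y"
  shows "hsum X Y f A \<in> Homs C X Y"
proof -
  interpret G: comm_group "Hom_group C X Y" using assms by (intro Hom_comm_group)
  show ?thesis using G.finprod_closed[of f A] assms by (auto simp: Hom_group_simps)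
qed

lemma hsum_insert:
  assumes "X \<in> Obj C" "Y \<in> Obj C" "finite A" "b \<notin> A" "\<And>a. a \<in> insert b A \<Longrightarrow> f a \<in> Homs C X Y"
  shows "hsum X Y f (insert b A) = f b \<oplus> hsum X Y f A"
proof -
  interpret G: comm_group "Hom_group C X Y" using assms by (intro Hom_comm_group)
  show ?thesis using G.finprod_insert[of A b f] assms by (auto simp: Hom_group_simps)
qed

lemma hsum_empty: "X \<in> Obj C \<Longrightarrow> Y \<in> Obj C \<Longrightarrow> hsum X Y f {} = Zero C X Y"
proof -
  assume "X \<in> Obj C" "Y \<in> Obj C"
  then interpret G: comm_group "Hom_group C X Y" by (intro Hom_comm_group)
  show ?thesis using G.finprod_empty by (simp add: Hom_group_simps)
qed

lemma hsum_cong: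
  assumes "X \<in> Obj C" "Y \<in> Obj C" "\<And>a. a \<in> A \<Longrightarrow> f a = g a" "\<And>a. a \<in> A \<Longrightarrow> g a \<in> Homs C X Y"
  shows "hsum X Y f A = hsum X Y g A"
proof -
  interpret G: comm_group "Hom_group C X Y" using assms by (intro Hom_comm_group)
  show ?thesis using assms by (intro G.finprod_cong') (auto simp: Hom_group_simps)
qed

lemma hsum_reindex:
  assumes "X \<in> Obj C" "Y \<in> Obj C" "inj_on h A" "\<And>a. a \<in> A \<Longrightarrow> f (h a) \<in> Homs C X Y"
  shows "hsum X Y f (h ` A) = hsum X Y (\<lambda>a. f (h a)) A"
proof -
  interpret G: comm_group "Hom_group C X Y" using assms by (intro Hom_comm_group)
  show ?thesis using assms by (intro G.finprod_reindex) (auto simp: Hom_group_simps)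
qed

lemma hsum_union:
  assumes "X \<in> Obj C" "Y \<in> Obj C" "finite A" "finite A'" "A \<inter> A' = {}"
    "\<And>a. a \<in> A \<union> A' \<Longrightarrow> f a \<in> Homs C X Y"
  shows "hsum X Y f (A \<union> A') = hsum X Y f A \<oplus> hsum X Y f A'"
proof -
  interpret G: comm_group "Hom_group C X Y" using assms by (intro Hom_comm_group)
  show ?thesis using assms G.finprod_Un_disjoint[of A A' f] by (auto simp: Hom_group_simps)
qed

lemma hsum_add:
  assumes "X \<in> Obj C" "Y \<in> Obj C" "\<And>a. a \<in> A \<Longrightarrow> f a \<in> Homs C X Y" "\<And>a. a \<in> A \<Longrightarrow> g a \<in> Homs C X Y"
  shows "hsum X Y f A \<oplus> hsum X Y g A = hsum X Y (\<lambda>a. f a \<oplus> g a) A"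
proof -
  interpret G: comm_group "Hom_group C X Y" using assms by (intro Hom_comm_group)
  show ?thesis using assms G.finprod_multf[of f A g] by (auto simp: Hom_group_simps)
qed

lemma comp_hsum:
  assumes "X \<in> Obj C" "Y \<in> Obj C" "finite A" "\<And>a. a \<in> A \<Longrightarrow> f a \<in> Homs C X Y" "h \<in> Homs C Y Z"
  shows "h \<cdot> hsum X Y f A = hsum X Z (\<lambda>a. h \<cdot> f a) A"
proof -
  have Z: "Z \<in> Obj C" using assms(5) Cod_closed by (auto simp: in_Homs)
  show ?thesis using assms(3,4)
  proof (induction A rule: finite_induct)
    case empty
    then show ?case using assms Z by (auto simp: hsum_empty in_Homs comp_zero)
  next
    case (insert b A)
    have "hsum X Y f A \<in> Homs C X Y" by (rule hsum_closed) (use insert assms in auto)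
    moreover have "h \<cdot> f a \<in> Homs C X Z" if "a \<in> Set.insert b A" for a
      using insert(4)[OF that] assms(5) by (simp add: in_Homs comp_arr)
    moreover have "hsum X Y f (Set.insert b A) = f b \<oplus> hsum X Y f A"
      by (rule hsum_insert) (use insert assms in auto)
    moreover have "hsum X Z (\<lambda>a. h \<cdot> f a) (Set.insert b A) = h \<cdot> f b \<oplus> hsum X Z (\<lambda>a. h \<cdot> f a) A"
      by (rule hsum_insert) (use insert assms Z calculation in auto)
    ultimately show ?case using insert assms by (simp add: in_Homs comp_add)
  qed
qed

lemma hsum_comp:
  assumes "X \<in> Obj C" "Y \<in> Obj C" "finite A" "\<And>a. a \<in> A \<Longrightarrow> f a \<in> Homs C X Y" "h \<in> Homs C W X"
  shows "hsum X Y f A \<cdot> h = hsum W Y (\<lambda>a. f a \<cdot> h) A"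
proof -
  have W: "W \<in> Obj C" using assms(5) Dom_closed by (auto simp: in_Homs)
  show ?thesis using assms(3,4)
  proof (induction A rule: finite_induct)
    case empty
    then show ?case using assms W by (auto simp: hsum_empty in_Homs zero_comp)
  next
    case (insert b A)
    have "hsum X Y f A \<in> Homs C X Y" by (rule hsum_closed) (use insert assms in auto)
    moreover have "f a \<cdot> h \<in> Homs C W Y" if "a \<in> Set.insert b A" for a
      using insert(4)[OF that] assms(5) by (simp add: in_Homs comp_arr)
    moreover have "hsum X Y f (Set.insert b A) = f b \<oplus> hsum X Y f A"
      by (rule hsum_insert) (use insert assms in auto)
    moreover have "hsum W Y (\<lambda>a. f a \<cdot> h) (Set.insert b A) = f b \<cdot> h \<oplus> hsum W Y (\<lambda>a. f a \<cdot> h) A"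
      by (rule hsum_insert) (use insert assms W calculation in auto)
    ultimately show ?case using insert assms by (simp add: in_Homs add_comp)
  qed
qed

end

context ncomplex_category
begin

definition homotopy_family :: "('o, 'm) ncomplex \<Rightarrow> ('o, 'm) ncomplex \<Rightarrow> (int \<Rightarrow> 'm) \<Rightarrow> bool" where
  "homotopy_family X Y s \<longleftrightarrow> (\<forall>i. s i \<in> Homs C (deg X i) (deg Y (i - int N + 1)))"

text \<open>The summand of the null-homotopy formula in the variable \<open>t = i + j - 1\<close>,
  the degree in which \<open>s\<close> is applied; \<open>t\<close> then runs through the window
  \<open>{i..<i + int N}\<close>.\<close>

definition homotopy_term :: "('o, 'm) ncomplex \<Rightarrow> ('o, 'm) ncomplex \<Rightarrow> (int \<Rightarrow> 'm) \<Rightarrow> int \<Rightarrow> int \<Rightarrow> 'm"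
  where "homotopy_term X Y s i t = dd Y (t - int N + 1) i \<cdot> s t \<cdot> dd X i t"

definition homotopy_map :: "('o, 'm) ncomplex \<Rightarrow> ('o, 'm) ncomplex \<Rightarrow> (int \<Rightarrow> 'm) \<Rightarrow> ('o, 'm) chain_map"
  where "homotopy_map X Y s = \<lparr>source = X, target = Y, component = \<lambda>i.
    hsum (deg X i) (deg Y i) (homotopy_term X Y s i) {i..<i + int N}\<rparr>"

lemma homotopy_map_simps [simp]:
  "source (homotopy_map X Y s) = X" "target (homotopy_map X Y s) = Y"
  "component (homotopy_map X Y s) i =
    hsum (deg X i) (deg Y i) (homotopy_term X Y s i) {i..<i + int N}"
  by (simp_all add: homotopy_map_def)

lemma homotopy_familyD:
  assumes "homotopy_family X Y s"
  shows "s i \<in> Arr C" "Dom C (s i) = deg X i" "Cod C (s i) = deg Y (i - int N + 1)"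
  using assms by (auto simp: homotopy_family_def in_Homs)

context
  fixes X Y s
  assumes X: "X \<in> ncomplexes C N" and Y: "Y \<in> ncomplexes C N" and s: "homotopy_family X Y s"
begin

lemma homotopy_term_closed:
  assumes "t \<in> {i..<i + int N}"
  shows "homotopy_term X Y s i t \<in> Homs C (deg X i) (deg Y i)"
  using assms homotopy_familyD[OF s]
  by (simp add: homotopy_term_def in_Homs comp_arr dd_arr[OF X] dd_arr[OF Y])

lemma homotopy_map_component:
  "component (homotopy_map X Y s) i \<in> Homs C (deg X i) (deg Y i)"
  unfolding homotopy_map_simps
  by (rule hsum_closed) (use homotopy_term_closed ncomplexD(1)[OF X] ncomplexD(1)[OF Y] in auto)

text \<open>The summand at \<open>t = i\<close> dies because it ends in a composite of
  \<open>N\<close> differentials of \<open>Y\<close>. In \<open>homotopy_map_diff_right\<close> it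
  is the summand at \<open>t = i + N\<close> that dies, in \<open>X\<close>; both sides of the chain
  map equation are thus one and the same sum.\<close>

lemma homotopy_map_diff_left:
  "diff Y i \<cdot> component (homotopy_map X Y s) i
    = hsum (deg X i) (deg Y (i + 1)) (\<lambda>t. dd Y (t - int N + 1) (i + 1) \<cdot> s t \<cdot> dd X i t) {i + 1..<i + int N}"
proof -
  note [simp] = ncomplexD(1-4)[OF X] ncomplexD(1-4)[OF Y] homotopy_familyD[OF s]
    dd_arr[OF X] dd_arr[OF Y] comp_arr
  let ?F = "\<lambda>t. dd Y (t - int N + 1) (i + 1) \<cdot> s t \<cdot> dd X i t"
  have F: "?F t \<in> Homs C (deg X i) (deg Y (i + 1))" if "t \<in> {i..<i + int N}" for t
    using that by (simp add: in_Homs)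
  have "diff Y i \<cdot> component (homotopy_map X Y s) i
      = hsum (deg X i) (deg Y (i + 1)) (\<lambda>t. diff Y i \<cdot> homotopy_term X Y s i t) {i..<i + int N}"
    unfolding homotopy_map_simps
    by (rule comp_hsum) (use homotopy_term_closed in \<open>auto simp: in_Homs[of "diff Y i"]\<close>)
  also have "\<dots> = hsum (deg X i) (deg Y (i + 1)) ?F {i..<i + int N}"
  proof (rule hsum_cong)
    fix t assume t: "t \<in> {i..<i + int N}"
    then show "diff Y i \<cdot> homotopy_term X Y s i t = ?F t"
      using dd_comp_assoc[OF Y, of "t - int N + 1" i "i + 1" "s t \<cdot> dd X i t"]
      by (simp add: homotopy_term_def dd_step[OF Y])
  qed (use F in auto)
  also have "{i..<i + int N} = Set.insert i {i + 1..<i + int N}" using N_pos by auto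
  also have "hsum (deg X i) (deg Y (i + 1)) ?F \<dots>
      = ?F i \<oplus> hsum (deg X i) (deg Y (i + 1)) ?F {i + 1..<i + int N}"
    using F N_pos by (intro hsum_insert) auto
  also have "?F i = Zero C (deg X i) (deg Y (i + 1))"
    by (simp add: dd_zero[OF Y] zero_comp)
  also have "\<dots> \<oplus> hsum (deg X i) (deg Y (i + 1)) ?F {i + 1..<i + int N}
      = hsum (deg X i) (deg Y (i + 1)) ?F {i + 1..<i + int N}"
    using hsum_closed[of "deg X i" "deg Y (i + 1)" "{i + 1..<i + int N}" ?F] F
    by (intro zero_add) (auto simp: in_Homs)
  finally show ?thesis .
qed

lemma homotopy_map_diff_right:
  "component (homotopy_map X Y s) (i + 1) \<cdot> diff X i
    = hsum (deg X i) (deg Y (i + 1)) (\<lambda>t. dd Y (t - int N + 1) (i + 1) \<cdot> s t \<cdot> dd X i t) {i + 1..<i + int N}"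
proof -
  note [simp] = ncomplexD(1-4)[OF X] ncomplexD(1-4)[OF Y] homotopy_familyD[OF s]
    dd_arr[OF X] dd_arr[OF Y] comp_arr
  let ?F = "\<lambda>t. dd Y (t - int N + 1) (i + 1) \<cdot> s t \<cdot> dd X i t"
  have F: "?F t \<in> Homs C (deg X i) (deg Y (i + 1))" if "t \<in> {i + 1..<i + 1 + int N}" for t
    using that by (simp add: in_Homs)
  have "component (homotopy_map X Y s) (i + 1) \<cdot> diff X i = hsum (deg X i) (deg Y (i + 1))
      (\<lambda>t. homotopy_term X Y s (i + 1) t \<cdot> diff X i) {i + 1..<i + 1 + int N}"
    unfolding homotopy_map_simps
    by (rule hsum_comp) (use homotopy_term_closed[of _ "i + 1"] in \<open>auto simp: in_Homs[of "diff X i"]\<close>)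
  also have "\<dots> = hsum (deg X i) (deg Y (i + 1)) ?F {i + 1..<i + 1 + int N}"
  proof (rule hsum_cong)
    fix t assume t: "t \<in> {i + 1..<i + 1 + int N}"
    then show "homotopy_term X Y s (i + 1) t \<cdot> diff X i = ?F t"
      using dd_comp[OF X, of i "i + 1" t]
      by (simp add: homotopy_term_def comp_assoc dd_step[OF X])
  qed (use F in auto)
  also have "{i + 1..<i + 1 + int N} = Set.insert (i + int N) {i + 1..<i + int N}"
    using N_pos by auto
  also have "hsum (deg X i) (deg Y (i + 1)) ?F \<dots>
      = ?F (i + int N) \<oplus> hsum (deg X i) (deg Y (i + 1)) ?F {i + 1..<i + int N}"
  proof (rule hsum_insert)
    show "?F a \<in> Homs C (deg X i) (deg Y (i + 1))"
      if "a \<in> Set.insert (i + int N) {i + 1..<i + int N}" for a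
      by (rule F) (use that N_pos in auto)
  qed auto
  also have "?F (i + int N) = Zero C (deg X i) (deg Y (i + 1))"
    using homotopy_familyD(3)[OF s, of "i + int N"]
    by (simp add: dd_zero[OF X] comp_zero)
  also have "\<dots> \<oplus> hsum (deg X i) (deg Y (i + 1)) ?F {i + 1..<i + int N}
      = hsum (deg X i) (deg Y (i + 1)) ?F {i + 1..<i + int N}"
    using hsum_closed[of "deg X i" "deg Y (i + 1)" "{i + 1..<i + int N}" ?F] F
    by (intro zero_add) (auto simp: in_Homs)
  finally show ?thesis .
qed

lemma homotopy_map_chain_map: "homotopy_map X Y s \<in> chain_maps C N"
  unfolding chain_maps_def mem_Collect_eq homotopy_map_simps(1,2)
proof (intro conjI allI)
  show "component (homotopy_map X Y s) (i + 1) \<cdot> diff X i = diff Y i \<cdot> component (homotopy_map X Y s) i"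
    for i by (simp only: homotopy_map_diff_left homotopy_map_diff_right)
qed (rule X Y homotopy_map_component)+

text \<open>A chain map passes through the differentials of every summand, so composing with it acts
  on the homotopy alone. With the mirror statement \<open>homotopy_map_comp\<close> this makes
  null-homotopic maps an ideal.\<close>

lemma comp_homotopy_map:
  assumes g: "g \<in> chain_maps C N" "source g = Y"
  shows "homotopy_family X (target g) (\<lambda>t. component g (t - int N + 1) \<cdot> s t)"
    and "g \<cdot>\<^bsub>CC\<^esub> homotopy_map X Y s
      = homotopy_map X (target g) (\<lambda>t. component g (t - int N + 1) \<cdot> s t)"
proof -
  note Z = chain_mapD(2)[OF g(1)]
  note [simp] = ncomplexD(1-4)[OF X] ncomplexD(1-4)[OF Y] ncomplexD(1-4)[OF Z] homotopy_familyD[OF s]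
    dd_arr[OF X] dd_arr[OF Y] dd_arr[OF Z] comp_arr chain_mapD(3-5)[OF g(1), unfolded g(2)]
  show fam: "homotopy_family X (target g) (\<lambda>t. component g (t - int N + 1) \<cdot> s t)" (is "homotopy_family _ _ ?s")
    by (simp add: homotopy_family_def in_Homs)
  show "g \<cdot>\<^bsub>CC\<^esub> homotopy_map X Y s = homotopy_map X (target g) ?s"
  proof (rule chain_map_eqI)
    fix i
    have "component g i \<cdot> component (homotopy_map X Y s) i = hsum (deg X i) (deg (target g) i)
        (\<lambda>t. component g i \<cdot> homotopy_term X Y s i t) {i..<i + int N}"
      unfolding homotopy_map_simps
      by (rule comp_hsum) (use homotopy_term_closed in \<open>auto simp: in_Homs[of "component g i"]\<close>)
    also have "\<dots> = hsum (deg X i) (deg (target g) i) (homotopy_term X (target g) ?s i) {i..<i + int N}"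
    proof (rule hsum_cong)
      fix t assume t: "t \<in> {i..<i + int N}"
      then have "component g i \<cdot> dd Y (t - int N + 1) i
          = dd (target g) (t - int N + 1) i \<cdot> component g (t - int N + 1)"
        using chain_map_dd[OF g(1), of "t - int N + 1" i] by (simp add: g(2))
      from comp_reduce[OF this, of "s t \<cdot> dd X i t"] t
      show "component g i \<cdot> homotopy_term X Y s i t = homotopy_term X (target g) ?s i t"
        by (simp add: homotopy_term_def comp_assoc)
    qed (auto simp: homotopy_term_def in_Homs)
    finally show "component (g \<cdot>\<^bsub>CC\<^esub> homotopy_map X Y s) i = component (homotopy_map X (target g) ?s) i"
      by simp
  qed auto
qed

lemma homotopy_map_comp:
  assumes f: "f \<in> chain_maps C N" "target f = X"
  shows "homotopy_family (source f) Y (\<lambda>t. s t \<cdot> component f t)"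
    and "homotopy_map X Y s \<cdot>\<^bsub>CC\<^esub> f = homotopy_map (source f) Y (\<lambda>t. s t \<cdot> component f t)"
proof -
  note Z = chain_mapD(1)[OF f(1)]
  note [simp] = ncomplexD(1-4)[OF X] ncomplexD(1-4)[OF Y] ncomplexD(1-4)[OF Z] homotopy_familyD[OF s]
    dd_arr[OF X] dd_arr[OF Y] dd_arr[OF Z] comp_arr chain_mapD(3-5)[OF f(1), unfolded f(2)]
  show fam: "homotopy_family (source f) Y (\<lambda>t. s t \<cdot> component f t)" (is "homotopy_family _ _ ?s")
    by (simp add: homotopy_family_def in_Homs)
  show "homotopy_map X Y s \<cdot>\<^bsub>CC\<^esub> f = homotopy_map (source f) Y ?s"
  proof (rule chain_map_eqI)
    fix i
    have "component (homotopy_map X Y s) i \<cdot> component f i = hsum (deg (source f) i) (deg Y i)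
        (\<lambda>t. homotopy_term X Y s i t \<cdot> component f i) {i..<i + int N}"
      unfolding homotopy_map_simps
      by (rule hsum_comp) (use homotopy_term_closed in \<open>auto simp: in_Homs[of "component f i"]\<close>)
    also have "\<dots> = hsum (deg (source f) i) (deg Y i) (homotopy_term (source f) Y ?s i) {i..<i + int N}"
    proof (rule hsum_cong)
      fix t assume t: "t \<in> {i..<i + int N}"
      then show "homotopy_term X Y s i t \<cdot> component f i = homotopy_term (source f) Y ?s i t"
        using chain_map_dd[OF f(1), of i t] by (simp add: homotopy_term_def comp_assoc f(2))
    qed (auto simp: homotopy_term_def in_Homs)
    finally show "component (homotopy_map X Y s \<cdot>\<^bsub>CC\<^esub> f) i = component (homotopy_map (source f) Y ?s) i"
      by simp
  qed auto
qed

lemma add_homotopy_map: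
  assumes s': "homotopy_family X Y s'"
  shows "homotopy_family X Y (\<lambda>t. s t \<oplus> s' t)"
    and "Add CC (homotopy_map X Y s) (homotopy_map X Y s') = homotopy_map X Y (\<lambda>t. s t \<oplus> s' t)"
proof -
  note [simp] = ncomplexD(1-4)[OF X] ncomplexD(1-4)[OF Y] homotopy_familyD[OF s]
    homotopy_familyD[OF s'] dd_arr[OF X] dd_arr[OF Y] comp_arr add_arr
  show "homotopy_family X Y (\<lambda>t. s t \<oplus> s' t)"
    by (simp add: homotopy_family_def in_Homs)
  show "Add CC (homotopy_map X Y s) (homotopy_map X Y s') = homotopy_map X Y (\<lambda>t. s t \<oplus> s' t)"
  proof (rule chain_map_eqI)
    fix i
    have "hsum (deg X i) (deg Y i) (homotopy_term X Y s i) {i..<i + int N}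
        \<oplus> hsum (deg X i) (deg Y i) (homotopy_term X Y s' i) {i..<i + int N}
        = hsum (deg X i) (deg Y i) (\<lambda>t. homotopy_term X Y s i t \<oplus> homotopy_term X Y s' i t) {i..<i + int N}"
      by (rule hsum_add) (auto simp: homotopy_term_def in_Homs)
    also have "\<dots> = hsum (deg X i) (deg Y i) (homotopy_term X Y (\<lambda>t. s t \<oplus> s' t) i) {i..<i + int N}"
      by (rule hsum_cong) (auto simp: homotopy_term_def in_Homs add_comp comp_add)
    finally show "component (Add CC (homotopy_map X Y s) (homotopy_map X Y s')) i
        = component (homotopy_map X Y (\<lambda>t. s t \<oplus> s' t)) i" by simp
  qed auto
qed

end

text \<open>The substitution \<open>t = i + j - 1\<close> identifies the defining sum over
  \<open>{1..N}\<close> with the sum over the window of degrees.\<close>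

lemma null_homotopic_iff:
  assumes f: "f \<in> chain_maps C N"
  shows "null_homotopic C N f \<longleftrightarrow> (\<exists>s. homotopy_family (source f) (target f) s \<and>
    f = homotopy_map (source f) (target f) s)"
proof -
  let ?X = "source f" and ?Y = "target f"
  note X = chain_mapD(1)[OF f] and Y = chain_mapD(2)[OF f]
  have eq: "hsum (deg ?X i) (deg ?Y i) (\<lambda>j. diff_iter C ?Y (i - int N + int j) (N - j) \<cdot>
        s (i + int j - 1) \<cdot> diff_iter C ?X i (j - 1)) {1..N}
      = component (homotopy_map ?X ?Y s) i" if s: "homotopy_family ?X ?Y s" for s i
  proof -
    let ?h = "\<lambda>j::nat. i + int j - 1"
    have "t \<in> ?h ` {1..N}" if "i \<le> t" "t < i + int N" for t
      by (rule image_eqI[of _ _ "nat (t - i + 1)"]) (use that in auto)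
    then have im: "{i..<i + int N} = ?h ` {1..N}" by auto
    have "component (homotopy_map ?X ?Y s) i
        = hsum (deg ?X i) (deg ?Y i) (\<lambda>j. homotopy_term ?X ?Y s i (?h j)) {1..N}"
      unfolding homotopy_map_simps im
      by (rule hsum_reindex)
        (use ncomplexD(1)[OF X] ncomplexD(1)[OF Y] homotopy_term_closed[OF X Y s] in \<open>auto simp: inj_on_def\<close>)
    also have "\<dots> = hsum (deg ?X i) (deg ?Y i) (\<lambda>j. diff_iter C ?Y (i - int N + int j) (N - j) \<cdot>
        s (i + int j - 1) \<cdot> diff_iter C ?X i (j - 1)) {1..N}"
    proof (rule hsum_cong)
      fix j assume j: "j \<in> {1..N}"
      then have "nat (int N - int j) = N - j" "nat (int j - 1) = j - 1" by auto
      then show *: "homotopy_term ?X ?Y s i (?h j) = diff_iter C ?Y (i - int N + int j) (N - j) \<cdot>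
          s (i + int j - 1) \<cdot> diff_iter C ?X i (j - 1)"
        by (simp add: homotopy_term_def dd_def algebra_simps)
      show "diff_iter C ?Y (i - int N + int j) (N - j) \<cdot>
          s (i + int j - 1) \<cdot> diff_iter C ?X i (j - 1) \<in> Homs C (deg ?X i) (deg ?Y i)"
        using homotopy_term_closed[OF X Y s, of "?h j" i] j unfolding *[symmetric] by auto
    qed (use ncomplexD(1)[OF X] ncomplexD(1)[OF Y] in auto)
    finally show ?thesis ..
  qed
  have "(\<forall>i. component f i = hsum (deg ?X i) (deg ?Y i) (\<lambda>j. diff_iter C ?Y (i - int N + int j) (N - j) \<cdot>
        s (i + int j - 1) \<cdot> diff_iter C ?X i (j - 1)) {1..N}) \<longleftrightarrow> f = homotopy_map ?X ?Y s"
    if s: "homotopy_family ?X ?Y s" for s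
    unfolding eq[OF s]
  proof
    assume "\<forall>i. component f i = component (homotopy_map ?X ?Y s) i"
    then show "f = homotopy_map ?X ?Y s" by (intro chain_map_eqI) auto
  next
    assume "f = homotopy_map ?X ?Y s"
    from fun_cong[OF arg_cong[where f = component, OF this]]
    show "\<forall>i. component f i = component (homotopy_map ?X ?Y s) i" ..
  qed
  then show ?thesis
    unfolding null_homotopic_def Let_def homotopy_family_def[symmetric] by blast
qed

end

section \<open>Split sequences and their direct sums\<close>

context preadditive_category
begin

definition splitting where
  "splitting f g r t \<longleftrightarrow> f \<in> Arr C \<and> g \<in> Arr C \<and> Cod C f = Dom C g \<and>
    r \<in> Homs C (Cod C f) (Dom C f) \<and> t \<in> Homs C (Cod C g) (Dom C g) \<and>
    g \<cdot> f = Zero C (Dom C f) (Cod C g) \<and> r \<cdot> f = Ident C (Dom C f) \<and> g \<cdot> t = Ident C (Cod C g) \<and>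
    f \<cdot> r \<oplus> t \<cdot> g = Ident C (Cod C f)"

lemma split_short_exact_iff: "split_short_exact C f g \<longleftrightarrow> (\<exists>r t. splitting f g r t)"
  unfolding split_short_exact_def splitting_def by blast

lemma splittingD:
  assumes "splitting f g r t"
  shows "f \<in> Arr C" "g \<in> Arr C" "r \<in> Arr C" "t \<in> Arr C"
    "Dom C g = Cod C f" "Dom C r = Cod C f" "Cod C r = Dom C f" "Dom C t = Cod C g" "Cod C t = Cod C f"
    "g \<cdot> f = Zero C (Dom C f) (Cod C g)" "r \<cdot> f = Ident C (Dom C f)" "g \<cdot> t = Ident C (Cod C g)"
    "f \<cdot> r \<oplus> t \<cdot> g = Ident C (Cod C f)" "r \<cdot> t = Zero C (Cod C g) (Dom C f)"
proof -
  show rt: "f \<in> Arr C" "g \<in> Arr C" "r \<in> Arr C" "t \<in> Arr C"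
    "Dom C g = Cod C f" "Dom C r = Cod C f" "Cod C r = Dom C f" "Dom C t = Cod C g" "Cod C t = Cod C f"
    "g \<cdot> f = Zero C (Dom C f) (Cod C g)" "r \<cdot> f = Ident C (Dom C f)" "g \<cdot> t = Ident C (Cod C g)"
    "f \<cdot> r \<oplus> t \<cdot> g = Ident C (Cod C f)"
    using assms by (auto simp: splitting_def in_Homs)
  \<comment> \<open>Inserting the decomposition of the identity between \<open>r\<close> and
    \<open>t\<close> gives \<open>r \<cdot> t\<close> twice on one side and once on the other, which
    forces it to vanish.\<close>
  have "r \<cdot> t \<oplus> r \<cdot> t = (r \<cdot> f) \<cdot> r \<cdot> t \<oplus> r \<cdot> t \<cdot> (g \<cdot> t)"
    unfolding rt(11,12) using rt(1-9) by (simp add: cat)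
  also have "\<dots> = r \<cdot> (f \<cdot> r \<oplus> t \<cdot> g) \<cdot> t"
    using rt(1-9) by (simp add: alg)
  also have "\<dots> = r \<cdot> t \<oplus> Zero C (Cod C g) (Dom C f)"
    unfolding rt(13) using rt(1-9) by (simp add: alg)
  finally show "r \<cdot> t = Zero C (Cod C g) (Dom C f)"
    by (rule add_left_cancel) (use rt(1-9) in \<open>simp_all add: alg\<close>)
qed

lemma split_short_exactI:
  assumes "f \<in> Arr C" "g \<in> Arr C" "r \<in> Arr C" "t \<in> Arr C"
    "Dom C g = Cod C f" "Dom C r = Cod C f" "Cod C r = Dom C f" "Dom C t = Cod C g" "Cod C t = Cod C f"
    "g \<cdot> f = Zero C (Dom C f) (Cod C g)" "r \<cdot> f = Ident C (Dom C f)" "g \<cdot> t = Ident C (Cod C g)"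
    "f \<cdot> r \<oplus> t \<cdot> g = Ident C (Cod C f)"
  shows "split_short_exact C f g"
proof -
  have "splitting f g r t" using assms by (simp add: splitting_def in_Homs)
  then show ?thesis unfolding split_short_exact_iff by blast
qed

lemma add_swap_cancel:
  assumes "a \<in> Arr C" "b \<in> Arr C" "c \<in> Arr C" "d \<in> Arr C" "Dom C b = Dom C a" "Cod C b = Cod C a"
    "Dom C c = Dom C a" "Cod C c = Cod C a" "Dom C d = Dom C a" "Cod C d = Cod C a"
  shows "(a \<oplus> b) \<oplus> (c \<oplus> (d \<oplus> \<ominus> b)) = (a \<oplus> c) \<oplus> d"
proof -
  have "b \<oplus> (c \<oplus> (d \<oplus> \<ominus> b)) = c \<oplus> (b \<oplus> (d \<oplus> \<ominus> b))"
    by (rule add_left_commute) (use assms in \<open>simp_all add: alg\<close>)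
  also have "b \<oplus> (d \<oplus> \<ominus> b) = d \<oplus> (b \<oplus> \<ominus> b)"
    by (rule add_left_commute) (use assms in \<open>simp_all add: alg\<close>)
  also have "\<dots> = d" using assms by (simp add: alg)
  finally have "b \<oplus> (c \<oplus> (d \<oplus> \<ominus> b)) = c \<oplus> d" .
  then show ?thesis using assms by (simp add: alg)
qed

lemma biprod_sym:
  assumes "biprod X Y S i j p q"
  shows "biprod Y X S j i q p"
  using assms add_commute[of "i \<cdot> p" "j \<cdot> q"] biprodD[OF assms]
  by (simp add: biprod_def in_Homs cat)

end

context additive_category
begin

lemma biprod_exists:
  assumes "X \<in> Obj C" "Y \<in> Obj C"
  obtains S i j p q where "biprod X Y S i j p q"
  using has_biproducts[OF assms] unfolding biprod_exists_iff by blast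

lemma split_mono_ident:
  assumes "X \<in> Obj C"
  shows "\<exists>g. split_short_exact C (Ident C X) g" "\<exists>f. split_short_exact C f (Ident C X)"
proof -
  obtain Z where Z: "zero_object C Z" using has_zero_object by blast
  then have ZO: "Z \<in> Obj C" by (simp add: zero_object_def)
  then have "Zero C Z Z \<in> Homs C Z Z" "Ident C Z \<in> Homs C Z Z" by (simp_all add: in_Homs alg)
  then have eq: "Zero C Z Z = Ident C Z" using Z unfolding zero_object_def by blast
  have "split_short_exact C (Ident C X) (Zero C X Z)"
    by (rule split_short_exactI[of _ _ "Ident C X" "Zero C Z X"])
      (use assms ZO eq in \<open>simp_all add: alg\<close>)
  moreover have "split_short_exact C (Zero C Z X) (Ident C X)"
    by (rule split_short_exactI[of _ _ "Zero C X Z" "Ident C X"])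
      (use assms ZO eq in \<open>simp_all add: alg\<close>)
  ultimately show "\<exists>g. split_short_exact C (Ident C X) g" "\<exists>f. split_short_exact C f (Ident C X)" by blast+
qed

text \<open>The retraction \<open>r \<cdot> p\<close> ignores the second coordinate. Shearing the
  second coordinate by \<open>f' \<cdot> r\<close> turns the column with entries \<open>f\<close>
  and \<open>f'\<close> into one with entries \<open>f\<close> and zero, whose cokernel is the sum
  \<open>T\<close> of \<open>Cod C g\<close> and \<open>A'\<close>; the displayed cokernel map is
  that shear followed by \<open>g\<close> on the first coordinate.\<close>

lemma split_mono_pair:
  assumes bp: "biprod A A' S i j p q" and f: "split_short_exact C f g" "Cod C f = A"
    and f': "f' \<in> Homs C (Dom C f) A'"
  shows "\<exists>h. split_short_exact C (i \<cdot> f \<oplus> j \<cdot> f') h"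
proof -
  obtain r t where "splitting f g r t"
    using f(1) unfolding split_short_exact_iff by blast
  note rt = splittingD[OF this]
  note D = biprodD[OF bp]
  note ft = f'[unfolded in_Homs]
  obtain T j1 j2 q1 q2 where T: "biprod (Cod C g) A' T j1 j2 q1 q2"
    by (rule biprod_exists[OF Cod_closed[OF rt(2)] D(14)])
  note [simp] = alg D(1-15) rt(1-9) ft f(2) biprodD(1-15)[OF T]
  note red = comp_reduce[OF rt(10)] comp_reduce[OF rt(11)] comp_reduce[OF rt(12)]
    comp_reduce[OF rt(14)] biprod_red[OF bp] biprod_red[OF T]
  have sum1: "f \<cdot> r \<oplus> t \<cdot> g = Ident C A" using rt(13) f(2) by simp
  have fr: "i \<cdot> f \<cdot> r \<cdot> p \<oplus> i \<cdot> t \<cdot> g \<cdot> p = i \<cdot> p"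
  proof -
    have "i \<cdot> f \<cdot> r \<cdot> p \<oplus> i \<cdot> t \<cdot> g \<cdot> p = i \<cdot> (f \<cdot> r \<oplus> t \<cdot> g) \<cdot> p" by simp
    then show ?thesis unfolding sum1 by simp
  qed
  have "split_short_exact C (i \<cdot> f \<oplus> j \<cdot> f') (j1 \<cdot> g \<cdot> p \<oplus> j2 \<cdot> (q \<oplus> \<ominus> (f' \<cdot> r \<cdot> p)))"
  proof (rule split_short_exactI[of _ _ "r \<cdot> p" "i \<cdot> t \<cdot> q1 \<oplus> j \<cdot> q2"])
    show "(j1 \<cdot> g \<cdot> p \<oplus> j2 \<cdot> (q \<oplus> \<ominus> (f' \<cdot> r \<cdot> p))) \<cdot> (i \<cdot> f \<oplus> j \<cdot> f') =
        Zero C (Dom C (i \<cdot> f \<oplus> j \<cdot> f')) (Cod C (j1 \<cdot> g \<cdot> p \<oplus> j2 \<cdot> (q \<oplus> \<ominus> (f' \<cdot> r \<cdot> p))))"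
      using rt(10,11) by (simp add: red)
    show "(r \<cdot> p) \<cdot> (i \<cdot> f \<oplus> j \<cdot> f') = Ident C (Dom C (i \<cdot> f \<oplus> j \<cdot> f'))"
      using rt(11) by (simp add: red)
    show "(j1 \<cdot> g \<cdot> p \<oplus> j2 \<cdot> (q \<oplus> \<ominus> (f' \<cdot> r \<cdot> p))) \<cdot> (i \<cdot> t \<cdot> q1 \<oplus> j \<cdot> q2)
        = Ident C (Cod C (j1 \<cdot> g \<cdot> p \<oplus> j2 \<cdot> (q \<oplus> \<ominus> (f' \<cdot> r \<cdot> p))))"
      using biprodD(20)[OF T] by (simp add: red)
    have cod: "Cod C (i \<cdot> f \<oplus> j \<cdot> f') = S" by simp
    have "(i \<cdot> f \<oplus> j \<cdot> f') \<cdot> r \<cdot> p \<oplus>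
        (i \<cdot> t \<cdot> q1 \<oplus> j \<cdot> q2) \<cdot> (j1 \<cdot> g \<cdot> p \<oplus> j2 \<cdot> (q \<oplus> \<ominus> (f' \<cdot> r \<cdot> p)))
        = (i \<cdot> f \<cdot> r \<cdot> p \<oplus> j \<cdot> f' \<cdot> r \<cdot> p) \<oplus>
          (i \<cdot> t \<cdot> g \<cdot> p \<oplus> (j \<cdot> q \<oplus> \<ominus> (j \<cdot> f' \<cdot> r \<cdot> p)))"
      by (simp add: red)
    also have "\<dots> = (i \<cdot> f \<cdot> r \<cdot> p \<oplus> i \<cdot> t \<cdot> g \<cdot> p) \<oplus> j \<cdot> q"
      by (rule add_swap_cancel) simp_all
    also note fr
    also note D(20)
    finally show "(i \<cdot> f \<oplus> j \<cdot> f') \<cdot> r \<cdot> p \<oplus>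
        (i \<cdot> t \<cdot> q1 \<oplus> j \<cdot> q2) \<cdot> (j1 \<cdot> g \<cdot> p \<oplus> j2 \<cdot> (q \<oplus> \<ominus> (f' \<cdot> r \<cdot> p)))
        = Ident C (Cod C (i \<cdot> f \<oplus> j \<cdot> f'))"
      unfolding cod .
  qed simp_all
  then show ?thesis by blast
qed

text \<open>Dually, the section \<open>i \<cdot> t\<close> survives, and the kernel is the sum of
  \<open>Dom C f\<close> and \<open>A'\<close>, the latter embedded as the graph of the negative of
  \<open>t \<cdot> g'\<close>.\<close>

lemma split_epi_pair:
  assumes bp: "biprod A A' S i j p q" and g: "split_short_exact C f g" "Dom C g = A"
    and g': "g' \<in> Homs C A' (Cod C g)"
  shows "\<exists>h. split_short_exact C h (g \<cdot> p \<oplus> g' \<cdot> q)"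
proof -
  obtain r t where "splitting f g r t"
    using g(1) unfolding split_short_exact_iff by blast
  note rt = splittingD[OF this]
  note D = biprodD[OF bp]
  note gt = g'[unfolded in_Homs]
  obtain T j1 j2 q1 q2 where T: "biprod (Dom C f) A' T j1 j2 q1 q2"
    by (rule biprod_exists[OF Dom_closed[OF rt(1)] D(14)])
  have fA: "Cod C f = A" using rt(5) g(2) by simp
  note [simp] = alg D(1-15) rt(1-9) gt fA biprodD(1-15)[OF T]
  note red = comp_reduce[OF rt(10)] comp_reduce[OF rt(11)] comp_reduce[OF rt(12)]
    comp_reduce[OF rt(14)] biprod_red[OF bp] biprod_red[OF T]
  have sum1: "f \<cdot> r \<oplus> t \<cdot> g = Ident C A" using rt(13) fA by simp
  have fr: "i \<cdot> f \<cdot> r \<cdot> p \<oplus> i \<cdot> t \<cdot> g \<cdot> p = i \<cdot> p"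
  proof -
    have "i \<cdot> f \<cdot> r \<cdot> p \<oplus> i \<cdot> t \<cdot> g \<cdot> p = i \<cdot> (f \<cdot> r \<oplus> t \<cdot> g) \<cdot> p" by simp
    then show ?thesis unfolding sum1 by simp
  qed
  have "split_short_exact C (i \<cdot> f \<cdot> q1 \<oplus> (j \<oplus> \<ominus> (i \<cdot> t \<cdot> g')) \<cdot> q2) (g \<cdot> p \<oplus> g' \<cdot> q)"
  proof (rule split_short_exactI[of _ _ "j1 \<cdot> r \<cdot> p \<oplus> j2 \<cdot> q" "i \<cdot> t"])
    show "(g \<cdot> p \<oplus> g' \<cdot> q) \<cdot> (i \<cdot> f \<cdot> q1 \<oplus> (j \<oplus> \<ominus> (i \<cdot> t \<cdot> g')) \<cdot> q2) =
        Zero C (Dom C (i \<cdot> f \<cdot> q1 \<oplus> (j \<oplus> \<ominus> (i \<cdot> t \<cdot> g')) \<cdot> q2)) (Cod C (g \<cdot> p \<oplus> g' \<cdot> q))"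
      by (simp add: red add_commute[of "\<ominus> (g' \<cdot> q2)"])
    show "(g \<cdot> p \<oplus> g' \<cdot> q) \<cdot> i \<cdot> t = Ident C (Cod C (g \<cdot> p \<oplus> g' \<cdot> q))"
      using rt(12) by (simp add: red)
    show "(j1 \<cdot> r \<cdot> p \<oplus> j2 \<cdot> q) \<cdot> (i \<cdot> f \<cdot> q1 \<oplus> (j \<oplus> \<ominus> (i \<cdot> t \<cdot> g')) \<cdot> q2)
        = Ident C (Dom C (i \<cdot> f \<cdot> q1 \<oplus> (j \<oplus> \<ominus> (i \<cdot> t \<cdot> g')) \<cdot> q2))"
      using biprodD(20)[OF T] by (simp add: red)
    have cod: "Cod C (i \<cdot> f \<cdot> q1 \<oplus> (j \<oplus> \<ominus> (i \<cdot> t \<cdot> g')) \<cdot> q2) = S" by simp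
    have "(i \<cdot> f \<cdot> q1 \<oplus> (j \<oplus> \<ominus> (i \<cdot> t \<cdot> g')) \<cdot> q2) \<cdot> (j1 \<cdot> r \<cdot> p \<oplus> j2 \<cdot> q) \<oplus> (i \<cdot> t) \<cdot> (g \<cdot> p \<oplus> g' \<cdot> q)
        = i \<cdot> f \<cdot> r \<cdot> p \<oplus> ((j \<cdot> q \<oplus> \<ominus> (i \<cdot> t \<cdot> g' \<cdot> q)) \<oplus> (i \<cdot> t \<cdot> g \<cdot> p \<oplus> i \<cdot> t \<cdot> g' \<cdot> q))"
      by (simp add: red)
    also have "(j \<cdot> q \<oplus> \<ominus> (i \<cdot> t \<cdot> g' \<cdot> q)) \<oplus> (i \<cdot> t \<cdot> g \<cdot> p \<oplus> i \<cdot> t \<cdot> g' \<cdot> q)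
        = (i \<cdot> t \<cdot> g \<cdot> p \<oplus> i \<cdot> t \<cdot> g' \<cdot> q) \<oplus> (j \<cdot> q \<oplus> \<ominus> (i \<cdot> t \<cdot> g' \<cdot> q))"
      by (rule add_commute) simp_all
    also have "i \<cdot> f \<cdot> r \<cdot> p \<oplus> \<dots> = (i \<cdot> f \<cdot> r \<cdot> p \<oplus> i \<cdot> t \<cdot> g \<cdot> p) \<oplus> j \<cdot> q"
      using add_left_commute[of "i \<cdot> t \<cdot> g' \<cdot> q" "j \<cdot> q" "\<ominus> (i \<cdot> t \<cdot> g' \<cdot> q)"] by simp
    also note fr
    also note D(20)
    finally show "(i \<cdot> f \<cdot> q1 \<oplus> (j \<oplus> \<ominus> (i \<cdot> t \<cdot> g')) \<cdot> q2) \<cdot> (j1 \<cdot> r \<cdot> p \<oplus> j2 \<cdot> q) \<oplus> (i \<cdot> t) \<cdot> (g \<cdot> p \<oplus> g' \<cdot> q)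
        = Ident C (Cod C (i \<cdot> f \<cdot> q1 \<oplus> (j \<oplus> \<ominus> (i \<cdot> t \<cdot> g')) \<cdot> q2))"
      unfolding cod .
  qed simp_all
  then show ?thesis by blast
qed

end

section \<open>The ideal of null-homotopic maps\<close>

context ncomplex_category
begin

abbreviation Null where "Null \<equiv> null_homotopic C N"

lemma null_homotopy_map:
  assumes "X \<in> ncomplexes C N" "Y \<in> ncomplexes C N" "homotopy_family X Y s"
  shows "Null (homotopy_map X Y s)"
  using null_homotopic_iff[OF homotopy_map_chain_map[OF assms]] assms(3)
  unfolding homotopy_map_simps(1,2) by blast

lemma null_homotopicE:
  assumes "Null f" "f \<in> chain_maps C N"
  obtains s where "homotopy_family (source f) (target f) s" "f = homotopy_map (source f) (target f) s"
  using assms null_homotopic_iff by blast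

lemma null_comp:
  assumes f: "f \<in> chain_maps C N" "Null f" and g: "g \<in> chain_maps C N" "source g = target f"
  shows "Null (g \<cdot>\<^bsub>CC\<^esub> f)"
proof -
  note Y = chain_mapD(1,2)[OF f(1)]
  obtain s where s: "homotopy_family (source f) (target f) s" "f = homotopy_map (source f) (target f) s"
    using null_homotopicE[OF f(2,1)] .
  note h = comp_homotopy_map[OF Y s(1) g]
  have "Null (g \<cdot>\<^bsub>CC\<^esub> homotopy_map (source f) (target f) s)"
    unfolding h(2) by (rule null_homotopy_map[OF Y(1) chain_mapD(2)[OF g(1)] h(1)])
  then show ?thesis using s(2) by simp
qed

lemma comp_null:
  assumes f: "f \<in> chain_maps C N" and g: "g \<in> chain_maps C N" "Null g" "source g = target f"
  shows "Null (g \<cdot>\<^bsub>CC\<^esub> f)"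
proof -
  note Y = chain_mapD(1,2)[OF g(1)]
  obtain s where s: "homotopy_family (source g) (target g) s" "g = homotopy_map (source g) (target g) s"
    using null_homotopicE[OF g(2,1)] .
  note h = homotopy_map_comp[OF Y s(1) f g(3)[symmetric]]
  have "Null (homotopy_map (source g) (target g) s \<cdot>\<^bsub>CC\<^esub> f)"
    unfolding h(2) by (rule null_homotopy_map[OF chain_mapD(1)[OF f] Y(2) h(1)])
  then show ?thesis using s(2) by simp
qed

lemma null_add:
  assumes f: "f \<in> chain_maps C N" "Null f" and g: "g \<in> chain_maps C N" "Null g"
    and eq: "source g = source f" "target g = target f"
  shows "Null (Add CC f g)"
proof -
  note Y = chain_mapD(1,2)[OF f(1)]
  obtain s where s: "homotopy_family (source f) (target f) s" "f = homotopy_map (source f) (target f) s"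
    using null_homotopicE[OF f(2,1)] .
  obtain s' where s': "homotopy_family (source f) (target f) s'" "g = homotopy_map (source f) (target f) s'"
    using null_homotopicE[OF g(2,1)] unfolding eq .
  note h = add_homotopy_map[OF Y s(1) s'(1)]
  have "Null (Add CC (homotopy_map (source f) (target f) s) (homotopy_map (source f) (target f) s'))"
    unfolding h(2) by (rule null_homotopy_map[OF Y h(1)])
  then show ?thesis using s(2) s'(2) by simp
qed

text \<open>Composing the homotopy map of some family with the zero endomorphism of \<open>Y\<close>
  yields the zero map by the ideal property, so no sum has to be evaluated. \<open>null_neg\<close>
  uses the negative of an identity in the same way.\<close>

lemma null_zero:
  assumes X: "X \<in> ncomplexes C N" and Y: "Y \<in> ncomplexes C N"
  shows "Null (Zero CC X Y)"
proof -
  let ?s = "\<lambda>t. Zero C (deg X t) (deg Y (t - int N + 1))"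
  have s: "homotopy_family X Y ?s"
    by (simp add: homotopy_family_def in_Homs zero_arr ncomplexD[OF X] ncomplexD[OF Y])
  have "Null (Zero CC Y Y \<cdot>\<^bsub>CC\<^esub> homotopy_map X Y ?s)"
    using null_comp[OF homotopy_map_chain_map[OF X Y s] null_homotopy_map[OF X Y s]]
    by (simp add: zero_chain_map Y)
  then show ?thesis
    using homotopy_map_chain_map[OF X Y s] by (simp add: CC.zero_comp Y)
qed

lemma null_neg:
  assumes f: "f \<in> chain_maps C N" "Null f"
  shows "Null (CC.neg f)"
proof -
  note Y = chain_mapD(2)[OF f(1)]
  have "CC.neg (Ident CC (target f)) \<cdot>\<^bsub>CC\<^esub> f = CC.neg f"
    using f Y by (simp add: CC.neg_comp CC.ident_comp ident_chain_map)
  moreover have "CC.neg (Ident CC (target f)) \<in> chain_maps C N"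
    using CC.neg_arr(1)[of "Ident CC (target f)"] Y by (simp add: ident_chain_map)
  ultimately show ?thesis
    using null_comp[OF f, of "CC.neg (Ident CC (target f))"] ident_chain_map[OF Y]
    by (simp add: neg_CC)
qed

subsection \<open>Degreewise split sequences\<close>

lemma conflationD:
  assumes "(f, g) \<in> conflations C N"
  shows "f \<in> chain_maps C N" "g \<in> chain_maps C N" "source g = target f"
    "split_short_exact C (component f k) (component g k)"
  using assms by (auto simp: conflations_def)

lemma conflation_splitting:
  assumes "(f, g) \<in> conflations C N"
  obtains r t where "\<And>k. splitting (component f k) (component g k) (r k) (t k)"
  using conflationD(4)[OF assms] unfolding split_short_exact_iff by metis

lemma split_mono_cancel:
  assumes "i \<cdot> a = i \<cdot> b" "r \<cdot> i = Ident C X" "r \<in> Arr C" "i \<in> Arr C" "Dom C i = X" "Dom C r = Cod C i"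
    "a \<in> Arr C" "b \<in> Arr C" "Cod C a = X" "Cod C b = X"
  shows "a = b"
proof -
  have "(r \<cdot> i) \<cdot> a = (r \<cdot> i) \<cdot> b" using assms(1,3-10) by (simp add: comp_assoc)
  then show ?thesis unfolding assms(2) using assms by (simp add: ident_comp)
qed

lemma split_epi_cancel:
  assumes "a \<cdot> p = b \<cdot> p" "p \<cdot> t = Ident C X" "t \<in> Arr C" "p \<in> Arr C" "Cod C p = X" "Dom C p = Cod C t"
    "a \<in> Arr C" "b \<in> Arr C" "Dom C a = X" "Dom C b = X"
  shows "a = b"
proof -
  have "a \<cdot> (p \<cdot> t) = b \<cdot> (p \<cdot> t)" using assms(1,3-10) by (simp add: comp_assoc[symmetric])
  then show ?thesis unfolding assms(2) using assms by (simp add: comp_ident)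
qed

text \<open>Compatibility with the differentials may be tested after composing with the degreewise
  split \<open>f\<close>, where it is that of \<open>b\<close>; the retractions \<open>r\<close> are
  not assumed to commute with the differentials.\<close>

lemma mono_factor_chain_map:
  assumes f: "f \<in> chain_maps C N" and b: "b \<in> chain_maps C N" "target b = target f"
    and a: "\<And>k. a k \<in> Homs C (deg (source b) k) (deg (source f) k)"
      "\<And>k. component f k \<cdot> a k = component b k"
    and r: "\<And>k. r k \<in> Homs C (deg (target f) k) (deg (source f) k)"
      "\<And>k. r k \<cdot> component f k = Ident C (deg (source f) k)"
  shows "\<lparr>source = source b, target = source f, component = a\<rparr> \<in> chain_maps C N"
proof (rule chain_mapI)
  fix k
  note [simp] = chain_mapD(1-5)[OF f] chain_mapD(1-5)[OF b(1)] b(2) a(1)[unfolded in_Homs]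
    r(1)[unfolded in_Homs] ncomplexD(1-4)[OF chain_mapD(1)[OF f]]
    ncomplexD(1-4)[OF chain_mapD(2)[OF f]] ncomplexD(1-4)[OF chain_mapD(1)[OF b(1)]]
  have "component f (k + 1) \<cdot> (a (k + 1) \<cdot> diff (source b) k)
      = (component f (k + 1) \<cdot> a (k + 1)) \<cdot> diff (source b) k" by (simp add: cat)
  also have "\<dots> = diff (target f) k \<cdot> (component f k \<cdot> a k)"
    unfolding a(2) using chain_mapD(6)[OF b(1)] by simp
  also have "\<dots> = (component f (k + 1) \<cdot> diff (source f) k) \<cdot> a k"
    unfolding chain_mapD(6)[OF f] by (simp add: cat)
  also have "\<dots> = component f (k + 1) \<cdot> (diff (source f) k \<cdot> a k)" by (simp add: cat)
  finally have "a (k + 1) \<cdot> diff (source b) k = diff (source f) k \<cdot> a k"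
    by (rule split_mono_cancel[OF _ r(2)]) (simp_all add: cat)
  then show "component \<lparr>source = source b, target = source f, component = a\<rparr> (k + 1) \<cdot>
      diff (source \<lparr>source = source b, target = source f, component = a\<rparr>) k
    = diff (target \<lparr>source = source b, target = source f, component = a\<rparr>) k \<cdot>
      component \<lparr>source = source b, target = source f, component = a\<rparr> k" by simp
qed (use a(1) chain_mapD[OF f] chain_mapD[OF b(1)] in simp_all)

lemma epi_factor_chain_map:
  assumes g: "g \<in> chain_maps C N" and b: "b \<in> chain_maps C N" "source b = source g"
    and a: "\<And>k. a k \<in> Homs C (deg (target g) k) (deg (target b) k)"
      "\<And>k. a k \<cdot> component g k = component b k"
    and t: "\<And>k. t k \<in> Homs C (deg (target g) k) (deg (source g) k)"
      "\<And>k. component g k \<cdot> t k = Ident C (deg (target g) k)"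
  shows "\<lparr>source = target g, target = target b, component = a\<rparr> \<in> chain_maps C N"
proof (rule chain_mapI)
  fix k
  note [simp] = chain_mapD(1-5)[OF g] chain_mapD(1-5)[OF b(1)] b(2) a(1)[unfolded in_Homs]
    t(1)[unfolded in_Homs] ncomplexD(1-4)[OF chain_mapD(1)[OF g]]
    ncomplexD(1-4)[OF chain_mapD(2)[OF g]] ncomplexD(1-4)[OF chain_mapD(2)[OF b(1)]]
  have "(a (k + 1) \<cdot> diff (target g) k) \<cdot> component g k
      = a (k + 1) \<cdot> (component g (k + 1) \<cdot> diff (source g) k)"
    unfolding chain_mapD(6)[OF g] by (simp add: cat)
  also have "\<dots> = (a (k + 1) \<cdot> component g (k + 1)) \<cdot> diff (source b) k" by (simp add: cat)
  also have "\<dots> = diff (target b) k \<cdot> (a k \<cdot> component g k)"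
    unfolding a(2) using chain_mapD(6)[OF b(1)] by simp
  also have "\<dots> = (diff (target b) k \<cdot> a k) \<cdot> component g k" by (simp add: cat)
  finally have "a (k + 1) \<cdot> diff (target g) k = diff (target b) k \<cdot> a k"
    by (rule split_epi_cancel[OF _ t(2)]) (simp_all add: cat)
  then show "component \<lparr>source = target g, target = target b, component = a\<rparr> (k + 1) \<cdot>
      diff (source \<lparr>source = target g, target = target b, component = a\<rparr>) k
    = diff (target \<lparr>source = target g, target = target b, component = a\<rparr>) k \<cdot>
      component \<lparr>source = target g, target = target b, component = a\<rparr> k" by simp
qed (use a(1) chain_mapD[OF g] chain_mapD[OF b(1)] in simp_all)

lemma conflation_zero:
  assumes fg: "(f, g) \<in> conflations C N"
  shows "g \<cdot>\<^bsub>CC\<^esub> f = Zero CC (source f) (target g)"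
proof -
  note D = conflationD[OF fg]
  have "component g k \<cdot> component f k = Zero C (deg (source f) k) (deg (target g) k)" for k
    using D(4)[of k] chain_mapD(4)[OF D(1)] chain_mapD(5)[OF D(2)] by (simp add: split_short_exact_def)
  then show ?thesis using D(3) by (intro chain_map_eqI) simp_all
qed

lemma conflation_ker:
  assumes fg: "(f, g) \<in> conflations C N" and b: "b \<in> chain_maps C N" "target b = target f"
    and gb: "g \<cdot>\<^bsub>CC\<^esub> b = Zero CC (source b) (target g)"
  shows "\<exists>a\<in>Homs CC (source b) (source f). f \<cdot>\<^bsub>CC\<^esub> a = b"
proof -
  note D = conflationD[OF fg]
  obtain r t where "\<And>k. splitting (component f k) (component g k) (r k) (t k)"
    using conflation_splitting[OF fg] by blast
  note rt = splittingD[OF this]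
  note [simp] = chain_mapD(3-5)[OF D(1)] chain_mapD(3-5)[OF D(2), unfolded D(3)]
    chain_mapD(3-5)[OF b(1), unfolded b(2)] rt(3,4,6-9) ncomplexD(1)[OF chain_mapD(1)[OF b(1)]]
    ncomplexD(1)[OF chain_mapD(2)[OF D(2)]]
  let ?a = "\<lparr>source = source b, target = source f, component = \<lambda>k. r k \<cdot> component b k\<rparr>"
  have fa: "component f k \<cdot> r k \<cdot> component b k = component b k" for k
  proof -
    have 0: "component g k \<cdot> component b k = Zero C (deg (source b) k) (deg (target g) k)"
      using fun_cong[OF arg_cong[where f = component, OF gb], of k] by simp
    have "component b k = (component f k \<cdot> r k \<oplus> t k \<cdot> component g k) \<cdot> component b k"
      unfolding rt(13) by (simp add: ident_comp)
    also have "\<dots> = component f k \<cdot> r k \<cdot> component b k \<oplus> t k \<cdot> (component g k \<cdot> component b k)"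
      by (simp add: alg)
    also have "\<dots> = component f k \<cdot> r k \<cdot> component b k"
      unfolding 0 by (simp add: alg)
    finally show ?thesis ..
  qed
  have "?a \<in> chain_maps C N"
    by (rule mono_factor_chain_map[OF D(1) b, of _ r]) (simp_all add: in_Homs cat fa rt(11))
  moreover have "f \<cdot>\<^bsub>CC\<^esub> ?a = b"
    using b(2) fa by (intro chain_map_eqI) auto
  ultimately show ?thesis by (intro bexI[of _ ?a]) (auto simp: Homs_CC)
qed

lemma conflation_coker:
  assumes fg: "(f, g) \<in> conflations C N" and b: "b \<in> chain_maps C N" "source b = target f"
    and bf: "b \<cdot>\<^bsub>CC\<^esub> f = Zero CC (source f) (target b)"
  shows "\<exists>a\<in>Homs CC (target g) (target b). a \<cdot>\<^bsub>CC\<^esub> g = b"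
proof -
  note D = conflationD[OF fg]
  obtain r t where "\<And>k. splitting (component f k) (component g k) (r k) (t k)"
    using conflation_splitting[OF fg] by blast
  note rt = splittingD[OF this]
  note [simp] = chain_mapD(3-5)[OF D(1)] chain_mapD(3-5)[OF D(2), unfolded D(3)]
    chain_mapD(3-5)[OF b(1), unfolded b(2)] rt(3,4,6-9) ncomplexD(1)[OF chain_mapD(2)[OF b(1)]]
    ncomplexD(1)[OF chain_mapD(1)[OF D(1)]]
  let ?a = "\<lparr>source = target g, target = target b, component = \<lambda>k. component b k \<cdot> t k\<rparr>"
  have ag: "(component b k \<cdot> t k) \<cdot> component g k = component b k" for k
  proof -
    have 0: "component b k \<cdot> component f k = Zero C (deg (source f) k) (deg (target b) k)"
      using fun_cong[OF arg_cong[where f = component, OF bf], of k] by simp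
    have "component b k = component b k \<cdot> (component f k \<cdot> r k \<oplus> t k \<cdot> component g k)"
      unfolding rt(13) by (simp add: comp_ident)
    also have "\<dots> = (component b k \<cdot> component f k) \<cdot> r k \<oplus> (component b k \<cdot> t k) \<cdot> component g k"
      by (simp add: alg)
    also have "\<dots> = (component b k \<cdot> t k) \<cdot> component g k"
      unfolding 0 by (simp add: alg)
    finally show ?thesis ..
  qed
  have "?a \<in> chain_maps C N"
    by (rule epi_factor_chain_map[OF D(2) b(1), of _ t])
      (simp_all add: in_Homs comp_arr ag rt(12) b(2) D(3))
  moreover have "?a \<cdot>\<^bsub>CC\<^esub> g = b"
    using b(2) ag D(3) by (intro chain_map_eqI) auto
  ultimately show ?thesis by (intro bexI[of _ ?a]) (auto simp: Homs_CC)
qed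

lemma conflation_mono:
  assumes fg: "(f, g) \<in> conflations C N" and a: "a \<in> Homs CC W (source f)" "b \<in> Homs CC W (source f)"
    and eq: "f \<cdot>\<^bsub>CC\<^esub> a = f \<cdot>\<^bsub>CC\<^esub> b"
  shows "a = b"
proof (rule chain_map_eqI)
  fix k
  note D = conflationD[OF fg]
  obtain r t where "splitting (component f k) (component g k) r t"
    using D(4)[of k] unfolding split_short_exact_iff by blast
  note rt = splittingD[OF this]
  have "component f k \<cdot> component a k = component f k \<cdot> component b k"
    using fun_cong[OF arg_cong[where f = component, OF eq], of k] by simp
  then show "component a k = component b k"
    by (rule split_mono_cancel[OF _ rt(11)])
      (use a rt(1-9) chain_mapD[OF D(1)] in \<open>auto simp: Homs_CC chain_mapD\<close>)
qed (use a in \<open>simp_all add: Homs_CC\<close>)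

lemma conflation_epi:
  assumes fg: "(f, g) \<in> conflations C N" and a: "a \<in> Homs CC (target g) W" "b \<in> Homs CC (target g) W"
    and eq: "a \<cdot>\<^bsub>CC\<^esub> g = b \<cdot>\<^bsub>CC\<^esub> g"
  shows "a = b"
proof (rule chain_map_eqI)
  fix k
  note D = conflationD[OF fg]
  obtain r t where "splitting (component f k) (component g k) r t"
    using D(4)[of k] unfolding split_short_exact_iff by blast
  note rt = splittingD[OF this]
  have "component a k \<cdot> component g k = component b k \<cdot> component g k"
    using fun_cong[OF arg_cong[where f = component, OF eq], of k] by simp
  then show "component a k = component b k"
    by (rule split_epi_cancel[OF _ rt(12)])
      (use a rt(1-9) chain_mapD[OF D(2)] in \<open>auto simp: Homs_CC chain_mapD\<close>)
qed (use a in \<open>simp_all add: Homs_CC\<close>)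

lemma conflation_null_extend:
  assumes fg: "(i, p) \<in> conflations C N" and f: "f \<in> chain_maps C N" "source f = source i" "Null f"
  shows "\<exists>h\<in>Homs CC (target i) (target f). Null h \<and> h \<cdot>\<^bsub>CC\<^esub> i = f"
proof -
  note D = conflationD[OF fg]
  note X = chain_mapD(1)[OF D(1)] and Y = chain_mapD(2)[OF f(1)] and Z = chain_mapD(2)[OF D(1)]
  obtain r t where "\<And>k. splitting (component i k) (component p k) (r k) (t k)"
    using conflation_splitting[OF fg] by blast
  note rt = splittingD[OF this]
  obtain s where s: "homotopy_family (source i) (target f) s" "f = homotopy_map (source i) (target f) s"
    using null_homotopicE[OF f(3,1)] unfolding f(2) .
  note sD = homotopy_familyD[OF s(1)]
  have fam: "homotopy_family (target i) (target f) (\<lambda>t. s t \<cdot> r t)"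
    by (simp add: homotopy_family_def in_Homs comp_arr rt(3,6,7) sD chain_mapD(3-5)[OF D(1)])
  let ?h = "homotopy_map (target i) (target f) (\<lambda>t. s t \<cdot> r t)"
  have "(s t \<cdot> r t) \<cdot> component i t = s t" for t
    using rt(3,6,7,11) sD chain_mapD(3-5)[OF D(1)] by (simp add: cat)
  then have "?h \<cdot>\<^bsub>CC\<^esub> i = f"
    using homotopy_map_comp(2)[OF Z Y fam D(1)] s(2) by simp
  moreover have "?h \<in> Homs CC (target i) (target f)"
    using homotopy_map_chain_map[OF Z Y fam] by (simp add: Homs_CC)
  ultimately show ?thesis using null_homotopy_map[OF Z Y fam] by blast
qed

text \<open>The dual construction with degreewise sections \<open>\<sigma>\<close>, taken in degree
  \<open>t - N + 1\<close> because that is where \<open>s t\<close> ends.\<close>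

lemma conflation_null_lift:
  assumes fg: "(i, p) \<in> conflations C N" and f: "f \<in> chain_maps C N" "target f = target p" "Null f"
  shows "\<exists>h\<in>Homs CC (source f) (target i). Null h \<and> p \<cdot>\<^bsub>CC\<^esub> h = f"
proof -
  note D = conflationD[OF fg]
  note X = chain_mapD(1)[OF f(1)] and Y = chain_mapD(2)[OF D(2)] and Z = chain_mapD(2)[OF D(1)]
  obtain r \<sigma> where "\<And>k. splitting (component i k) (component p k) (r k) (\<sigma> k)"
    using conflation_splitting[OF fg] by blast
  note rt = splittingD[OF this]
  obtain s where s: "homotopy_family (source f) (target p) s" "f = homotopy_map (source f) (target p) s"
    using null_homotopicE[OF f(3,1)] unfolding f(2) .
  note sD = homotopy_familyD[OF s(1)]
  have fam: "homotopy_family (source f) (target i) (\<lambda>t. \<sigma> (t - int N + 1) \<cdot> s t)"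
    by (simp add: homotopy_family_def in_Homs comp_arr rt(4,8,9) sD chain_mapD(3-5)[OF D(1)] chain_mapD(3-5)[OF D(2)])
  let ?h = "homotopy_map (source f) (target i) (\<lambda>t. \<sigma> (t - int N + 1) \<cdot> s t)"
  have "component p (t - int N + 1) \<cdot> \<sigma> (t - int N + 1) \<cdot> s t = s t" for t
    using rt(4,8,9) sD chain_mapD(3-5)[OF D(1)] chain_mapD(3-5)[OF D(2)] D(3)
      comp_reduce[OF rt(12)[of "t - int N + 1"], of "s t"] by (simp add: ident_comp)
  then have "p \<cdot>\<^bsub>CC\<^esub> ?h = f"
    using comp_homotopy_map(2)[OF X Z fam D(2,3)] s(2) by simp
  moreover have "?h \<in> Homs CC (source f) (target i)"
    using homotopy_map_chain_map[OF X Z fam] by (simp add: Homs_CC)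
  ultimately show ?thesis using null_homotopy_map[OF X Z fam] by blast
qed

text \<open>The differential on the cokernels is transported along the sections \<open>t\<close>. It
  commutes with \<open>g\<close> because the part of the middle term coming from \<open>f\<close> is
  carried into the image of \<open>f\<close>, which \<open>g\<close> kills; and as \<open>g\<close>
  is split epi, vanishing of composites of \<open>N\<close> differentials descends.\<close>

lemma cokernel_complex:
  assumes f: "f \<in> chain_maps C N" and split: "\<And>k. \<exists>g. split_short_exact C (component f k) g"
  shows "\<exists>g. (f, g) \<in> conflations C N"
proof -
  obtain g r t where "\<And>k. splitting (component f k) (g k) (r k) (t k)"
    using split unfolding split_short_exact_iff by metis
  note rt = splittingD[OF this]
  note X = chain_mapD(1)[OF f] and J = chain_mapD(2)[OF f]
  note [simp] = chain_mapD(3-5)[OF f] rt(2-9) ncomplexD(1-4)[OF X] ncomplexD(1-4)[OF J]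
    Cod_closed comp_arr
  let ?d = "diff (target f)"
  define T where "T = \<lparr>deg = \<lambda>k. Cod C (g k), diff = \<lambda>k. g (k + 1) \<cdot> ?d k \<cdot> t k\<rparr>"
  have T: "deg T k = Cod C (g k)" "diff T k = g (k + 1) \<cdot> ?d k \<cdot> t k" for k by (simp_all add: T_def)
  have dT: "diff T k \<cdot> g k = g (k + 1) \<cdot> ?d k" for k
  proof -
    have "g (k + 1) \<cdot> ?d k = g (k + 1) \<cdot> ?d k \<cdot> (component f k \<cdot> r k \<oplus> t k \<cdot> g k)"
      unfolding rt(13) by (simp add: comp_ident)
    also have "\<dots> = g (k + 1) \<cdot> (?d k \<cdot> component f k) \<cdot> r k \<oplus> g (k + 1) \<cdot> ?d k \<cdot> t k \<cdot> g k"
      by (simp add: comp_add comp_assoc)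
    also have "?d k \<cdot> component f k = component f (k + 1) \<cdot> diff (source f) k"
      by (rule chain_mapD(6)[OF f, symmetric])
    also have "g (k + 1) \<cdot> (component f (k + 1) \<cdot> diff (source f) k) \<cdot> r k
        = (g (k + 1) \<cdot> component f (k + 1)) \<cdot> diff (source f) k \<cdot> r k" by (simp add: comp_assoc)
    also have "\<dots> = Zero C (deg (target f) k) (Cod C (g (k + 1)))"
      unfolding rt(10) by (simp add: zero_comp)
    finally show ?thesis by (simp add: T comp_assoc zero_add)
  qed
  have TH: "deg T k \<in> Obj C" "diff T k \<in> Homs C (deg T k) (deg T (k + 1))" for k
    by (simp_all add: T in_Homs)
  have iter: "diff_iter C T k n \<cdot> g k = g (k + int n) \<cdot> diff_iter C (target f) k n" for k n
  proof (induction n)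
    case 0
    show ?case by (simp add: T comp_ident ident_comp)
  next
    case (Suc n)
    have A: "diff_iter C T k n \<in> Homs C (Cod C (g k)) (Cod C (g (k + int n)))"
      using diff_iter_arr[OF TH, of k n] by (simp add: T)
    have B: "diff T (k + int n) \<in> Homs C (Cod C (g (k + int n))) (Cod C (g (k + int n + 1)))"
      using TH(2)[of "k + int n"] by (simp add: T)
    have "diff_iter C T k (Suc n) \<cdot> g k = diff T (k + int n) \<cdot> (diff_iter C T k n \<cdot> g k)"
      using A B by (simp add: in_Homs comp_assoc)
    also have "\<dots> = (diff T (k + int n) \<cdot> g (k + int n)) \<cdot> diff_iter C (target f) k n"
      unfolding Suc using B diff_iter_arr'[OF J] by (simp add: in_Homs comp_assoc)
    also have "\<dots> = g (k + int (Suc n)) \<cdot> diff_iter C (target f) k (Suc n)"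
      unfolding dT using diff_iter_arr'[OF J] by (simp add: comp_assoc add.assoc add.commute[of 1])
    finally show ?case .
  qed
  have "diff_iter C T k N = Zero C (deg T k) (deg T (k + int N))" for k
  proof -
    have A: "diff_iter C T k N \<in> Homs C (Cod C (g k)) (Cod C (g (k + int N)))"
      using diff_iter_arr[OF TH, of k N] by (simp add: T)
    have "diff_iter C T k N = diff_iter C T k N \<cdot> (g k \<cdot> t k)"
      unfolding rt(12) using A by (simp add: in_Homs comp_ident)
    also have "\<dots> = (g (k + int N) \<cdot> diff_iter C (target f) k N) \<cdot> t k"
      unfolding iter[symmetric] using A by (simp add: in_Homs comp_assoc)
    also have "\<dots> = Zero C (deg T k) (deg T (k + int N))"
      unfolding ncomplexD(5)[OF J] by (simp add: comp_zero zero_comp T)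
    finally show ?thesis .
  qed
  then have TN: "T \<in> ncomplexes C N" using TH by (intro ncomplexI)
  let ?g = "\<lparr>source = target f, target = T, component = g\<rparr>"
  have "?g \<in> chain_maps C N"
    by (rule chain_mapI) (use TN J dT in \<open>simp_all add: in_Homs T\<close>)
  then have "(f, ?g) \<in> conflations C N" using f \<open>\<And>k. splitting (component f k) (g k) (r k) (t k)\<close>
    by (auto simp: conflations_def split_short_exact_iff)
  then show ?thesis by blast
qed

text \<open>The dual of \<open>cokernel_complex\<close>: the retractions \<open>r\<close> transport
  the differential to the kernels.\<close>

lemma kernel_complex:
  assumes g: "g \<in> chain_maps C N" and split: "\<And>k. \<exists>f. split_short_exact C f (component g k)"
  shows "\<exists>f. (f, g) \<in> conflations C N"
proof -
  obtain f r t where "\<And>k. splitting (f k) (component g k) (r k) (t k)"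
    using split unfolding split_short_exact_iff by metis
  note rt = splittingD[OF this]
  note J = chain_mapD(1)[OF g] and Y = chain_mapD(2)[OF g]
  note [simp] = chain_mapD(3-5)[OF g] rt(1,3,4) rt(5)[symmetric] rt(6-9) ncomplexD(1-4)[OF J] ncomplexD(1-4)[OF Y]
    Dom_closed comp_arr
  let ?d = "diff (source g)"
  define T where "T = \<lparr>deg = \<lambda>k. Dom C (f k), diff = \<lambda>k. r (k + 1) \<cdot> ?d k \<cdot> f k\<rparr>"
  have T: "deg T k = Dom C (f k)" "diff T k = r (k + 1) \<cdot> ?d k \<cdot> f k" for k by (simp_all add: T_def)
  have dT: "f (k + 1) \<cdot> diff T k = ?d k \<cdot> f k" for k
  proof -
    have "?d k \<cdot> f k = (f (k + 1) \<cdot> r (k + 1) \<oplus> t (k + 1) \<cdot> component g (k + 1)) \<cdot> ?d k \<cdot> f k"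
      unfolding rt(13) by (simp add: ident_comp)
    also have "\<dots> = f (k + 1) \<cdot> r (k + 1) \<cdot> ?d k \<cdot> f k \<oplus> t (k + 1) \<cdot> (component g (k + 1) \<cdot> ?d k) \<cdot> f k"
      by (simp add: add_comp comp_assoc)
    also have "component g (k + 1) \<cdot> ?d k = diff (target g) k \<cdot> component g k"
      by (rule chain_mapD(6)[OF g])
    also have "t (k + 1) \<cdot> (diff (target g) k \<cdot> component g k) \<cdot> f k
        = t (k + 1) \<cdot> diff (target g) k \<cdot> (component g k \<cdot> f k)" by (simp add: comp_assoc)
    also have "\<dots> = Zero C (Dom C (f k)) (deg (source g) (k + 1))"
      unfolding rt(10) by (simp add: comp_zero)
    finally show ?thesis by (simp add: T comp_assoc zero_add)
  qed
  have TH: "deg T k \<in> Obj C" "diff T k \<in> Homs C (deg T k) (deg T (k + 1))" for k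
    by (simp_all add: T in_Homs)
  have iter: "f (k + int n) \<cdot> diff_iter C T k n = diff_iter C (source g) k n \<cdot> f k" for k n
  proof (induction n)
    case 0
    show ?case by (simp add: T comp_ident ident_comp)
  next
    case (Suc n)
    have A: "diff_iter C T k n \<in> Homs C (Dom C (f k)) (Dom C (f (k + int n)))"
      using diff_iter_arr[OF TH, of k n] by (simp add: T)
    have B: "diff T (k + int n) \<in> Homs C (Dom C (f (k + int n))) (Dom C (f (k + int n + 1)))"
      using TH(2)[of "k + int n"] by (simp add: T)
    have "f (k + int (Suc n)) \<cdot> diff_iter C T k (Suc n)
        = (f (k + int n + 1) \<cdot> diff T (k + int n)) \<cdot> diff_iter C T k n"
      using A B by (simp add: in_Homs comp_assoc add.assoc add.commute[of 1])
    also have "\<dots> = ?d (k + int n) \<cdot> (f (k + int n) \<cdot> diff_iter C T k n)"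
      unfolding dT using A by (simp add: in_Homs comp_assoc)
    also have "\<dots> = diff_iter C (source g) k (Suc n) \<cdot> f k"
      unfolding Suc using diff_iter_arr'[OF J] by (simp add: comp_assoc)
    finally show ?case .
  qed
  have "diff_iter C T k N = Zero C (deg T k) (deg T (k + int N))" for k
  proof -
    have A: "diff_iter C T k N \<in> Homs C (Dom C (f k)) (Dom C (f (k + int N)))"
      using diff_iter_arr[OF TH, of k N] by (simp add: T)
    have "diff_iter C T k N = (r (k + int N) \<cdot> f (k + int N)) \<cdot> diff_iter C T k N"
      unfolding rt(11) using A by (simp add: in_Homs ident_comp)
    also have "\<dots> = r (k + int N) \<cdot> (diff_iter C (source g) k N \<cdot> f k)"
      unfolding iter[symmetric] using A by (simp add: in_Homs comp_assoc)
    also have "\<dots> = Zero C (deg T k) (deg T (k + int N))"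
      unfolding ncomplexD(5)[OF J] by (simp add: comp_zero zero_comp T)
    finally show ?thesis .
  qed
  then have TN: "T \<in> ncomplexes C N" using TH by (intro ncomplexI)
  let ?f = "\<lparr>source = T, target = source g, component = f\<rparr>"
  have "?f \<in> chain_maps C N"
    by (rule chain_mapI) (use TN J dT in \<open>simp_all add: in_Homs T\<close>)
  then have "(?f, g) \<in> conflations C N" using g \<open>\<And>k. splitting (f k) (component g k) (r k) (t k)\<close>
    by (auto simp: conflations_def split_short_exact_iff)
  then show ?thesis by blast
qed

end

subsection \<open>Reindexing\<close>

context preadditive_category
begin

lemma hsum_single:
  assumes "X \<in> Obj C" "Y \<in> Obj C" "finite A" "e \<in> A" "f e \<in> Homs C X Y"
    and zero: "\<And>a. a \<in> A \<Longrightarrow> a \<noteq> e \<Longrightarrow> f a = Zero C X Y"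
  shows "hsum X Y f A = f e"
proof -
  interpret G: comm_group "Hom_group C X Y" using assms by (intro Hom_comm_group)
  have Z: "Zero C X Y \<in> Homs C X Y" using assms by (simp add: in_Homs zero_arr)
  have "hsum X Y f (A - {e}) = hsum X Y (\<lambda>a. Zero C X Y) (A - {e})"
    by (rule hsum_cong) (use assms(1,2) zero Z in auto)
  also have "\<dots> = Zero C X Y"
    using G.finprod_one_eqI[of "A - {e}" "\<lambda>a. Zero C X Y"] by (simp add: Hom_group_simps)
  finally have 0: "hsum X Y f (A - {e}) = Zero C X Y" .
  have "hsum X Y f (Set.insert e (A - {e})) = f e \<oplus> hsum X Y f (A - {e})"
  proof (rule hsum_insert)
    show "f a \<in> Homs C X Y" if "a \<in> Set.insert e (A - {e})" for a
      using that assms(5) zero[of a] Z by (cases "a = e") auto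
  qed (use assms in auto)
  then show ?thesis unfolding 0 using assms by (simp add: insert_absorb in_Homs zero_add)
qed

text \<open>By monotonicity the blocks tile the large interval; a block on which
  \<open>\<phi>\<close> is constant is empty and contributes zero.\<close>

lemma hsum_blocks:
  assumes X: "X \<in> Obj C" and Y: "Y \<in> Obj C" and \<phi>: "mono (\<phi> :: int \<Rightarrow> int)" and "a \<le> b"
    and F: "\<And>t. t \<in> {\<phi> a..<\<phi> b} \<Longrightarrow> F t \<in> Homs C X Y"
  shows "hsum X Y (\<lambda>u. hsum X Y F {\<phi> u..<\<phi> (u + 1)}) {a..<b} = hsum X Y F {\<phi> a..<\<phi> b}"
  using \<open>a \<le> b\<close> F
proof (induction b rule: int_ge_induct)
  case base
  show ?case using X Y by (simp add: hsum_empty)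
next
  case (step b)
  have le: "\<phi> a \<le> \<phi> u" "\<phi> u \<le> \<phi> b" "\<phi> b \<le> \<phi> (b + 1)" if "a \<le> u" "u \<le> b" for u
    using that \<phi> by (simp_all add: monoD)
  have in_F: "F t \<in> Homs C X Y" if "a \<le> u" "u \<le> b" "t \<in> {\<phi> u..<\<phi> (u + 1)}" for u t
  proof (rule step(3))
    have "\<phi> (u + 1) \<le> \<phi> (b + 1)" using that \<phi> by (simp add: monoD)
    then show "t \<in> {\<phi> a..<\<phi> (b + 1)}" using that le[of u] by auto
  qed
  have block: "hsum X Y F {\<phi> u..<\<phi> (u + 1)} \<in> Homs C X Y" if "a \<le> u" "u \<le> b" for u
    by (rule hsum_closed[OF X Y in_F[OF that]])
  have ins: "{a..<b + 1} = Set.insert b {a..<b}" using step(1) by auto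
  have "hsum X Y (\<lambda>u. hsum X Y F {\<phi> u..<\<phi> (u + 1)}) {a..<b + 1}
      = hsum X Y F {\<phi> b..<\<phi> (b + 1)} \<oplus> hsum X Y (\<lambda>u. hsum X Y F {\<phi> u..<\<phi> (u + 1)}) {a..<b}"
    unfolding ins by (rule hsum_insert[OF X Y]) (use block step(1) in auto)
  also have "hsum X Y (\<lambda>u. hsum X Y F {\<phi> u..<\<phi> (u + 1)}) {a..<b} = hsum X Y F {\<phi> a..<\<phi> b}"
  proof (rule step(2))
    fix t assume "t \<in> {\<phi> a..<\<phi> b}"
    then show "F t \<in> Homs C X Y" using le[of b] step(1) by (intro step(3)) auto
  qed
  also have "hsum X Y F {\<phi> b..<\<phi> (b + 1)} \<oplus> hsum X Y F {\<phi> a..<\<phi> b}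
      = hsum X Y F ({\<phi> b..<\<phi> (b + 1)} \<union> {\<phi> a..<\<phi> b})"
  proof (rule hsum_union[OF X Y, symmetric])
    fix t assume "t \<in> {\<phi> b..<\<phi> (b + 1)} \<union> {\<phi> a..<\<phi> b}"
    then show "F t \<in> Homs C X Y" using le[of b] step(1) by (intro step(3)) auto
  qed auto
  also have "{\<phi> b..<\<phi> (b + 1)} \<union> {\<phi> a..<\<phi> b} = {\<phi> a..<\<phi> (b + 1)}"
    using le[of b] step(1) by auto
  finally show ?case .
qed

end

context ncomplex_category
begin

text \<open>By equivariance, \<open>N\<close> steps of a reindexed complex cover exactly
  \<open>N\<close> steps of the original one: composites of \<open>N\<close> differentials remain
  zero, and the windows of homotopies match.\<close>

definition shift_map :: "(int \<Rightarrow> int) \<Rightarrow> bool" where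
  "shift_map \<phi> \<longleftrightarrow> mono \<phi> \<and> (\<forall>i. \<phi> (i + int N) = \<phi> i + int N)"

definition reindex :: "(int \<Rightarrow> int) \<Rightarrow> ('o, 'm) ncomplex \<Rightarrow> ('o, 'm) ncomplex" where
  "reindex \<phi> X = \<lparr>deg = \<lambda>i. deg X (\<phi> i), diff = \<lambda>i. dd X (\<phi> i) (\<phi> (i + 1))\<rparr>"

definition reindex_map :: "(int \<Rightarrow> int) \<Rightarrow> ('o, 'm) chain_map \<Rightarrow> ('o, 'm) chain_map" where
  "reindex_map \<phi> f = \<lparr>source = reindex \<phi> (source f), target = reindex \<phi> (target f),
    component = \<lambda>i. component f (\<phi> i)\<rparr>"

definition transition :: "('o, 'm) ncomplex \<Rightarrow> (int \<Rightarrow> int) \<Rightarrow> (int \<Rightarrow> int) \<Rightarrow> ('o, 'm) chain_map" where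
  "transition X \<phi> \<psi> = \<lparr>source = reindex \<phi> X, target = reindex \<psi> X,
    component = \<lambda>i. dd X (\<phi> i) (\<psi> i)\<rparr>"

lemma reindex_simps [simp]:
  "deg (reindex \<phi> X) i = deg X (\<phi> i)" "diff (reindex \<phi> X) i = dd X (\<phi> i) (\<phi> (i + 1))"
  "source (reindex_map \<phi> f) = reindex \<phi> (source f)" "target (reindex_map \<phi> f) = reindex \<phi> (target f)"
  "component (reindex_map \<phi> f) i = component f (\<phi> i)"
  "source (transition X \<phi> \<psi>) = reindex \<phi> X" "target (transition X \<phi> \<psi>) = reindex \<psi> X"
  "component (transition X \<phi> \<psi>) i = dd X (\<phi> i) (\<psi> i)"
  by (simp_all add: reindex_def reindex_map_def transition_def)

lemma shift_mapD:
  assumes "shift_map \<phi>"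
  shows "i \<le> j \<Longrightarrow> \<phi> i \<le> \<phi> j" "\<phi> i \<le> \<phi> (i + 1)" "\<phi> (i + int N) = \<phi> i + int N"
    "\<phi> (i - int N + 1) = \<phi> (i + 1) - int N"
proof -
  show "i \<le> j \<Longrightarrow> \<phi> i \<le> \<phi> j" "\<phi> i \<le> \<phi> (i + 1)" "\<phi> (i + int N) = \<phi> i + int N" for i j
    using assms by (simp_all add: shift_map_def monoD)
  from this(3)[of "i - int N + 1"] show "\<phi> (i - int N + 1) = \<phi> (i + 1) - int N"
    by (simp add: algebra_simps)
qed

lemma shift_map_id: "shift_map (\<lambda>i. i)"
  by (simp add: shift_map_def mono_def)

lemma reindex_id: "X \<in> ncomplexes C N \<Longrightarrow> reindex (\<lambda>i. i) X = X"
  by (rule ncomplex.equality) (auto simp: reindex_def dd_step)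

lemma diff_iter_reindex:
  assumes X: "X \<in> ncomplexes C N" and \<phi>: "shift_map \<phi>"
  shows "diff_iter C (reindex \<phi> X) i n = dd X (\<phi> i) (\<phi> (i + int n))"
proof (induction n)
  case (Suc n)
  then show ?case
    using dd_comp[OF X, of "\<phi> i" "\<phi> (i + int n)" "\<phi> (i + int n + 1)"] shift_mapD[OF \<phi>]
    by (simp add: add.assoc add.commute[of 1])
qed (simp add: dd_self)

lemma reindex_ncomplex:
  assumes X: "X \<in> ncomplexes C N" and \<phi>: "shift_map \<phi>"
  shows "reindex \<phi> X \<in> ncomplexes C N"
  by (rule ncomplexI)
    (use shift_mapD[OF \<phi>] in \<open>simp_all add: diff_iter_reindex[OF X \<phi>] dd_zero[OF X] ncomplexD[OF X]
      dd_arr[OF X] in_Homs\<close>)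

lemma dd_reindex:
  assumes "X \<in> ncomplexes C N" "shift_map \<phi>" "a \<le> b"
  shows "dd (reindex \<phi> X) a b = dd X (\<phi> a) (\<phi> b)"
  using diff_iter_reindex[OF assms(1,2), of a "nat (b - a)"] assms(3)
  unfolding dd_def[of "reindex \<phi> X"] by simp

lemma reindex_chain_map:
  assumes f: "f \<in> chain_maps C N" and \<phi>: "shift_map \<phi>"
  shows "reindex_map \<phi> f \<in> chain_maps C N"
  by (rule chain_mapI)
    (use chain_mapD[OF f] shift_mapD[OF \<phi>] in
      \<open>simp_all add: reindex_ncomplex[OF _ \<phi>] in_Homs chain_map_dd[OF f]\<close>)

lemma transition_chain_map:
  assumes X: "X \<in> ncomplexes C N" and \<phi>: "shift_map \<phi>" and \<psi>: "shift_map \<psi>"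
    and le: "\<And>i. \<phi> i \<le> \<psi> i"
  shows "transition X \<phi> \<psi> \<in> chain_maps C N"
proof (rule chain_mapI)
  fix i
  have "\<phi> i \<le> \<psi> (i + 1)" using shift_mapD(2)[OF \<psi>, of i] le[of i] by simp
  then show "component (transition X \<phi> \<psi>) (i + 1) \<cdot> diff (source (transition X \<phi> \<psi>)) i
      = diff (target (transition X \<phi> \<psi>)) i \<cdot> component (transition X \<phi> \<psi>) i"
    using shift_mapD(2)[OF \<phi>, of i] shift_mapD(2)[OF \<psi>, of i] le[of i] le[of "i + 1"]
    by (simp add: dd_comp[OF X])
qed (use X le in \<open>simp_all add: reindex_ncomplex \<phi> \<psi> in_Homs dd_arr\<close>)

lemma reindex_conflation:
  assumes "(f, g) \<in> conflations C N" "shift_map \<phi>"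
  shows "(reindex_map \<phi> f, reindex_map \<phi> g) \<in> conflations C N"
  using assms by (auto simp: conflations_def reindex_chain_map)

lemma reindex_ident: "reindex_map \<phi> (Ident CC X) = Ident CC (reindex \<phi> X)"
  by (rule chain_map_eqI) simp_all

lemma reindex_diff:
  assumes f: "f \<in> chain_maps C N" and g: "g \<in> chain_maps C N" and \<phi>: "shift_map \<phi>"
    and eq: "source g = source f" "target g = target f"
  shows "reindex_map \<phi> (Add CC f (CC.neg g)) = Add CC (reindex_map \<phi> f) (CC.neg (reindex_map \<phi> g))"
  by (rule chain_map_eqI) (simp_all add: neg_CC[OF g] neg_CC[OF reindex_chain_map[OF g \<phi>]])

text \<open>The new homotopy in degree \<open>u\<close> collects the old \<open>s t\<close> over the
  block from \<open>\<phi> u\<close> to \<open>\<phi> (u + 1) - 1\<close>, padded with differentials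
  on both sides. On the side of \<open>Y\<close> the padding runs forwards because
  \<open>\<phi> (u - N + 1) = \<phi> (u + 1) - N\<close>. Over a window of \<open>N\<close> indices
  \<open>u\<close> the blocks tile the window starting at \<open>\<phi> i\<close>, so
  \<open>hsum_blocks\<close> recovers the original sum.\<close>

lemma reindex_homotopy_map:
  assumes X: "X \<in> ncomplexes C N" and Y: "Y \<in> ncomplexes C N" and s: "homotopy_family X Y s"
    and \<phi>: "shift_map \<phi>"
  shows "Null (reindex_map \<phi> (homotopy_map X Y s))"
proof -
  note [simp] = ncomplexD(1-4)[OF X] ncomplexD(1-4)[OF Y] homotopy_familyD[OF s]
    dd_arr[OF X] dd_arr[OF Y] comp_arr
  note P = shift_mapD[OF \<phi>]
  define F where "F u t = dd Y (t - int N + 1) (\<phi> (u - int N + 1)) \<cdot> s t \<cdot> dd X (\<phi> u) t" for u t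
  define s' where "s' u = hsum (deg X (\<phi> u)) (deg Y (\<phi> (u - int N + 1))) (F u) {\<phi> u..<\<phi> (u + 1)}" for u
  have F: "F u t \<in> Homs C (deg X (\<phi> u)) (deg Y (\<phi> (u - int N + 1)))" if "t \<in> {\<phi> u..<\<phi> (u + 1)}" for u t
    using that P(4)[of u] by (simp add: F_def in_Homs)
  have s'H: "s' u \<in> Homs C (deg X (\<phi> u)) (deg Y (\<phi> (u - int N + 1)))" for u
    unfolding s'_def by (rule hsum_closed) (simp_all add: F)
  then have s': "homotopy_family (reindex \<phi> X) (reindex \<phi> Y) s'"
    by (simp add: homotopy_family_def)
  have "reindex_map \<phi> (homotopy_map X Y s) = homotopy_map (reindex \<phi> X) (reindex \<phi> Y) s'"
  proof (rule chain_map_eqI)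
    fix i
    let ?X = "deg X (\<phi> i)" and ?Y = "deg Y (\<phi> i)"
    have T: "homotopy_term X Y s (\<phi> i) t \<in> Homs C ?X ?Y" if "t \<in> {\<phi> i..<\<phi> (i + int N)}" for t
      using homotopy_term_closed[OF X Y s, of t "\<phi> i"] that P(3) by simp
    have "homotopy_term (reindex \<phi> X) (reindex \<phi> Y) s' i u
        = hsum ?X ?Y (homotopy_term X Y s (\<phi> i)) {\<phi> u..<\<phi> (u + 1)}" if u: "u \<in> {i..<i + int N}" for u
    proof -
      have le: "\<phi> i \<le> \<phi> u" "\<phi> (u - int N + 1) \<le> \<phi> i" using u by (auto intro!: P(1))
      let ?a = "dd X (\<phi> i) (\<phi> u)" and ?b = "dd Y (\<phi> (u - int N + 1)) (\<phi> i)"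
      have a: "?a \<in> Homs C ?X (deg X (\<phi> u))" and b: "?b \<in> Homs C (deg Y (\<phi> (u - int N + 1))) ?Y"
        using le by (simp_all add: in_Homs)
      have Fa: "F u t \<cdot> ?a \<in> Homs C ?X (deg Y (\<phi> (u - int N + 1)))" if "t \<in> {\<phi> u..<\<phi> (u + 1)}" for t
        using F[OF that] a by (simp add: in_Homs)
      have "homotopy_term (reindex \<phi> X) (reindex \<phi> Y) s' i u = ?b \<cdot> s' u \<cdot> ?a"
        using u by (simp add: homotopy_term_def dd_reindex[OF X \<phi>] dd_reindex[OF Y \<phi>])
      also have "s' u \<cdot> ?a = hsum ?X (deg Y (\<phi> (u - int N + 1))) (\<lambda>t. F u t \<cdot> ?a) {\<phi> u..<\<phi> (u + 1)}"
        unfolding s'_def by (rule hsum_comp[OF _ _ _ F a]) simp_all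
      also have "?b \<cdot> \<dots> = hsum ?X ?Y (\<lambda>t. ?b \<cdot> F u t \<cdot> ?a) {\<phi> u..<\<phi> (u + 1)}"
        by (rule comp_hsum[OF _ _ _ Fa b]) simp_all
      also have "\<dots> = hsum ?X ?Y (homotopy_term X Y s (\<phi> i)) {\<phi> u..<\<phi> (u + 1)}"
      proof (rule hsum_cong)
        fix t assume t: "t \<in> {\<phi> u..<\<phi> (u + 1)}"
        then have le': "\<phi> u \<le> t" "t - int N + 1 \<le> \<phi> (u - int N + 1)" using P(4)[of u] by auto
        then show "?b \<cdot> F u t \<cdot> ?a = homotopy_term X Y s (\<phi> i) t"
          using le by (simp add: F_def homotopy_term_def comp_assoc dd_comp[OF X] dd_comp_assoc[OF Y])
        show "homotopy_term X Y s (\<phi> i) t \<in> Homs C ?X ?Y"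
          using le le' by (simp add: homotopy_term_def in_Homs)
      qed simp_all
      finally show ?thesis .
    qed
    then have "hsum ?X ?Y (homotopy_term (reindex \<phi> X) (reindex \<phi> Y) s' i) {i..<i + int N}
        = hsum ?X ?Y (\<lambda>u. hsum ?X ?Y (homotopy_term X Y s (\<phi> i)) {\<phi> u..<\<phi> (u + 1)}) {i..<i + int N}"
    proof (intro hsum_cong)
      fix u assume u: "u \<in> {i..<i + int N}"
      show "hsum ?X ?Y (homotopy_term X Y s (\<phi> i)) {\<phi> u..<\<phi> (u + 1)} \<in> Homs C ?X ?Y"
      proof (rule hsum_closed)
        fix t assume "t \<in> {\<phi> u..<\<phi> (u + 1)}"
        then show "homotopy_term X Y s (\<phi> i) t \<in> Homs C ?X ?Y"
          using P(1)[of i u] P(1)[of "u + 1" "i + int N"] u by (intro T) auto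
      qed simp_all
    qed auto
    also have "\<dots> = hsum ?X ?Y (homotopy_term X Y s (\<phi> i)) {\<phi> i..<\<phi> (i + int N)}"
      by (rule hsum_blocks) (use \<phi> T in \<open>auto simp: shift_map_def\<close>)
    finally show "component (reindex_map \<phi> (homotopy_map X Y s)) i
        = component (homotopy_map (reindex \<phi> X) (reindex \<phi> Y) s') i"
      by (simp add: P(3))
  qed simp_all
  then show ?thesis
    using null_homotopy_map[OF reindex_ncomplex[OF X \<phi>] reindex_ncomplex[OF Y \<phi>] s'] by simp
qed

lemma reindex_null:
  assumes f: "f \<in> chain_maps C N" "Null f" and \<phi>: "shift_map \<phi>"
  shows "Null (reindex_map \<phi> f)"
proof -
  obtain s where "homotopy_family (source f) (target f) s" "f = homotopy_map (source f) (target f) s"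
    using null_homotopicE[OF f(2,1)] .
  then show ?thesis using reindex_homotopy_map[OF chain_mapD(1,2)[OF f(1)] _ \<phi>] by metis
qed

text \<open>\<open>step_map a b\<close> has the value \<open>b + q N\<close> on the interval from \<open>a + q N\<close> to \<open>a + q N + N - 1\<close>.\<close>

definition step_map :: "int \<Rightarrow> int \<Rightarrow> int \<Rightarrow> int" where
  "step_map a b k = b + int N * ((k - a) div int N)"

lemma div_bounds: "int N * (x div int N) \<le> x" "x < int N * (x div int N) + int N"
  using N_pos mult_div_mod_eq[of "int N" x] pos_mod_sign[of "int N" x] pos_mod_bound[of "int N" x]
  by linarith+

lemma div_unique: "int N * q \<le> x \<Longrightarrow> x < int N * q + int N \<Longrightarrow> x div int N = q"
  by (rule int_div_pos_eq[of _ _ _ "x - int N * q"]) auto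

lemma shift_map_step: "shift_map (step_map a b)"
  unfolding shift_map_def step_map_def
proof (intro conjI allI)
  show "mono (\<lambda>k. b + int N * ((k - a) div int N))"
    using N_pos by (intro monoI add_left_mono mult_left_mono zdiv_mono1) auto
  show "b + int N * ((i + int N - a) div int N) = b + int N * ((i - a) div int N) + int N" for i
    using div_bounds[of "i - a"] div_unique[of "(i - a) div int N + 1" "i + int N - a"]
    by (simp add: distrib_left)
qed

lemma reindex_step_null:
  assumes X: "X \<in> ncomplexes C N"
  shows "Null (Ident CC (reindex (step_map a b) X))"
proof -
  let ?\<phi> = "step_map a b"
  let ?P = "reindex ?\<phi> X"
  note \<phi> = shift_map_step[of a b]
  note P = reindex_ncomplex[OF X \<phi>]
  note [simp] = ncomplexD(1)[OF X] alg
  \<comment> \<open>Nonzero at most in the last degree of each block. There \<open>t - N + 1\<close>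
    is the first degree of the same block, so \<open>s t\<close> has equal source and target and can
    be an identity.\<close>
  define s where "s t = (if (t + 1 - a) mod int N = 0 then Ident C (deg X (?\<phi> t))
    else Zero C (deg X (?\<phi> t)) (deg X (?\<phi> (t - int N + 1))))" for t
  have last: "?\<phi> (t - int N + 1) = ?\<phi> t" if mod: "(t + 1 - a) mod int N = 0" for t
  proof -
    obtain q where q: "t + 1 - a = int N * q" using mod by (auto simp: mod_0_imp_dvd elim: dvdE)
    have "(t - int N + 1 - a) div int N = q - 1" "(t - a) div int N = q - 1"
      using q N_pos by (auto intro!: div_unique simp: right_diff_distrib)
    then show ?thesis by (simp add: step_map_def)
  qed
  have s: "homotopy_family ?P ?P s"
    by (auto simp: homotopy_family_def s_def in_Homs last)
  have "Ident CC ?P = homotopy_map ?P ?P s"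
  proof (rule chain_map_eqI)
    fix i
    let ?q = "(i - a) div int N"
    \<comment> \<open>The last degree of the block containing \<open>i\<close>, and the only degree
      of the window in which \<open>s\<close> is given by an identity. The complex is constant from
      \<open>i\<close> to \<open>e\<close> and from \<open>e - N + 1\<close> to \<open>i\<close>, so
      this summand is the identity.\<close>
    define e where "e = a + int N * ?q + int N - 1"
    have e: "e \<in> {i..<i + int N}" "(e + 1 - a) mod int N = 0"
      using div_bounds[of "i - a"] by (auto simp: e_def)
    have "(e - a) div int N = ?q"
      using N_pos by (intro div_unique) (auto simp: e_def)
    then have e\<phi>: "?\<phi> e = ?\<phi> i" by (simp add: step_map_def)
    have E: "homotopy_term ?P ?P s i e = Ident C (deg X (?\<phi> i))"
      using e last[OF e(2)] e\<phi>
      by (simp add: homotopy_term_def dd_reindex[OF X \<phi>] s_def dd_self)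
    have Z: "homotopy_term ?P ?P s i t = Zero C (deg X (?\<phi> i)) (deg X (?\<phi> i))"
      if t: "t \<in> {i..<i + int N}" "t \<noteq> e" for t
    proof -
      have "(t + 1 - a) mod int N \<noteq> 0"
      proof
        assume "(t + 1 - a) mod int N = 0"
        then obtain q where q: "t + 1 - a = int N * q" by (auto simp: mod_0_imp_dvd elim: dvdE)
        then have "?q = q - 1"
          using t by (intro div_unique) (auto simp: right_diff_distrib)
        then show False using q t(2) by (simp add: e_def right_diff_distrib)
      qed
      then show ?thesis
        using t shift_mapD(1)[OF \<phi>, of i t] shift_mapD(1)[OF \<phi>, of "t - int N + 1" i]
        by (simp add: homotopy_term_def dd_reindex[OF X \<phi>] s_def dd_arr[OF X])
    qed
    have "hsum (deg X (?\<phi> i)) (deg X (?\<phi> i)) (homotopy_term ?P ?P s i) {i..<i + int N}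
        = homotopy_term ?P ?P s i e"
      by (rule hsum_single) (use e(1) E Z in \<open>simp_all add: in_Homs\<close>)
    then show "component (Ident CC ?P) i = component (homotopy_map ?P ?P s) i"
      using E by simp
  qed simp_all
  then show ?thesis using null_homotopy_map[OF P P s] by simp
qed

subsection \<open>Enough injectives and projectives\<close>

lemma null_biprod:
  assumes bp: "CC.biprod X Y S i j p q" and null: "Null (Ident CC X)" "Null (Ident CC Y)"
  shows "Null (Ident CC S)"
proof -
  note D = CC.biprodD[OF bp]
  have i: "Null i" using comp_null[of i "Ident CC X"] null_comp[of "Ident CC X" i] null D
    by (simp add: CC.comp_ident ident_chain_map)
  have j: "Null j" using null_comp[of "Ident CC Y" j] null D
    by (simp add: CC.comp_ident ident_chain_map)
  have "Null (Add CC (i \<cdot>\<^bsub>CC\<^esub> p) (j \<cdot>\<^bsub>CC\<^esub> q))"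
    using D i j by (intro null_add comp_null) (simp_all add: comp_chain_map)
  then show ?thesis unfolding D(20) .
qed

text \<open>\<open>step_map (m + 1) (m + N)\<close> rounds a degree up to the next one congruent to
  \<open>m\<close>. Being a step map it gives a contractible complex, and it fixes the degrees
  congruent to \<open>m\<close>, where the natural map is therefore an identity.\<close>

lemma hull_piece:
  assumes X: "X \<in> ncomplexes C N"
  shows "\<exists>P. \<exists>e\<in>Homs CC X P. Null (Ident CC P) \<and>
    (\<forall>k. k mod int N = m mod int N \<longrightarrow> component e k = Ident C (deg X k))"
proof -
  let ?c = "step_map (m + 1) (m + int N)"
  note c = shift_map_step[of "m + 1" "m + int N"]
  have "k \<le> ?c k" for k
    using div_bounds[of "k - (m + 1)"] by (simp add: step_map_def)
  then have "transition X (\<lambda>k. k) ?c \<in> Homs CC X (reindex ?c X)"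
    using transition_chain_map[OF X shift_map_id c] by (simp add: Homs_CC reindex_id[OF X])
  moreover have "component (transition X (\<lambda>k. k) ?c) k = Ident C (deg X k)"
    if mod: "k mod int N = m mod int N" for k
  proof -
    obtain q where q: "k - m = int N * q"
      using mod mod_eq_dvd_iff[of k "int N" m] by (auto elim: dvdE)
    then have "(k - (m + 1)) div int N = q - 1"
      using N_pos by (intro div_unique) (auto simp: right_diff_distrib)
    then have "?c k = k" using q by (simp add: step_map_def right_diff_distrib)
    then show ?thesis by (simp add: dd_self)
  qed
  ultimately show ?thesis using reindex_step_null[OF X] by blast
qed

text \<open>Here \<open>step_map m m\<close> rounds down instead, so the natural map points towards
  \<open>X\<close>.\<close>

lemma cohull_piece:
  assumes X: "X \<in> ncomplexes C N"
  shows "\<exists>P. \<exists>e\<in>Homs CC P X. Null (Ident CC P) \<and>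
    (\<forall>k. k mod int N = m mod int N \<longrightarrow> component e k = Ident C (deg X k))"
proof -
  let ?c = "step_map m m"
  note c = shift_map_step[of m m]
  have "?c k \<le> k" for k
    using div_bounds[of "k - m"] by (simp add: step_map_def)
  then have "transition X ?c (\<lambda>k. k) \<in> Homs CC (reindex ?c X) X"
    using transition_chain_map[OF X c shift_map_id] by (simp add: Homs_CC reindex_id[OF X])
  moreover have "component (transition X ?c (\<lambda>k. k)) k = Ident C (deg X k)"
    if mod: "k mod int N = m mod int N" for k
  proof -
    obtain q where q: "k - m = int N * q"
      using mod mod_eq_dvd_iff[of k "int N" m] by (auto elim: dvdE)
    then have "?c k = k" using N_pos by (simp add: step_map_def)
    then show ?thesis by (simp add: dd_self)
  qed
  ultimately show ?thesis using reindex_step_null[OF X] by blast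
qed

text \<open>A single piece is known to split only in one residue class. Induction adds one piece per
  class; \<open>split_mono_pair\<close> keeps the splittings already obtained, and the sum has null
  identity since both summands do.\<close>

lemma hull_stage:
  assumes X: "X \<in> ncomplexes C N"
  shows "\<exists>J. \<exists>f\<in>Homs CC X J. Null (Ident CC J) \<and>
    (\<forall>k. k mod int N \<le> int n \<longrightarrow> (\<exists>g. split_short_exact C (component f k) g))"
proof (induction n)
  case 0
  obtain P e where e: "e \<in> Homs CC X P" "Null (Ident CC P)"
    "\<And>k. k mod int N = 0 mod int N \<Longrightarrow> component e k = Ident C (deg X k)"
    using hull_piece[OF X, of 0] by blast
  have "\<exists>g. split_short_exact C (component e k) g" if "k mod int N \<le> int 0" for k
  proof -
    have "k mod int N = 0" using that pos_mod_sign[of "int N" k] N_pos by linarith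
    then show ?thesis using e(3)[of k] split_mono_ident(1)[OF ncomplexD(1)[OF X]] by simp
  qed
  then show ?case using e by blast
next
  case (Suc n)
  then obtain J f where f: "f \<in> Homs CC X J" "Null (Ident CC J)"
    "\<And>k. k mod int N \<le> int n \<Longrightarrow> \<exists>g. split_short_exact C (component f k) g" by blast
  obtain P e where e: "e \<in> Homs CC X P" "Null (Ident CC P)"
    "\<And>k. k mod int N = int (Suc n) mod int N \<Longrightarrow> component e k = Ident C (deg X k)"
    using hull_piece[OF X, of "int (Suc n)"] by blast
  have fe: "f \<in> chain_maps C N" "source f = X" "target f = J" "e \<in> chain_maps C N" "source e = X"
    "target e = P" using f(1) e(1) by (auto simp: Homs_CC)
  obtain S i j p q where S: "CC.biprod J P S i j p q" and bp: "\<And>k. biprod (deg J k) (deg P k) (deg S k)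
      (component i k) (component j k) (component p k) (component q k)"
    using CC_biprod_exists[of J P] chain_mapD(2) fe by blast
  note D = CC.biprodD[OF S]
  let ?h = "Add CC (i \<cdot>\<^bsub>CC\<^esub> f) (j \<cdot>\<^bsub>CC\<^esub> e)"
  have "?h \<in> Homs CC X S"
    using D fe by (simp add: Homs_CC add_chain_map comp_chain_map)
  moreover have "\<exists>g. split_short_exact C (component ?h k) g" if k: "k mod int N \<le> int (Suc n)" for k
  proof (cases "k mod int N \<le> int n")
    case True
    then obtain g where g: "split_short_exact C (component f k) g" using f(3) by blast
    have "component e k \<in> Homs C (Dom C (component f k)) (deg P k)"
      using chain_mapD(3-5)[OF fe(1)] chain_mapD(3-5)[OF fe(4)] fe by (simp add: in_Homs)
    from split_mono_pair[OF bp g _ this] show ?thesis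
      using chain_mapD(5)[OF fe(1)] fe(3) by simp
  next
    case False
    then have "k mod int N = int (Suc n)" using k by simp
    \<comment> \<open>Since \<open>Suc n\<close> occurs as a residue it is smaller than
      \<open>N\<close>; this is how the piece attached to \<open>Suc n\<close> applies to
      \<open>k\<close>, also when the stage index is allowed to reach \<open>N\<close>.\<close>
    moreover from this have "int (Suc n) mod int N = int (Suc n)"
      using mod_mod_trivial[of k "int N"] by simp
    ultimately have ek: "component e k = Ident C (deg X k)" by (intro e(3)) simp
    have eP: "deg P k = deg X k"
      using chain_mapD(5)[OF fe(4), of k] fe(6) ncomplexD(1)[OF X, of k] by (simp add: ek ident_arr)
    obtain g where g: "split_short_exact C (component e k) g"
      using split_mono_ident(1)[OF ncomplexD(1)[OF X, of k]] unfolding ek by blast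
    have "component f k \<in> Homs C (Dom C (component e k)) (deg J k)"
      using chain_mapD(3-5)[OF fe(1)] chain_mapD(3-5)[OF fe(4)] fe by (simp add: in_Homs)
    \<comment> \<open>In this class the second summand is the one known to split, so the roles of
      the summands are exchanged and the order of addition is restored afterwards.\<close>
    from split_mono_pair[OF biprod_sym[OF bp] g _ this]
    obtain h where "split_short_exact C (component j k \<cdot> component e k \<oplus> component i k \<cdot> component f k) h"
      using chain_mapD(5)[OF fe(4)] fe(6) by auto
    moreover have "component j k \<cdot> component e k \<oplus> component i k \<cdot> component f k = component ?h k"
      unfolding CC_simps using biprodD(1-15)[OF bp, of k] chain_mapD(3-5)[OF fe(1), of k]
        chain_mapD(3-5)[OF fe(4), of k] fe by (intro add_commute) (simp_all add: comp_arr)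
    ultimately show ?thesis by auto
  qed
  ultimately show ?case using null_biprod[OF S f(2) e(2)] by blast
qed

lemma cohull_stage:
  assumes X: "X \<in> ncomplexes C N"
  shows "\<exists>J. \<exists>g\<in>Homs CC J X. Null (Ident CC J) \<and>
    (\<forall>k. k mod int N \<le> int n \<longrightarrow> (\<exists>f. split_short_exact C f (component g k)))"
proof (induction n)
  case 0
  obtain P e where e: "e \<in> Homs CC P X" "Null (Ident CC P)"
    "\<And>k. k mod int N = 0 mod int N \<Longrightarrow> component e k = Ident C (deg X k)"
    using cohull_piece[OF X, of 0] by blast
  have "\<exists>f. split_short_exact C f (component e k)" if "k mod int N \<le> int 0" for k
  proof -
    have "k mod int N = 0" using that pos_mod_sign[of "int N" k] N_pos by linarith
    then show ?thesis using e(3)[of k] split_mono_ident(2)[OF ncomplexD(1)[OF X]] by simp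
  qed
  then show ?case using e by blast
next
  case (Suc n)
  then obtain J f where f: "f \<in> Homs CC J X" "Null (Ident CC J)"
    "\<And>k. k mod int N \<le> int n \<Longrightarrow> \<exists>g. split_short_exact C g (component f k)" by blast
  obtain P e where e: "e \<in> Homs CC P X" "Null (Ident CC P)"
    "\<And>k. k mod int N = int (Suc n) mod int N \<Longrightarrow> component e k = Ident C (deg X k)"
    using cohull_piece[OF X, of "int (Suc n)"] by blast
  have fe: "f \<in> chain_maps C N" "target f = X" "source f = J" "e \<in> chain_maps C N" "target e = X"
    "source e = P" using f(1) e(1) by (auto simp: Homs_CC)
  obtain S i j p q where S: "CC.biprod J P S i j p q" and bp: "\<And>k. biprod (deg J k) (deg P k) (deg S k)
      (component i k) (component j k) (component p k) (component q k)"
    using CC_biprod_exists[of J P] chain_mapD(1) fe by blast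
  note D = CC.biprodD[OF S]
  let ?h = "Add CC (f \<cdot>\<^bsub>CC\<^esub> p) (e \<cdot>\<^bsub>CC\<^esub> q)"
  have "?h \<in> Homs CC S X"
    using D fe by (simp add: Homs_CC add_chain_map comp_chain_map)
  moreover have "\<exists>g. split_short_exact C g (component ?h k)" if k: "k mod int N \<le> int (Suc n)" for k
  proof (cases "k mod int N \<le> int n")
    case True
    then obtain g where g: "split_short_exact C g (component f k)" using f(3) by blast
    have "component e k \<in> Homs C (deg P k) (Cod C (component f k))"
      using chain_mapD(3-5)[OF fe(1)] chain_mapD(3-5)[OF fe(4)] fe by (simp add: in_Homs)
    from split_epi_pair[OF bp g _ this] show ?thesis
      using chain_mapD(4)[OF fe(1)] fe(3) by simp
  next
    case False
    then have "k mod int N = int (Suc n)" using k by simp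
    moreover from this have "int (Suc n) mod int N = int (Suc n)"
      using mod_mod_trivial[of k "int N"] by simp
    ultimately have ek: "component e k = Ident C (deg X k)" by (intro e(3)) simp
    obtain g where g: "split_short_exact C g (component e k)"
      using split_mono_ident(2)[OF ncomplexD(1)[OF X, of k]] unfolding ek by blast
    have "component f k \<in> Homs C (deg J k) (Cod C (component e k))"
      using chain_mapD(3-5)[OF fe(1)] chain_mapD(3-5)[OF fe(4)] fe by (simp add: in_Homs)
    from split_epi_pair[OF biprod_sym[OF bp] g _ this]
    obtain h where "split_short_exact C h (component e k \<cdot> component q k \<oplus> component f k \<cdot> component p k)"
      using chain_mapD(4)[OF fe(4)] fe(6) by auto
    moreover have "component e k \<cdot> component q k \<oplus> component f k \<cdot> component p k = component ?h k"
      unfolding CC_simps using biprodD(1-15)[OF bp, of k] chain_mapD(3-5)[OF fe(1), of k]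
        chain_mapD(3-5)[OF fe(4), of k] fe by (intro add_commute) (simp_all add: comp_arr)
    ultimately show ?thesis by auto
  qed
  ultimately show ?case using null_biprod[OF S f(2) e(2)] by blast
qed

lemma enough_injectives:
  assumes X: "X \<in> ncomplexes C N"
  shows "\<exists>i p. (i, p) \<in> conflations C N \<and> source i = X \<and> Null (Ident CC (target i))"
proof -
  obtain J f where f: "f \<in> Homs CC X J" "Null (Ident CC J)"
    "\<And>k. k mod int N \<le> int N \<Longrightarrow> \<exists>g. split_short_exact C (component f k) g"
    using hull_stage[OF X, of N] by blast
  have "\<exists>g. split_short_exact C (component f k) g" for k
    using pos_mod_bound[of "int N" k] N_pos by (intro f(3)) linarith
  then show ?thesis using cokernel_complex[of f] f(1,2) by (auto simp: Homs_CC)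
qed

lemma enough_projectives:
  assumes X: "X \<in> ncomplexes C N"
  shows "\<exists>i p. (i, p) \<in> conflations C N \<and> target p = X \<and> Null (Ident CC (target i))"
proof -
  obtain J f where f: "f \<in> Homs CC J X" "Null (Ident CC J)"
    "\<And>k. k mod int N \<le> int N \<Longrightarrow> \<exists>g. split_short_exact C g (component f k)"
    using cohull_stage[OF X, of N] by blast
  have "\<exists>g. split_short_exact C g (component f k)" for k
    using pos_mod_bound[of "int N" k] N_pos by (intro f(3)) linarith
  then obtain i where i: "(i, f) \<in> conflations C N"
    using kernel_complex[of f] f(1) by (auto simp: Homs_CC)
  show ?thesis
    by (rule exI[of _ i], rule exI[of _ f])
      (use i f(1,2) conflationD(3)[OF i] in \<open>auto simp: Homs_CC\<close>)
qed

lemma frobenius_CC: "frobenius CC (conflations C N) Null"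
proof (intro frobenius.intro frobenius_axioms.intro additive_CC, unfold CC_simps)
  fix X assume "X \<in> ncomplexes C N"
  then show "\<exists>i p. (i, p) \<in> conflations C N \<and> source i = X \<and> Null (Ident CC (target i))"
    "\<exists>i p. (i, p) \<in> conflations C N \<and> target p = X \<and> Null (Ident CC (target i))"
    by (rule enough_injectives enough_projectives)+
next
  fix f i p Y assume "Null f" "(i, p) \<in> conflations C N" "f \<in> Homs CC (source i) Y"
  then show "\<exists>g\<in>Homs CC (target i) Y. Null g \<and> g \<cdot>\<^bsub>CC\<^esub> i = f"
    using conflation_null_extend[of i p f] by (auto simp: Homs_CC)
next
  fix f i p X assume "Null f" "(i, p) \<in> conflations C N" "f \<in> Homs CC X (target p)"
  then show "\<exists>g\<in>Homs CC X (target i). Null g \<and> p \<cdot>\<^bsub>CC\<^esub> g = f"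
    using conflation_null_lift[of i p f] by (auto simp: Homs_CC)
next
  fix i p b W assume "(i, p) \<in> conflations C N" "b \<in> Homs CC W (target i)"
    "p \<cdot>\<^bsub>CC\<^esub> b = Zero CC W (target p)"
  then show "\<exists>a\<in>Homs CC W (source i). i \<cdot>\<^bsub>CC\<^esub> a = b"
    using conflation_ker[of i p b] by (auto simp: Homs_CC)
next
  fix i p b W assume "(i, p) \<in> conflations C N" "b \<in> Homs CC (target i) W"
    "b \<cdot>\<^bsub>CC\<^esub> i = Zero CC (source i) W"
  then show "\<exists>a\<in>Homs CC (target p) W. a \<cdot>\<^bsub>CC\<^esub> p = b"
    using conflation_coker[of i p b] by (auto simp: Homs_CC)
qed (auto simp: null_zero null_add null_neg null_comp comp_null conflationD conflation_zero
    intro: conflation_mono conflation_epi)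

end

section \<open>The subcategories \<open>\<F>\<^sub>s\<^sup>r\<close>\<close>

context frobenius
begin

text \<open>The idempotent onto the summand \<open>P\<close> is null, so inclusion and projection of
  \<open>X\<close> are inverse to each other in the stable category.\<close>

lemma siso_biprod:
  assumes bp: "biprod X P S i j p q" and P: "Null (Ident C P)"
  shows "siso X S"
proof -
  note D = biprodD[OF bp]
  have "Null (j \<cdot> q)"
    using null_comp[OF null_into_injective[of P q S], of j] P D by (simp add: in_Homs)
  then have "Null (\<ominus> (j \<cdot> q))" by (rule null_neg) (simp add: D comp_arr)
  moreover have "i \<cdot> p \<oplus> \<ominus> (i \<cdot> p \<oplus> j \<cdot> q) = \<ominus> (j \<cdot> q)"
    using D(1-15) by (simp add: alg)
  ultimately have "i \<cdot> p \<sim> i \<cdot> p \<oplus> j \<cdot> q"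
    using D(1-15) by (simp add: sim_iff alg)
  then have "i \<cdot> p \<sim> Ident C S" unfolding D(20) .
  then show ?thesis
    by (intro sisoI[of i _ _ p]) (simp_all add: D(1-16) in_Homs sim_refl ident_arr)
qed

end

context preadditive_category
begin

text \<open>The sequence attached to a commutative square in which two parallel sides are identities
  and the other two are \<open>e\<close>; the minus sign makes it a complex. The composites with
  \<open>Ident\<close> are kept in the shape in which they occur in the truncation sequence, in
  degrees \<open>k \<le> mid k\<close>; \<open>split_square_right\<close> handles the remaining
  degrees.\<close>

lemma split_square_left:
  assumes bp: "biprod X P S i j p q" and e: "e \<in> Homs C X P"
  shows "split_short_exact C (i \<cdot> Ident C X \<oplus> j \<cdot> e) (e \<cdot> p \<oplus> \<ominus> (Ident C P \<cdot> q))"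
proof -
  note D = biprodD[OF bp]
  note [simp] = alg D(1-19) e[unfolded in_Homs] biprod_red[OF bp]
  show ?thesis
  proof (rule split_short_exactI[of _ _ p "\<ominus> j"])
    have "(i \<cdot> Ident C X \<oplus> j \<cdot> e) \<cdot> p \<oplus> \<ominus> j \<cdot> (e \<cdot> p \<oplus> \<ominus> (Ident C P \<cdot> q)) = i \<cdot> p \<oplus> j \<cdot> q"
      by simp
    also note D(20)
    finally show "(i \<cdot> Ident C X \<oplus> j \<cdot> e) \<cdot> p \<oplus> \<ominus> j \<cdot> (e \<cdot> p \<oplus> \<ominus> (Ident C P \<cdot> q))
        = Ident C (Cod C (i \<cdot> Ident C X \<oplus> j \<cdot> e))" by simp
  qed simp_all
qed

lemma split_square_right:
  assumes bp: "biprod X P S i j p q" and e: "e \<in> Homs C P X"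
  shows "split_short_exact C (i \<cdot> e \<oplus> j \<cdot> Ident C P) (Ident C X \<cdot> p \<oplus> \<ominus> (e \<cdot> q))"
proof -
  note D = biprodD[OF bp]
  note [simp] = alg D(1-19) e[unfolded in_Homs] biprod_red[OF bp]
  show ?thesis
  proof (rule split_short_exactI[of _ _ q i])
    have "(i \<cdot> e \<oplus> j \<cdot> Ident C P) \<cdot> q \<oplus> i \<cdot> (Ident C X \<cdot> p \<oplus> \<ominus> (e \<cdot> q))
        = (i \<cdot> e \<cdot> q \<oplus> j \<cdot> q) \<oplus> (i \<cdot> p \<oplus> \<ominus> (i \<cdot> e \<cdot> q))"
      by simp
    also have "\<dots> = (j \<cdot> q \<oplus> i \<cdot> e \<cdot> q) \<oplus> (Zero C S S \<oplus> (i \<cdot> p \<oplus> \<ominus> (i \<cdot> e \<cdot> q)))"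
      using add_commute[of "i \<cdot> e \<cdot> q" "j \<cdot> q"] by simp
    also have "\<dots> = (j \<cdot> q \<oplus> Zero C S S) \<oplus> i \<cdot> p"
      by (rule add_swap_cancel) simp_all
    also have "\<dots> = i \<cdot> p \<oplus> j \<cdot> q"
      using add_commute[of "i \<cdot> p" "j \<cdot> q"] by simp
    also note D(20)
    finally show "(i \<cdot> e \<oplus> j \<cdot> Ident C P) \<cdot> q \<oplus> i \<cdot> (Ident C X \<cdot> p \<oplus> \<ominus> (e \<cdot> q))
        = Ident C (Cod C (i \<cdot> e \<oplus> j \<cdot> Ident C P))" by simp
  qed simp_all
qed

end

sublocale ncomplex_category \<subseteq> F: frobenius "C_cat C N" "conflations C N" "null_homotopic C N"
  by (rule frobenius_CC)

context ncomplex_category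
begin

lemmas CC_alg = CC.alg[unfolded CC_simps(1-4)]

lemma homotopy_eq: "homotopy C N = F.hrel"
  unfolding homotopy_def F.hrel_def CC_simps ..

lemma K_cat_eq: "K_cat C N = F.K"
  by (simp add: K_cat_def homotopy_eq)

text \<open>The condition holds on the nose here, and \<open>F_subcat\<close> is the isomorphism
  closure. Reindexing lands in this strict class and fixes its members as complexes, so equalities
  can replace isomorphisms.\<close>

definition strict_F :: "int \<Rightarrow> nat \<Rightarrow> ('o, 'm) ncomplex set" where
  "strict_F s r = {X \<in> ncomplexes C N. \<forall>i. [i = s] (mod int N) \<longrightarrow>
    (\<forall>k<r. diff X (i + int k) = Ident C (deg X (i + int k)))}"

lemma F_subcat_eq: "F_subcat C N s r = F.iso_closure (strict_F s r)"
  unfolding F_subcat_def F.iso_closure_def strict_F_def K_cat_eq F.Obj_K F.isomorphic_K CC_simps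
  by blast

lemma strict_F_iff:
  "X \<in> strict_F s r \<longleftrightarrow> X \<in> ncomplexes C N \<and>
    (\<forall>q j. 0 \<le> j \<and> j < int r \<longrightarrow> diff X (s + int N * q + j) = Ident C (deg X (s + int N * q + j)))"
proof -
  have cong: "[i = s] (mod int N) \<longleftrightarrow> (\<exists>q. i = s + int N * q)" for i
    by (metis cong_iff_lin cong_sym_eq mult.commute)
  have bnd: "(\<forall>k<r. P (int k)) \<longleftrightarrow> (\<forall>j. 0 \<le> j \<and> j < int r \<longrightarrow> P j)" for P
    by (metis nonneg_int_cases of_nat_0_le_iff of_nat_less_iff)
  have "(\<forall>k<r. diff X (i + int k) = Ident C (deg X (i + int k))) \<longleftrightarrow>
      (\<forall>j. 0 \<le> j \<and> j < int r \<longrightarrow> diff X (i + j) = Ident C (deg X (i + j)))" for i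
    by (rule bnd)
  then show ?thesis unfolding strict_F_def mem_Collect_eq cong by blast
qed

lemma dd_ident:
  assumes X: "X \<in> ncomplexes C N" and "a \<le> b"
    and "\<And>j. a \<le> j \<Longrightarrow> j < b \<Longrightarrow> diff X j = Ident C (deg X j)"
  shows "dd X a b = Ident C (deg X a)"
  using \<open>a \<le> b\<close> assms(3)
proof (induction b rule: int_ge_induct)
  case (step b)
  have "dd X a b = Ident C (deg X a)" by (rule step(2)) (use step(3) in auto)
  moreover from this have "deg X b = deg X a"
    using dd_arr(3)[OF X step(1)] ncomplexD(1)[OF X] by (simp add: ident_arr)
  ultimately show ?case
    using dd_comp[OF X, of a b "b + 1"] step(1) step(3)[of b] ncomplexD(1)[OF X, of a]
    by (simp add: dd_step[OF X] comp_ident ident_arr)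
qed (simp add: dd_self)

lemma dd_ident_deg:
  assumes "X \<in> ncomplexes C N" "a \<le> b" "dd X a b = Ident C (deg X a)"
  shows "deg X b = deg X a"
  using dd_arr(3)[OF assms(1,2)] ncomplexD(1)[OF assms(1)] assms(3) by (simp add: ident_arr)

text \<open>The result is an equality of complexes: a composite differential that equals an identity
  arrow forces its source and target objects to coincide.\<close>

lemma reindex_fix_above:
  assumes X: "X \<in> ncomplexes C N" and \<phi>: "shift_map \<phi>" and le: "\<And>i. i \<le> \<phi> i"
    and ident: "\<And>i. dd X i (\<phi> i) = Ident C (deg X i)"
  shows "reindex \<phi> X = X"
proof -
  have deg: "deg X (\<phi> i) = deg X i" for i by (rule dd_ident_deg[OF X le ident])
  have "dd X (\<phi> i) (\<phi> (i + 1)) = diff X i" for i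
    using dd_comp[OF X le[of i] shift_mapD(2)[OF \<phi>, of i]] dd_comp[OF X, of i "i + 1" "\<phi> (i + 1)"]
      le[of "i + 1"] shift_mapD(2)[OF \<phi>, of i] ncomplexD[OF X, of i]
    by (simp add: ident deg dd_step[OF X] comp_ident ident_comp dd_arr[OF X])
  then show ?thesis by (intro ncomplex.equality) (auto simp: deg reindex_def)
qed

lemma reindex_fix_below:
  assumes X: "X \<in> ncomplexes C N" and \<phi>: "shift_map \<phi>" and le: "\<And>i. \<phi> i \<le> i"
    and ident: "\<And>i. dd X (\<phi> i) i = Ident C (deg X (\<phi> i))"
  shows "reindex \<phi> X = X"
proof -
  have deg: "deg X (\<phi> i) = deg X i" for i by (rule dd_ident_deg[OF X le ident, symmetric])
  have "dd X (\<phi> i) (\<phi> (i + 1)) = diff X i" for i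
    using dd_comp[OF X shift_mapD(2)[OF \<phi>, of i] le[of "i + 1"]] dd_comp[OF X le[of i], of "i + 1"]
      le[of "i + 1"] shift_mapD(2)[OF \<phi>, of i] ncomplexD[OF X, of i]
    by (simp add: ident deg dd_step[OF X] comp_ident ident_comp dd_arr[OF X])
  then show ?thesis by (intro ncomplex.equality) (auto simp: deg reindex_def)
qed

text \<open>Of a reindexed conflation, one end is \<open>X\<close> by \<open>fix'\<close> and the
  other lies in \<open>S\<close> by \<open>into\<close>. Starting from a projective cover instead of
  an injective hull produces the desuspension.\<close>

lemma shift_stable_reindex:
  assumes S: "S \<subseteq> ncomplexes C N" and \<phi>: "shift_map \<phi>"
    and into: "\<And>X. X \<in> ncomplexes C N \<Longrightarrow> reindex \<phi> X \<in> S"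
    and fix': "\<And>X. X \<in> S \<Longrightarrow> reindex \<phi> X = X"
  shows "F.shift_stable S"
proof -
  have inj: "F.inj_confl (reindex_map \<phi> i) (reindex_map \<phi> p)"
    if ip: "(i, p) \<in> conflations C N" "Null (Ident CC (target i))" for i p
    using reindex_conflation[OF ip(1) \<phi>] ip(2) chain_mapD(2)[OF conflationD(1)[OF ip(1)]]
      reindex_null[OF ident_chain_map _ \<phi>, of "target i"]
    by (simp add: F.inj_confl_def reindex_ident)
  show ?thesis unfolding F.shift_stable_def CC_simps
  proof (intro conjI ballI)
    fix X assume X: "X \<in> S"
    obtain i p where ip: "(i, p) \<in> conflations C N" "source i = X" "Null (Ident CC (target i))"
      using enough_injectives X S by blast
    show "\<exists>i p. F.inj_confl i p \<and> source i = X \<and> target p \<in> S"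
      by (rule exI[of _ "reindex_map \<phi> i"], rule exI[of _ "reindex_map \<phi> p"])
        (use inj[OF ip(1,3)] ip(2) fix'[OF X] into chain_mapD(2)[OF conflationD(2)[OF ip(1)]] in simp)
  next
    fix X assume X: "X \<in> S"
    obtain i p where ip: "(i, p) \<in> conflations C N" "target p = X" "Null (Ident CC (target i))"
      using enough_projectives X S by blast
    show "\<exists>i p. F.inj_confl i p \<and> target p = X \<and> source i \<in> S"
      by (rule exI[of _ "reindex_map \<phi> i"], rule exI[of _ "reindex_map \<phi> p"])
        (use inj[OF ip(1,3)] ip(2) fix'[OF X] into chain_mapD(1)[OF conflationD(1)[OF ip(1)]] in simp)
  qed (rule S)
qed

text \<open>Reindexing descends to homotopy classes; this is what later transports a homotopy
  inverse along \<open>low\<close>.\<close>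

lemma reindex_sim:
  assumes "(f, g) \<in> F.hrel" "shift_map \<phi>"
  shows "(reindex_map \<phi> f, reindex_map \<phi> g) \<in> F.hrel"
proof -
  have fg: "f \<in> chain_maps C N" "g \<in> chain_maps C N" "source g = source f" "target g = target f"
    "Null (Add CC f (CC.neg g))"
    using assms(1) by (simp_all add: F.sim_iff)
  have "Add CC f (CC.neg g) \<in> chain_maps C N"
    using CC.add_arr(1)[of f "CC.neg g"] CC.neg_arr[of g] fg by simp
  from reindex_null[OF this fg(5) assms(2)] show ?thesis
    using fg reindex_chain_map[OF _ assms(2)] reindex_diff[OF fg(1,2) assms(2) fg(3,4)]
    by (simp add: F.sim_iff)
qed

text \<open>
  Fix \<open>s\<close> and \<open>r < N\<close>. Composing a complex with \<open>low\<close> makes it constant from \<open>s + r\<close> to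
  \<open>s + N - 1\<close>, composing it with \<open>high\<close> makes it constant from \<open>s\<close> to \<open>s + r\<close>, both modulo \<open>N\<close>.
\<close>

context
  fixes s :: int and r :: nat
  assumes r: "r < N"
begin

abbreviation mid where "mid \<equiv> step_map s (s + int r)"

definition low where "low i = min i (mid i)"

definition high where "high i = max i (mid i)"

lemma mid_value: "0 \<le> j \<Longrightarrow> j < int N \<Longrightarrow> mid (s + int N * q + j) = s + int N * q + int r"
  using div_unique[of q "s + int N * q + j - s"] by (simp add: step_map_def)

lemma block_cases:
  obtains q j where "0 \<le> j" "j < int N" "i = s + int N * q + j"
  using div_bounds[of "i - s"]
  by (intro that[of "i - s - int N * ((i - s) div int N)" "(i - s) div int N"]) auto

lemma shift_low: "shift_map low" and shift_high: "shift_map high"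
proof -
  note M = shift_mapD[OF shift_map_step[of s "s + int r"]]
  have "low x \<le> low y" "high x \<le> high y" if "x \<le> y" for x y
    unfolding low_def high_def by (rule min.mono max.mono; rule that M(1)[OF that])+
  moreover have "low (i + int N) = low i + int N" "high (i + int N) = high i + int N" for i
    by (simp_all add: low_def high_def M(3) min_add_distrib_left max_add_distrib_left)
  ultimately show "shift_map low" "shift_map high" by (simp_all add: shift_map_def mono_def)
qed

text \<open>Because \<open>r < N\<close>, the value \<open>s + N q + r\<close> of \<open>mid\<close>
  lies in the block on which it is attained, so \<open>mid\<close> fixes its own values.\<close>

lemma low_low: "low (low i) = low i"
proof -
  obtain q j where "0 \<le> j" "j < int N" "i = s + int N * q + j" by (rule block_cases)
  then have "mid (mid i) = mid i" using r by (simp add: mid_value)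
  then show ?thesis by (simp add: low_def min_def)
qed

lemma high_value: "0 \<le> j \<Longrightarrow> j \<le> int r \<Longrightarrow> high (s + int N * q + j) = s + int N * q + int r"
  using r by (simp add: high_def mid_value)

lemma low_value: "int r \<le> j \<Longrightarrow> j < int N \<Longrightarrow> low (s + int N * q + j) = s + int N * q + int r"
  using r by (simp add: low_def mid_value)

lemma reindex_high: "X \<in> ncomplexes C N \<Longrightarrow> reindex high X \<in> strict_F s r"
  unfolding strict_F_iff using high_value
  by (auto simp: reindex_ncomplex shift_high dd_self add.assoc)

text \<open>\<open>low\<close> is constant on the \<open>N - r\<close> degrees from
  \<open>s + r\<close> to \<open>s + N - 1\<close>; between them lie \<open>N - 1 - r\<close>
  differentials, whence the exponent.\<close>

lemma reindex_low: "X \<in> ncomplexes C N \<Longrightarrow> reindex low X \<in> strict_F (s + int r) (N - 1 - r)"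
  unfolding strict_F_iff
proof (intro conjI allI impI)
  fix q j assume X: "X \<in> ncomplexes C N" and "0 \<le> j \<and> j < int (N - 1 - r)"
  then have "low (s + int N * q + (int r + j)) = s + int N * q + int r"
    "low (s + int N * q + (int r + j + 1)) = s + int N * q + int r"
    using r by (auto intro!: low_value)
  then show "diff (reindex low X) (s + int r + int N * q + j)
      = Ident C (deg (reindex low X) (s + int r + int N * q + j))"
    by (simp add: dd_self algebra_simps)
qed (simp add: reindex_ncomplex shift_low)

lemma dd_high:
  assumes X: "X \<in> strict_F s r"
  shows "dd X i (high i) = Ident C (deg X i)"
proof -
  obtain q j where j: "0 \<le> j" "j < int N" "i = s + int N * q + j" by (rule block_cases)
  show ?thesis
  proof (cases "j \<le> int r")
    case True
    show ?thesis
    proof (rule dd_ident)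
      fix k assume k: "i \<le> k" "k < high i"
      then have "diff X (s + int N * q + (k - s - int N * q)) = Ident C (deg X (s + int N * q + (k - s - int N * q)))"
        using X j True high_value[of j q] by (intro strict_F_iff[THEN iffD1, THEN conjunct2, rule_format]) auto
      then show "diff X k = Ident C (deg X k)" by simp
    qed (use X in \<open>simp_all add: strict_F_iff high_def\<close>)
  next
    case False
    then have "high i = i" using j by (simp add: high_def mid_value)
    then show ?thesis by (simp add: dd_self)
  qed
qed

lemma dd_low:
  assumes X: "X \<in> strict_F (s + int r) (N - 1 - r)"
  shows "dd X (low i) i = Ident C (deg X (low i))"
proof -
  obtain q j where j: "0 \<le> j" "j < int N" "i = s + int N * q + j" by (rule block_cases)
  show ?thesis
  proof (cases "int r \<le> j")
    case True
    show ?thesis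
    proof (rule dd_ident)
      fix k assume k: "low i \<le> k" "k < i"
      let ?k = "k - (s + int r) - int N * q"
      have "diff X (s + int r + int N * q + ?k) = Ident C (deg X (s + int r + int N * q + ?k))"
        using X j True low_value[of j q] k r
        by (intro strict_F_iff[THEN iffD1, THEN conjunct2, rule_format]) auto
      then show "diff X k = Ident C (deg X k)" by simp
    qed (use X in \<open>simp_all add: strict_F_iff low_def\<close>)
  next
    case False
    then have "low i = i" using j by (simp add: low_def mid_value)
    then show ?thesis by (simp add: dd_self)
  qed
qed

lemma reindex_high_fix: "X \<in> strict_F s r \<Longrightarrow> reindex high X = X"
  by (rule reindex_fix_above[OF _ shift_high]) (simp_all add: dd_high, simp_all add: strict_F_iff high_def)

lemma reindex_low_fix: "X \<in> strict_F (s + int r) (N - 1 - r) \<Longrightarrow> reindex low X = X"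
  by (rule reindex_fix_below[OF _ shift_low]) (simp_all add: dd_low, simp_all add: strict_F_iff low_def)

lemma shift_stable_strict_F: "F.shift_stable (strict_F s r)"
  by (rule shift_stable_reindex[OF _ shift_high reindex_high reindex_high_fix])
    (auto simp: strict_F_iff)

text \<open>The middle factor is \<open>reindex_map mid f\<close>. In degrees
  \<open>i \<le> mid i\<close> the complex \<open>Y\<close> is constant from \<open>i\<close> to
  \<open>mid i\<close>, elsewhere \<open>X\<close> is constant from \<open>mid i\<close> to
  \<open>i\<close>; in both cases naturality of \<open>f\<close> identifies the composite with
  \<open>f\<close>.\<close>

lemma hom_null:
  assumes X: "X \<in> strict_F (s + int r) (N - 1 - r)" and Y: "Y \<in> strict_F s r"
    and f: "f \<in> Homs CC X Y"
  shows "Null f"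
proof -
  have XN: "X \<in> ncomplexes C N" and YN: "Y \<in> ncomplexes C N" using X Y by (simp_all add: strict_F_iff)
  have fm: "f \<in> chain_maps C N" "source f = X" "target f = Y" using f by (auto simp: Homs_CC)
  note mid = shift_map_step[of s "s + int r"]
  let ?a = "transition X low mid" and ?b = "transition Y mid high" and ?g = "reindex_map mid f"
  have a: "?a \<in> chain_maps C N"
    by (rule transition_chain_map[OF XN shift_low mid]) (simp add: low_def)
  have b: "?b \<in> chain_maps C N"
    by (rule transition_chain_map[OF YN mid shift_high]) (simp add: high_def)
  have g: "?g \<in> chain_maps C N" by (rule reindex_chain_map[OF fm(1) mid])
  have "f = ?b \<cdot>\<^bsub>CC\<^esub> (?g \<cdot>\<^bsub>CC\<^esub> ?a)"
  proof (rule chain_map_eqI)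
    fix i
    note D = chain_mapD(3-5)[OF fm(1), unfolded fm(2,3)]
    show "component f i = component (?b \<cdot>\<^bsub>CC\<^esub> (?g \<cdot>\<^bsub>CC\<^esub> ?a)) i"
    proof (cases "i \<le> mid i")
      case True
      then have "low i = i" "high i = mid i" by (simp_all add: low_def high_def)
      moreover have "component f (mid i) \<cdot> dd X i (mid i) = dd Y i (mid i) \<cdot> component f i"
        using chain_map_dd[OF fm(1) True] fm by simp
      moreover have "dd Y i (mid i) = Ident C (deg Y i)" "deg Y (mid i) = deg Y i"
        using dd_high[OF Y, of i] dd_ident_deg[OF YN True] \<open>high i = mid i\<close> by simp_all
      ultimately show ?thesis using D by (simp add: dd_self ident_comp)
    next
      case False
      then have "low i = mid i" "high i = i" by (simp_all add: low_def high_def)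
      moreover have "component f i \<cdot> dd X (mid i) i = dd Y (mid i) i \<cdot> component f (mid i)"
        using chain_map_dd[OF fm(1), of "mid i" i] fm False by simp
      moreover have "dd X (mid i) i = Ident C (deg X (mid i))" "deg X i = deg X (mid i)"
        using dd_low[OF X, of i] dd_ident_deg[OF XN, of "mid i" i] \<open>low i = mid i\<close> False by simp_all
      ultimately show ?thesis using D by (simp add: dd_self comp_ident)
    qed
  qed (simp_all add: fm reindex_low_fix[OF X] reindex_high_fix[OF Y])
  moreover have "Null ?g"
  proof -
    have "Null (?g \<cdot>\<^bsub>CC\<^esub> Ident CC (reindex mid X))"
      by (rule null_comp) (simp_all add: ident_chain_map reindex_ncomplex XN mid reindex_step_null g fm)
    then show ?thesis using g fm by (simp add: CC.comp_ident)
  qed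
  then have "Null (?b \<cdot>\<^bsub>CC\<^esub> (?g \<cdot>\<^bsub>CC\<^esub> ?a))"
    using a b g fm by (intro null_comp comp_null) (simp_all add: comp_chain_map)
  ultimately show ?thesis by simp
qed

text \<open>
  The square with corners \<open>X \<circ> low\<close>, \<open>X\<close>, \<open>X \<circ> mid\<close>, \<open>X \<circ> high\<close> is bicartesian, because in each
  degree two parallel sides are identities; its corner \<open>X \<circ> mid\<close> is contractible.
\<close>

lemma truncation_conflation:
  assumes X: "X \<in> ncomplexes C N"
  shows "\<exists>S i j p q a b. CC.biprod X (reindex mid X) S i j p q \<and> (a, b) \<in> conflations C N \<and>
    source a = reindex low X \<and> target a = S \<and> target b = reindex high X \<and>
    p \<cdot>\<^bsub>CC\<^esub> a = transition X low (\<lambda>i. i) \<and>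
    b = Add CC (transition X (\<lambda>i. i) high \<cdot>\<^bsub>CC\<^esub> p) (CC.neg (transition X mid high \<cdot>\<^bsub>CC\<^esub> q))"
proof -
  note mid = shift_map_step[of s "s + int r"]
  have P: "reindex mid X \<in> ncomplexes C N" by (rule reindex_ncomplex[OF X mid])
  obtain S i j p q where S: "CC.biprod X (reindex mid X) S i j p q"
    and bp: "\<And>k. biprod (deg X k) (deg X (mid k)) (deg S k)
      (component i k) (component j k) (component p k) (component q k)"
    using CC_biprod_exists[OF X P] by auto
  note D = CC.biprodD[OF S, unfolded CC_simps]
  let ?li = "transition X low (\<lambda>i. i)" and ?lm = "transition X low mid"
  let ?ih = "transition X (\<lambda>i. i) high" and ?mh = "transition X mid high"
  have t: "?li \<in> chain_maps C N" "?lm \<in> chain_maps C N" "?ih \<in> chain_maps C N" "?mh \<in> chain_maps C N"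
    using transition_chain_map[OF X shift_low shift_map_id] transition_chain_map[OF X shift_low mid]
      transition_chain_map[OF X shift_map_id shift_high] transition_chain_map[OF X mid shift_high]
    by (simp_all add: low_def high_def)
  have id: "reindex (\<lambda>i. i) X = X" by (rule reindex_id[OF X])
  note ty = D(1-12) t id
  define a where "a = Add CC (i \<cdot>\<^bsub>CC\<^esub> ?li) (j \<cdot>\<^bsub>CC\<^esub> ?lm)"
  define b where "b = Add CC (?ih \<cdot>\<^bsub>CC\<^esub> p) (CC.neg (?mh \<cdot>\<^bsub>CC\<^esub> q))"
  have am: "a \<in> chain_maps C N"
    unfolding a_def by (simp add: add_chain_map comp_chain_map ty)
  have mq: "?mh \<cdot>\<^bsub>CC\<^esub> q \<in> chain_maps C N" by (simp add: comp_chain_map ty)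
  have bm: "b \<in> chain_maps C N"
    unfolding b_def using CC.neg_arr[of "?mh \<cdot>\<^bsub>CC\<^esub> q"] mq by (simp add: add_chain_map comp_chain_map ty)
  have ends: "source a = reindex low X" "target a = S" "source b = S" "target b = reindex high X"
    by (simp_all add: a_def b_def ty)
  have "split_short_exact C (component a k) (component b k)" for k
  proof -
    have ak: "component a k = component i k \<cdot> dd X (low k) k \<oplus> component j k \<cdot> dd X (low k) (mid k)"
      by (simp add: a_def)
    have bk: "component b k = dd X k (high k) \<cdot> component p k
        \<oplus> \<ominus> (dd X (mid k) (high k) \<cdot> component q k)"
      by (simp add: b_def neg_CC[OF mq])
    show ?thesis
    proof (cases "k \<le> mid k")
      case True
      then have "low k = k" "high k = mid k" by (simp_all add: low_def high_def)
      moreover have "dd X k (mid k) \<in> Homs C (deg X k) (deg X (mid k))"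
        using True by (simp add: in_Homs dd_arr[OF X])
      ultimately show ?thesis unfolding ak bk
        using split_square_left[OF bp] by (simp add: dd_self)
    next
      case False
      then have "low k = mid k" "high k = k" by (simp_all add: low_def high_def)
      moreover have "dd X (mid k) k \<in> Homs C (deg X (mid k)) (deg X k)"
        using False by (simp add: in_Homs dd_arr[OF X])
      ultimately show ?thesis unfolding ak bk
        using split_square_right[OF bp] by (simp add: dd_self)
    qed
  qed
  then have confl: "(a, b) \<in> conflations C N"
    using am bm ends by (simp add: conflations_def)
  have "p \<cdot>\<^bsub>CC\<^esub> a = Add CC ((p \<cdot>\<^bsub>CC\<^esub> i) \<cdot>\<^bsub>CC\<^esub> ?li) ((p \<cdot>\<^bsub>CC\<^esub> j) \<cdot>\<^bsub>CC\<^esub> ?lm)"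
    unfolding a_def by (simp add: CC.comp_add CC.comp_assoc comp_chain_map ty)
  also have "\<dots> = ?li"
    unfolding D(16,18)
    by (simp add: CC.ident_comp CC.zero_comp CC.zero_add ty X)
  finally show ?thesis using S confl ends b_def by blast
qed

text \<open>One inclusion is \<open>hom_null\<close>. For the other, \<open>b\<close> is null: its
  component on \<open>X\<close> is a map into \<open>strict_F s r\<close>, and its component on
  \<open>reindex mid X\<close> starts at a contractible complex. This splits the truncation
  conflation up to homotopy and makes \<open>?t\<close> a homotopy equivalence.\<close>

lemma left_perp_strict_F: "F.iso_closure (strict_F (s + int r) (N - 1 - r)) = F.left_perp (strict_F s r)"
proof (intro equalityI subsetI)
  fix X assume "X \<in> F.iso_closure (strict_F (s + int r) (N - 1 - r))"
  then obtain Y where Y: "Y \<in> strict_F (s + int r) (N - 1 - r)" "F.siso X Y" "X \<in> ncomplexes C N"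
    by (auto simp: F.iso_closure_def)
  then have "Y \<in> F.left_perp (strict_F s r)"
    using hom_null[OF Y(1)] by (auto simp: F.left_perp_def strict_F_iff)
  then show "X \<in> F.left_perp (strict_F s r)" using F.left_perp_iso Y(2) by blast
next
  fix X assume "X \<in> F.left_perp (strict_F s r)"
  then have X: "X \<in> ncomplexes C N"
    and perp: "\<And>V f. V \<in> strict_F s r \<Longrightarrow> f \<in> Homs CC X V \<Longrightarrow> Null f"
    by (auto simp: F.left_perp_def)
  note mid = shift_map_step[of s "s + int r"]
  let ?U = "reindex low X" and ?t = "transition X low (\<lambda>i. i)"
  obtain S i j p q a b where S: "CC.biprod X (reindex mid X) S i j p q"
    and ab: "(a, b) \<in> conflations C N" "source a = ?U" "target a = S" "target b = reindex high X"
    and pa: "p \<cdot>\<^bsub>CC\<^esub> a = ?t"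
    and b: "b = Add CC (transition X (\<lambda>i. i) high \<cdot>\<^bsub>CC\<^esub> p) (CC.neg (transition X mid high \<cdot>\<^bsub>CC\<^esub> q))"
    using truncation_conflation[OF X] by blast
  note D = CC.biprodD[OF S, unfolded CC_simps]
  note id = reindex_id[OF X]
  have t: "?t \<in> chain_maps C N"
    by (rule transition_chain_map[OF X shift_low shift_map_id]) (simp add: low_def)
  have ih: "transition X (\<lambda>i. i) high \<in> chain_maps C N"
    by (rule transition_chain_map[OF X shift_map_id shift_high]) (simp add: high_def)
  have mh: "transition X mid high \<in> chain_maps C N"
    by (rule transition_chain_map[OF X mid shift_high]) (simp add: high_def)
  have "Null (transition X (\<lambda>i. i) high)"
    by (rule perp[OF reindex_high[OF X]]) (simp add: Homs_CC ih id)
  then have n1: "Null (transition X (\<lambda>i. i) high \<cdot>\<^bsub>CC\<^esub> p)"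
    using D(7-9) ih id by (intro comp_null) simp_all
  have "Null (transition X mid high)"
    by (rule F.null_from_injective[of "reindex mid X" _ "reindex high X"])
      (simp_all add: reindex_ncomplex[OF X mid] reindex_step_null[OF X] Homs_CC mh)
  then have "Null (transition X mid high \<cdot>\<^bsub>CC\<^esub> q)"
    using D(10-12) mh by (intro comp_null) simp_all
  then have n2: "Null (CC.neg (transition X mid high \<cdot>\<^bsub>CC\<^esub> q))"
    using D(10-12) mh by (intro null_neg comp_chain_map) simp_all
  have mq: "transition X mid high \<cdot>\<^bsub>CC\<^esub> q \<in> chain_maps C N" "transition X (\<lambda>i. i) high \<cdot>\<^bsub>CC\<^esub> p \<in> chain_maps C N"
    using D ih mh id by (simp_all add: comp_chain_map)
  have bN: "Null b" unfolding b
    by (rule null_add[OF mq(2) n1 _ n2]) (use CC.neg_arr[of "transition X mid high \<cdot>\<^bsub>CC\<^esub> q"] mq D in simp_all)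
  have abm: "a \<in> chain_maps C N" "b \<in> chain_maps C N" "source b = S"
    using conflationD[OF ab(1)] ab(3) by auto
  \<comment> \<open>The null map \<open>b\<close> is lifted along itself to a null endomorphism
    \<open>e\<close>. Then the identity minus \<open>e\<close> is killed by \<open>b\<close>, so it
    factors through \<open>a\<close>; this provides the inverse of \<open>?t\<close> on one
    side.\<close>
  obtain e where e: "e \<in> chain_maps C N" "source e = S" "target e = S" "Null e" "b \<cdot>\<^bsub>CC\<^esub> e = b"
    using F.null_lift[OF bN ab(1), of S] abm ab by (auto simp: Homs_CC)
  let ?d = "Add CC (Ident CC S) (CC.neg e)"
  have d: "?d \<in> chain_maps C N" "source ?d = S" "target ?d = S"
    using CC.neg_arr[of e] CC.add_arr[of "Ident CC S" "CC.neg e"] e D(15)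
    by (simp_all add: ident_chain_map)
  have "b \<cdot>\<^bsub>CC\<^esub> ?d = Zero CC S (target b)"
    using e abm D(15) ident_chain_map[OF D(15)] by (simp add: CC_alg)
  then obtain m where m: "m \<in> chain_maps C N" "source m = S" "target m = ?U" "a \<cdot>\<^bsub>CC\<^esub> m = ?d"
    using conflation_ker[OF ab(1) d(1)] d ab by (auto simp: Homs_CC)
  let ?k = "m \<cdot>\<^bsub>CC\<^esub> i"
  have k: "?k \<in> chain_maps C N" "source ?k = X" "target ?k = ?U"
    using m D by (simp_all add: comp_chain_map)
  have "?t \<cdot>\<^bsub>CC\<^esub> ?k = p \<cdot>\<^bsub>CC\<^esub> ((a \<cdot>\<^bsub>CC\<^esub> m) \<cdot>\<^bsub>CC\<^esub> i)"
    unfolding pa[symmetric] using m(1-3) abm ab D(1-15) by (simp add: CC.comp_assoc comp_chain_map)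
  also have "\<dots> = Add CC (p \<cdot>\<^bsub>CC\<^esub> i) (CC.neg (p \<cdot>\<^bsub>CC\<^esub> (e \<cdot>\<^bsub>CC\<^esub> i)))"
    unfolding m(4) using e(1-3) D(1-15) ident_chain_map[OF D(15)] by (simp add: CC_alg)
  finally have tk: "?t \<cdot>\<^bsub>CC\<^esub> ?k = Add CC (Ident CC X) (CC.neg (p \<cdot>\<^bsub>CC\<^esub> (e \<cdot>\<^bsub>CC\<^esub> i)))"
    unfolding D(16) .
  have pei: "p \<cdot>\<^bsub>CC\<^esub> (e \<cdot>\<^bsub>CC\<^esub> i) \<in> chain_maps C N" "Null (p \<cdot>\<^bsub>CC\<^esub> (e \<cdot>\<^bsub>CC\<^esub> i))"
    using e(1-4) D(1-15) null_comp[of "e \<cdot>\<^bsub>CC\<^esub> i" p] comp_null[of i e] by (simp_all add: comp_chain_map)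
  have "(Ident CC X, ?t \<cdot>\<^bsub>CC\<^esub> ?k) \<in> F.hrel"
  proof -
    have "Add CC (Ident CC X) (CC.neg (?t \<cdot>\<^bsub>CC\<^esub> ?k)) = p \<cdot>\<^bsub>CC\<^esub> (e \<cdot>\<^bsub>CC\<^esub> i)"
      unfolding tk using pei(1) e(1-3) D(1-15) ident_chain_map[OF X] by (simp add: CC_alg)
    then show ?thesis
      using pei(2) k t X id by (simp add: F.sim_iff ident_chain_map comp_chain_map)
  qed
  then have tk1: "(?t \<cdot>\<^bsub>CC\<^esub> ?k, Ident CC X) \<in> F.hrel" by (rule F.sim_sym)
  have le: "low n \<le> n" for n by (simp add: low_def)
  have UU: "reindex low ?U = ?U"
    by (rule reindex_fix_below[OF reindex_ncomplex[OF X shift_low] shift_low le])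
      (simp add: dd_reindex[OF X shift_low le] low_low dd_self)
  \<comment> \<open>The other composite: \<open>?U\<close> is constant from \<open>low n\<close> to
    \<open>n\<close>, so precomposing \<open>?k\<close> with \<open>?t\<close> is reindexing by
    \<open>low\<close>. The same reindexing turns \<open>?t\<close> into an identity, so the
    composite is also the reindexing of \<open>?t\<close> after \<open>?k\<close>, and homotopies
    survive reindexing.\<close>
  have "?k \<cdot>\<^bsub>CC\<^esub> ?t = reindex_map low ?k"
  proof (rule chain_map_eqI)
    fix n
    have "component ?k n \<cdot> dd X (low n) n = dd ?U (low n) n \<cdot> component ?k (low n)"
      using chain_map_dd[OF k(1) le[of n]] k by simp
    also have "dd ?U (low n) n = Ident C (deg X (low n))"
      by (simp add: dd_reindex[OF X shift_low le] low_low dd_self)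
    also have "\<dots> \<cdot> component ?k (low n) = component ?k (low n)"
      using chain_mapD(3-5)[OF k(1)] k(2,3) by (intro ident_comp) (simp_all add: low_low)
    finally show "component (?k \<cdot>\<^bsub>CC\<^esub> ?t) n = component (reindex_map low ?k) n" by simp
  qed (use k UU in simp_all)
  also have "\<dots> = reindex_map low (?t \<cdot>\<^bsub>CC\<^esub> ?k)"
  proof (rule chain_map_eqI)
    fix n
    show "component (reindex_map low ?k) n = component (reindex_map low (?t \<cdot>\<^bsub>CC\<^esub> ?k)) n"
      using chain_mapD(3-5)[OF k(1), of "low n"] k(2,3)
      by (simp add: low_low dd_self ident_comp)
  qed (use k UU id in simp_all)
  also have "(\<dots>, Ident CC ?U) \<in> F.hrel"
    using reindex_sim[OF tk1 shift_low] unfolding reindex_ident .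
  finally have kt1: "(?k \<cdot>\<^bsub>CC\<^esub> ?t, Ident CC ?U) \<in> F.hrel" .
  have "F.siso X ?U"
    by (rule F.sisoI[OF _ _ tk1 kt1]) (use k t id in \<open>simp_all add: Homs_CC\<close>)
  then show "X \<in> F.iso_closure (strict_F (s + int r) (N - 1 - r))"
    using reindex_low[OF X] X by (auto simp: F.iso_closure_def)
qed

end

section \<open>The stable t-structures and the polygon\<close>

lemma stable_t_structure_F:
  assumes "r < N"
  shows "stable_t_structure (K_cat C N) (F_subcat C N (s + int r) (N - 1 - r)) (F_subcat C N s r)"
  unfolding F_subcat_eq K_cat_eq
proof (rule F.stable_t_structureI)
  show "F.shift_stable (strict_F (s + int r) (N - 1 - r))" "F.shift_stable (strict_F s r)"
    using assms by (simp_all add: shift_stable_strict_F)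
  show "Null f" if "X \<in> strict_F (s + int r) (N - 1 - r)" "Y \<in> strict_F s r" "f \<in> Homs CC X Y" for X Y f
    by (rule hom_null[OF assms that])
  fix X assume "X \<in> Obj CC"
  then have X: "X \<in> ncomplexes C N" by simp
  obtain S i j p q a b where S: "CC.biprod X (reindex (step_map s (s + int r)) X) S i j p q"
    and ab: "(a, b) \<in> conflations C N" "source a = reindex (low s r) X" "target a = S"
      "target b = reindex (high s r) X"
    using truncation_conflation[OF assms X] by blast
  have "F.siso X S" by (rule F.siso_biprod[OF S reindex_step_null[OF X]])
  then show "\<exists>i p. (i, p) \<in> conflations C N \<and> Dom CC i \<in> strict_F (s + int r) (N - 1 - r) \<and>
      Cod CC p \<in> strict_F s r \<and> F.siso X (Cod CC i)"
    using ab reindex_low[OF assms X] reindex_high[OF assms X]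
    by (intro exI[of _ a] exI) auto
qed

text \<open>Replacing \<open>r\<close> by \<open>N - 1 - r\<close> and moving the base point down by
  the same amount makes the given subcategory the left member of a pair, where the orthogonal
  description is available.\<close>

lemma triangulated_F:
  assumes "r < N"
  shows "triangulated_subcat (K_cat C N) (F_subcat C N s r)"
proof -
  let ?r = "N - 1 - r" and ?s = "s - int (N - 1 - r)"
  have r: "?r < N" and eq: "?s + int ?r = s" "N - 1 - ?r = r" using assms by auto
  obtain Z where Z: "zero_object C Z" using has_zero_object by blast
  note Z' = zero_complex[OF Z]
  have "\<lparr>deg = \<lambda>i. Z, diff = \<lambda>i. Ident C Z\<rparr> \<in> strict_F s r"
    using Z' by (auto simp: strict_F_iff zero_object_def)
  then show ?thesis
    unfolding F_subcat_eq K_cat_eq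
    using F.triangulated_subcatI[OF shift_stable_strict_F[OF assms] shift_stable_strict_F[OF r, of ?s]
        left_perp_strict_F[OF r, of ?s, unfolded eq] Z'] by blast
qed

end

lemma length_concat_pairs: "length (concat (map (\<lambda>r. [f r, g r]) [0..<n])) = 2 * n"
  by (induction n) simp_all

lemma nth_concat_pairs:
  "k < n \<Longrightarrow> concat (map (\<lambda>r. [f r, g r]) [0..<n]) ! (2 * k) = f k"
  "k < n \<Longrightarrow> concat (map (\<lambda>r. [f r, g r]) [0..<n]) ! (2 * k + 1) = g k"
proof (induction n)
  case (Suc n)
  { case 1 then show ?case using Suc by (cases "k = n") (simp_all add: nth_append length_concat_pairs)
  next
    case 2 then show ?case using Suc by (cases "k = n") (simp_all add: nth_append length_concat_pairs) }
qed simp_all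

theorem corollary5p11:
  fixes B :: "('o, 'm) precat" and N :: nat and s :: int
  assumes "additive_category B" and "N \<ge> 2"
  shows "polygon_of_recollements (K_cat B N) (2 * N)
    (concat (map (\<lambda>r. [F_subcat B N (s + int r + 1) (N - 2), F_subcat B N (s + int r) 1]) [0..<N]))"
proof -
  interpret ncomplex_category B N
    using assms by (simp add: ncomplex_category_def ncomplex_category_axioms_def)
  let ?F = "F_subcat B N"
  let ?L = "\<lambda>n. concat (map (\<lambda>r. [?F (s + int r + 1) (N - 2), ?F (s + int r) 1]) [0..<n])"
  note len = length_concat_pairs and nth = nth_concat_pairs
  have "triangulated_subcat (K_cat B N) U" if "U \<in> set (?L N)" for U
    using that assms(2) by (auto intro!: triangulated_F)
  moreover have "stable_t_structure (K_cat B N) (?L N ! i) (?L N ! (Suc i mod (2 * N)))"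
    if i: "i < 2 * N" for i
  proof (cases "even i")
    case True
    \<comment> \<open>Even places are the pairs for \<open>r = 1\<close> with base
      \<open>s + k\<close>, since \<open>N - 1 - 1 = N - 2\<close>.\<close>
    then obtain k where k: "i = 2 * k" "k < N" using i by auto
    then have "Suc i mod (2 * N) = 2 * k + 1" by simp
    then show ?thesis
      using stable_t_structure_F[of 1 "s + int k"] assms(2) k(2)
      unfolding k(1) by (simp only: nth[OF k(2)]) (simp add: numeral_2_eq_2)
  next
    case False
    then obtain k where k: "i = 2 * k + 1" "k < N" using i by (auto elim: oddE)
    \<comment> \<open>Odd places are the pairs for \<open>r = N - 2\<close> with base
      \<open>s + k + 2\<close>. The left member is then based at \<open>s + k + N\<close>, which
      periodicity brings back to \<open>s + k\<close>.\<close>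
    have eq: "s + int k + 2 + int (N - 2) = s + int k + int N" "N - 1 - (N - 2) = 1"
      using assms(2) by auto
    have t: "stable_t_structure (K_cat B N) (?F (s + int k) 1) (?F (s + int k + 2) (N - 2))"
      using stable_t_structure_F[of "N - 2" "s + int k + 2"] assms(2)
      unfolding eq F_subcat_periodic by simp
    show ?thesis
    proof (cases "k + 1 < N")
      case True
      then have "Suc i mod (2 * N) = 2 * (k + 1)" using k by simp
      then show ?thesis
        using t unfolding k(1) by (simp only: nth[OF k(2)] nth[OF True]) (simp add: algebra_simps)
    next
      case False
      \<comment> \<open>The polygon closes here: for \<open>k = N - 1\<close> the base
        \<open>s + k + 2\<close> is \<open>s + 1 + N\<close>, a full period beyond the first
        entry.\<close>
      then have N: "N = k + 1" using k by simp
      then have "Suc i mod (2 * N) = 2 * 0" using k by simp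
      moreover have "?F (s + int 0 + 1) (N - 2) = ?F (s + int k + 2) (N - 2)"
        using F_subcat_periodic[of B N "s + 1" "N - 2"] N by (simp add: algebra_simps)
      moreover have "0 < N" using k by simp
      ultimately show ?thesis
        using t unfolding k(1) by (simp only: nth[OF k(2)] nth[OF \<open>0 < N\<close>])
    qed
  qed
  ultimately show ?thesis
    unfolding polygon_of_recollements_def by (simp only: len) blast
qed

end
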